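(* Let $\gamma>0$ and $\alpha\in(1,\infty)$, and let $$A(\alpha,\gamma)=\left\{x\in(0,1):\lim_{n\to\infty}\frac1n\left(a_1^\gamma+a_2^\gamma+\dots+a_n^\gamma\right)=\alpha\right\},$$ where $x=[a_1a_2a_3\dots]$ is the continued fraction expansion of $x$. Then $$\dim_H A(\alpha,\gamma)=\sup\left\{\frac{h(\mu)}{\lambda(\mu)}:\mu\in\mathcal{M}_G,\ \int\phi_\gamma\,d\mu=-\alpha\ \text{and}\ \lambda(\mu)<\infty\right\}.$$
   Context: The Gauss map is $G:(0,1]\to(0,1]$, $G(x)=\frac1x-\left[\frac1x\right]$. Irrational $x\in(0,1)$ are written as continued fractions $x=[a_1a_2a_3\dots]$ with $a_i\in\mathbb{N}$, and $\phi_\gamma(x)=-a_1^\gamma$, where $a_1=[1/x]$ is the first digit of $x$. $\mathcal{M}_G$ is the set of $G$-invariant probability measures, $h(\mu)$ the measure-theoretic entropy, $\lambda(\mu)=\int\log|G'|\,d\mu$, and $\dim_H$ is Hausdorff dimension. *)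

theory Defs
  imports "HOL-Probability.Probability"
begin

section \<open>Hausdorff dimension\<close>

text \<open>
  The size \<open>|U|\<^sup>s\<close> of a covering set.  Since \<^term>\<open>(0::real) powr s\<close> is always 0, the exponent
  \<open>s = 0\<close> is separated, so that the zero-dimensional Hausdorff measure is the counting measure.
\<close>

definition diam_power :: "real \<Rightarrow> 'a::metric_space set \<Rightarrow> real" where
  "diam_power s U = (if U = {} then 0 else if s = 0 then 1 else diameter U powr s)"

text \<open>
  The condition \<^const>\<open>bounded\<close> is needed because \<^const>\<open>diameter\<close> is a real number,
  unspecified on unbounded sets.  Finite covers are included by padding with empty sets.
\<close>

definition hausdorff_premeasure :: "real \<Rightarrow> real \<Rightarrow> 'a::metric_space set \<Rightarrow> ennreal" where
  "hausdorff_premeasure s \<delta> A =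
     (INF U \<in> {U :: nat \<Rightarrow> 'a set. A \<subseteq> (\<Union>i. U i) \<and> (\<forall>i. bounded (U i) \<and> diameter (U i) \<le> \<delta>)}.
        \<Sum>i. ennreal (diam_power s (U i)))"

definition hausdorff_measure :: "real \<Rightarrow> 'a::metric_space set \<Rightarrow> ennreal" where
  "hausdorff_measure s A = (SUP \<delta>\<in>{0<..}. hausdorff_premeasure s \<delta> A)"

definition hausdorff_dim :: "'a::metric_space set \<Rightarrow> ennreal" where
  "hausdorff_dim A = Inf {ennreal s | s. 0 \<le> s \<and> hausdorff_measure s A = 0}"


section \<open>Measure-theoretic entropy\<close>

definition partition_entropy :: "'a measure \<Rightarrow> 'a set set \<Rightarrow> real" where
  "partition_entropy \<mu> P = (\<Sum>A\<in>P. - measure \<mu> A * ln (measure \<mu> A))"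

text \<open>
  The join of \<open>P, T\<^sup>-\<^sup>1 P, \<dots>, T\<^sup>-\<^sup>(\<^sup>n\<^sup>-\<^sup>1\<^sup>) P\<close>.  It may also contain the empty set, which contributes 0
  to the entropy.
\<close>

definition iterated_partition :: "'a measure \<Rightarrow> ('a \<Rightarrow> 'a) \<Rightarrow> 'a set set \<Rightarrow> nat \<Rightarrow> 'a set set" where
  "iterated_partition \<mu> T P n =
     {{x \<in> space \<mu>. \<forall>i<n. (T ^^ i) x \<in> A i} | A. A \<in> {..<n} \<rightarrow> P}"

text \<open>The limit exists whenever \<open>T\<close> preserves \<open>\<mu>\<close>, by subadditivity.\<close>

definition entropy_wrt_partition :: "'a measure \<Rightarrow> ('a \<Rightarrow> 'a) \<Rightarrow> 'a set set \<Rightarrow> real" where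
  "entropy_wrt_partition \<mu> T P =
     lim (\<lambda>n. partition_entropy \<mu> (iterated_partition \<mu> T P n) / real n)"

definition measure_entropy :: "'a measure \<Rightarrow> ('a \<Rightarrow> 'a) \<Rightarrow> ennreal" where
  "measure_entropy \<mu> T =
     (SUP P \<in> {P. finite P \<and> partition_on (space \<mu>) P \<and> P \<subseteq> sets \<mu>}.
        ennreal (entropy_wrt_partition \<mu> T P))"


section \<open>The Gauss map\<close>

definition gauss_map :: "real \<Rightarrow> real" where
  "gauss_map x = 1 / x - of_int \<lfloor>1 / x\<rfloor>"

text \<open>The digit \<open>a\<^sub>n\<close> of an irrational number in \<open>(0,1)\<close>; digits are numbered from 1.\<close>

definition cf_digit :: "real \<Rightarrow> nat \<Rightarrow> nat" where
  "cf_digit x n = nat \<lfloor>1 / (gauss_map ^^ (n - 1)) x\<rfloor>"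

definition phi :: "real \<Rightarrow> real \<Rightarrow> real" where
  "phi \<gamma> x = - (real (cf_digit x 1) powr \<gamma>)"

text \<open>
  The \<open>G\<close>-invariant probability measures on \<open>(0,1]\<close>, represented as Borel measures on the line
  concentrated on \<open>(0,1]\<close>.  Since \<open>G\<close> maps each \<open>1/n\<close> to 0, which has measure zero, invariance
  forces all rationals to be null, so values of the functions above at rational points are
  irrelevant.
\<close>

definition gauss_invariant_measures :: "real measure set" where
  "gauss_invariant_measures =
     {\<mu>. prob_space \<mu> \<and> sets \<mu> = sets borel \<and> emeasure \<mu> {0<..1} = 1 \<and>
          distr \<mu> borel gauss_map = \<mu>}"

text \<open>
  At every irrational point of \<open>(0,1)\<close> the integrand is \<open>- 2 ln x > 0\<close>, hence nothing is lost by
  taking the integral in \<^typ>\<open>ennreal\<close>.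
\<close>

definition lyapunov_exponent :: "real measure \<Rightarrow> ennreal" where
  "lyapunov_exponent \<mu> = (\<integral>\<^sup>+ x. ennreal (ln \<bar>deriv gauss_map x\<bar>) \<partial>\<mu>)"

definition cf_mean_set :: "real \<Rightarrow> real \<Rightarrow> real set" where
  "cf_mean_set \<alpha> \<gamma> =
     {x \<in> {0<..<1} - \<rat>.
        (\<lambda>n. 1 / real n * (\<Sum>i=1..n. real (cf_digit x i) powr \<gamma>)) \<longlonglongrightarrow> \<alpha>}"

end

theory Submission
  imports Defs
begin

text \<open>
  Both sides are compared with finite probability distributions \<open>p\<close> on words of one length \<open>n\<close>.
  Write \<open>\<ell>(w)\<close> for twice the logarithm of the continuant of \<open>w\<close>, which up to an additive constant
  is the negative logarithm of the length of the cylinder of \<open>w\<close>.  Suppose that the mean digit sum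
  \<open>\<Sum>a\<^sub>i\<^sup>\<gamma>\<close> under \<open>p\<close> is \<open>n\<alpha>\<close> and that the entropy of \<open>p\<close> exceeds \<open>s\<close> times the mean of \<open>\<ell> + 2 ln 2\<close>.
  Concatenating independent words with law \<open>p\<close> gives points that almost surely lie in \<open>A(\<alpha>,\<gamma>)\<close>, and
  the mass distribution principle yields \<open>s \<le> dim A(\<alpha>,\<gamma>)\<close>; starting at a uniformly random position
  inside the first word gives a \<open>G\<close>-invariant measure with \<open>h/\<lambda> \<ge> s\<close>.

  Conversely such distributions exist for every \<open>s\<close> below either side.  If \<open>s < dim A(\<alpha>,\<gamma>)\<close>, then
  \<open>\<Sum>exp (- s \<ell>(w))\<close> over the words with digit mean close to \<open>\<alpha>\<close> stays bounded below as \<open>n\<close> grows, and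
  \<open>p\<close> is the normalised weight.  If \<open>s < h(\<mu>)/\<lambda>(\<mu>)\<close>, then \<open>p\<close> is the law under \<open>\<mu>\<close> of the first \<open>n\<close>
  digits, truncated at a large level.  In both cases the digit mean is only close to \<open>\<alpha>\<close>; giving a
  small probability to a constant word corrects it at a negligible cost.
\<close>

section \<open>Continued fraction words\<close>

text \<open>The alphabet of digits is infinite, so \<open>phi \<gamma>\<close> and the integrand of
  the Lyapunov exponent are unbounded. Finitely many words of one length remove this obstacle: all
  digits of the random points share a bound \<open>K\<close>, which gives laws of large numbers for
  bounded variables and a uniform lower bound for distances. On the side of the measures truncation
  is harmless: it only shrinks continuants, while entropy and digit mean are recovered for a large
  truncation level.

  All estimates rest on bounded distortion: on [0,1] the denominator of a Moebius map varies by at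
  most a factor 2. Each concatenation thus costs \<open>2 * ln 2\<close>, the term that accompanies
  the mean of \<open>cf_log\<close>. It becomes negligible since \<open>cf_log\<close> grows at
  least linearly in the length, and the same growth pays for correcting the mean. The condition
  \<alpha> > 1 leaves room for that correction: words of ones have digit mean 1, strictly below
  \<alpha>. The normalised weights are chosen because their entropy is exactly s times the mean of
  \<open>cf_log\<close> plus the logarithm of the normalising sum.\<close>

primrec cf_fold :: "nat list \<Rightarrow> real \<Rightarrow> real" where
  "cf_fold [] t = t"
| "cf_fold (a # w) t = 1 / (real a + cf_fold w t)"

text \<open>
  The denominator \<open>q\<^sub>n + t q\<^sub>n\<^sub>-\<^sub>1\<close> of the Moebius map \<^term>\<open>cf_fold w\<close>; its value at
  \<open>t = 0\<close> is the continuant of \<open>w\<close>.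
\<close>

primrec cf_den :: "nat list \<Rightarrow> real \<Rightarrow> real" where
  "cf_den [] t = 1"
| "cf_den (a # w) t = (real a + cf_fold w t) * cf_den w t"

definition cf_log :: "nat list \<Rightarrow> real" where
  "cf_log w = 2 * ln (cf_den w 0)"

section \<open>Continuants: distortion, growth and monotonicity\<close>

lemma cf_fold_nonneg: "0 \<le> t \<Longrightarrow> 0 \<le> cf_fold w t"
  by (induction w) auto

lemma cf_fold_le_one: "0 \<notin> set w \<Longrightarrow> 0 \<le> t \<Longrightarrow> t \<le> 1 \<Longrightarrow> cf_fold w t \<le> 1"
proof (induction w)
  case (Cons a w)
  then have "1 \<le> real a + cf_fold w t"
    using cf_fold_nonneg[of t w] by (cases a) auto
  then show ?case by simp
qed simp

lemma cf_den_ge_one: "0 \<notin> set w \<Longrightarrow> 0 \<le> t \<Longrightarrow> 1 \<le> cf_den w t"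
proof (induction w)
  case (Cons a w)
  then have "1 \<le> real a + cf_fold w t"
    using cf_fold_nonneg[of t w] by (cases a) auto
  then show ?case using Cons mult_mono[of 1 "real a + cf_fold w t" 1 "cf_den w t"] by simp
qed simp

lemma cf_den_pos: "0 \<notin> set w \<Longrightarrow> 0 \<le> t \<Longrightarrow> 0 < cf_den w t"
  using cf_den_ge_one[of w t] by linarith

lemma cf_log_nonneg: "0 \<notin> set w \<Longrightarrow> 0 \<le> cf_log w"
  using cf_den_ge_one[of w 0] by (simp add: cf_log_def)

lemma cf_fold_append: "cf_fold (u @ w) t = cf_fold u (cf_fold w t)"
  by (induction u) auto

lemma cf_den_append: "cf_den (u @ w) t = cf_den u (cf_fold w t) * cf_den w t"
  by (induction u) (auto simp: cf_fold_append)

text \<open>The three-term recurrence of continuants: \<open>cf_fold (b # w) t\<close> is the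
  reciprocal of the first factor of \<open>cf_den (b # w) t\<close>, so the product collapses. All
  terms are nonnegative, which suits the inductions below.\<close>

lemma cf_den_Cons_Cons:
  assumes "0 \<notin> set (b # w)" "0 \<le> t"
  shows "cf_den (a # b # w) t = real a * cf_den (b # w) t + cf_den w t"
proof -
  have "real b + cf_fold w t > 0"
    using assms cf_fold_nonneg[of t w] by (cases b) auto
  then show ?thesis by (simp add: field_simps)
qed

text \<open>In \<open>t\<close> the denominator is affine, with slope the previous continuant, which
  is at most the value at 0. The recurrence passes both inequalities on from the two shorter words,
  so the slope never has to be named.\<close>

lemma cf_den_distortion:
  assumes "0 \<notin> set w" "0 \<le> t" "t \<le> 1"
  shows "cf_den w 0 \<le> cf_den w t \<and> cf_den w t \<le> 2 * cf_den w 0"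
  using assms(1)
proof (induction w rule: induct_list012)
  case (2 a)
  then show ?case using assms by (cases a) auto
next
  case (3 a b w)
  have IH: "cf_den (b # w) 0 \<le> cf_den (b # w) t \<and> cf_den (b # w) t \<le> 2 * cf_den (b # w) 0"
    "cf_den w 0 \<le> cf_den w t \<and> cf_den w t \<le> 2 * cf_den w 0"
    using 3 by auto
  have "real a * cf_den (b # w) 0 \<le> real a * cf_den (b # w) t"
    "real a * cf_den (b # w) t \<le> real a * (2 * cf_den (b # w) 0)"
    using IH by (intro mult_left_mono; simp)+
  moreover have eq: "cf_den (a # b # w) s = real a * cf_den (b # w) s + cf_den w s" if "s \<in> {0,t}" for s
    using 3 assms that by (intro cf_den_Cons_Cons) auto
  ultimately show ?case
    using IH unfolding eq[of 0, simplified] eq[of t, simplified] by auto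
qed simp

text \<open>The Moebius map of a word has determinant 1 or -1, so its difference quotient is, up to
  sign, the reciprocal of the product of the two denominators.\<close>

lemma cf_fold_diff:
  assumes "0 \<notin> set w" "0 \<le> s" "0 \<le> t"
  shows "\<bar>cf_fold w s - cf_fold w t\<bar> = \<bar>s - t\<bar> / (cf_den w s * cf_den w t)"
  using assms(1)
proof (induction w)
  case (Cons a w)
  let ?u = "real a + cf_fold w s" and ?v = "real a + cf_fold w t"
  have pos: "?u > 0" "?v > 0"
    using Cons assms cf_fold_nonneg[of t w] cf_fold_nonneg[of s w] by (cases a; simp)+
  have "1 / ?u - 1 / ?v = (cf_fold w t - cf_fold w s) / (?u * ?v)"
    using pos by (simp add: field_simps)
  then have "\<bar>1 / ?u - 1 / ?v\<bar> = \<bar>cf_fold w s - cf_fold w t\<bar> / (?u * ?v)"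
    using pos by (simp add: abs_mult abs_minus_commute)
  then show ?case using Cons by (simp add: mult_ac)
qed simp

lemma cf_den_Cons_mono:
  assumes "0 \<notin> set (a # w)"
  shows "cf_den w 0 \<le> cf_den (a # w) 0"
proof -
  have "1 \<le> real a + cf_fold w 0"
    using assms cf_fold_nonneg[of 0 w] by (cases a) auto
  then show ?thesis
    using mult_right_mono[of 1 "real a + cf_fold w 0" "cf_den w 0"] cf_den_pos[of w 0] assms by auto
qed

text \<open>Prepending two digits at least doubles the continuant. The square avoids half-integer
  exponents and fits the factor 2 in \<open>cf_log\<close>; the exponent is
  \<open>length w - 1\<close> because the word \<open>[1]\<close> has continuant 1.\<close>

lemma cf_den_growth: "0 \<notin> set w \<Longrightarrow> 2 ^ (length w - 1) \<le> (cf_den w 0)\<^sup>2"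
proof (induction w rule: induct_list012)
  case (2 a)
  then show ?case by (cases a) auto
next
  case (3 a b w)
  have "cf_den w 0 \<le> cf_den (b # w) 0" using 3 by (intro cf_den_Cons_mono) auto
  moreover have "1 * cf_den (b # w) 0 \<le> real a * cf_den (b # w) 0"
    using 3 cf_den_pos[of "b # w" 0] by (intro mult_right_mono) (cases a, auto)
  moreover have "cf_den (a # b # w) 0 = real a * cf_den (b # w) 0 + cf_den w 0"
    using 3 by (intro cf_den_Cons_Cons) auto
  ultimately have "2 * cf_den w 0 \<le> cf_den (a # b # w) 0" by linarith
  then have "(2 * cf_den w 0)\<^sup>2 \<le> (cf_den (a # b # w) 0)\<^sup>2"
    using cf_den_pos[of w 0] 3 by (intro power_mono) auto
  moreover have "4 * 2 ^ (length w - 1) \<le> 4 * (cf_den w 0)\<^sup>2" using 3 by auto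
  moreover have "(2::real) ^ (length w + 1) \<le> 4 * 2 ^ (length w - 1)"
    by (cases w) auto
  ultimately show ?case by (simp add: power_mult_distrib)
qed simp

lemma cf_log_growth: "0 \<notin> set w \<Longrightarrow> real (length w - 1) * ln 2 \<le> cf_log w"
proof -
  assume nz: "0 \<notin> set w"
  have "ln (2 ^ (length w - 1)) \<le> ln ((cf_den w 0)\<^sup>2)"
    using cf_den_growth[OF nz] cf_den_pos[OF nz, of 0] by (intro ln_mono) auto
  then show ?thesis
    using cf_den_pos[OF nz, of 0] by (simp add: cf_log_def ln_realpow del: One_nat_def)
qed

text \<open>Larger digits enlarge every term of the recurrence. This is what allows digits to be
  truncated without increasing \<open>cf_log\<close>.\<close>

lemma cf_den_mono:
  assumes "list_all2 (\<le>) u w" "0 \<notin> set u"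
  shows "cf_den u 0 \<le> cf_den w 0"
  using assms
proof (induction u arbitrary: w rule: induct_list012)
  case (2 a)
  then show ?case by (auto simp: list_all2_Cons1)
next
  case (3 a b v)
  from "3.prems" obtain a' b' w' where w: "w = a' # b' # w'" "a \<le> a'" "b \<le> b'" "list_all2 (\<le>) v w'"
    by (auto simp: list_all2_Cons1)
  have nz: "0 \<notin> set w"
    using 3(3,4) by (metis le_zero_eq list_all2_conv_all_nth in_set_conv_nth)
  have "cf_den (b # v) 0 \<le> cf_den (b' # w') 0" "cf_den v 0 \<le> cf_den w' 0"
    using "3.IH"(2)[of "b' # w'"] "3.IH"(1)[of w'] "3.prems" w by (auto simp del: cf_den.simps)
  moreover have "real a * cf_den (b # v) 0 \<le> real a' * cf_den (b' # w') 0"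
    using w calculation cf_den_pos[of "b # v" 0] "3.prems" by (intro mult_mono) auto
  moreover have "cf_den (a # b # v) 0 = real a * cf_den (b # v) 0 + cf_den v 0"
    using 3 by (intro cf_den_Cons_Cons) auto
  moreover have "cf_den (a' # b' # w') 0 = real a' * cf_den (b' # w') 0 + cf_den w' 0"
    using nz w by (intro cf_den_Cons_Cons) auto
  ultimately show ?case unfolding w by linarith
qed auto

lemma cf_den_le_power:
  assumes "0 \<notin> set w" "\<And>a. a \<in> set w \<Longrightarrow> a \<le> K"
  shows "cf_den w 0 \<le> (real K + 1) ^ length w"
  using assms
proof (induction w)
  case (Cons a w)
  have "cf_fold w 0 \<le> 1" using Cons by (intro cf_fold_le_one) auto
  then have "real a + cf_fold w 0 \<le> real K + 1" using Cons.prems(2)[of a] by auto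
  moreover have "cf_den w 0 \<le> (real K + 1) ^ length w" using Cons by auto
  ultimately show ?case
    using cf_den_pos[of w 0] Cons by (auto intro!: mult_mono)
qed simp

lemma cf_log_le:
  assumes "0 \<notin> set w" "\<And>a. a \<in> set w \<Longrightarrow> a \<le> K"
  shows "cf_log w \<le> 2 * real (length w) * ln (real K + 1)"
proof -
  have "ln (cf_den w 0) \<le> ln ((real K + 1) ^ length w)"
    using cf_den_le_power[OF assms] cf_den_pos[of w 0] assms(1) by (intro ln_mono) auto
  then show ?thesis by (simp add: cf_log_def ln_realpow)
qed

text \<open>The prefix \<open>u\<close> is evaluated at \<open>cf_fold w 0\<close>, a point of
  [0,1], instead of at 0; distortion bounds the loss by a factor 2, which becomes
  \<open>2 * ln 2\<close>.\<close>

lemma cf_log_append: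
  assumes "0 \<notin> set u" "0 \<notin> set w"
  shows "cf_log (u @ w) \<le> cf_log u + cf_log w + 2 * ln 2"
proof -
  have t: "0 \<le> cf_fold w 0" "cf_fold w 0 \<le> 1"
    using assms by (auto intro: cf_fold_nonneg cf_fold_le_one)
  have "cf_den (u @ w) 0 \<le> 2 * cf_den u 0 * cf_den w 0"
    using cf_den_distortion[OF assms(1) t] cf_den_pos[OF assms(2), of 0]
    by (simp add: cf_den_append)
  moreover have "0 < cf_den (u @ w) 0" using assms by (intro cf_den_pos) auto
  ultimately have "ln (cf_den (u @ w) 0) \<le> ln (2 * cf_den u 0 * cf_den w 0)"
    by (intro ln_mono) auto
  also have "\<dots> = ln 2 + ln (cf_den u 0) + ln (cf_den w 0)"
    using cf_den_pos[OF assms(1), of 0] cf_den_pos[OF assms(2), of 0] by (simp add: ln_mult)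
  finally show ?thesis by (simp add: cf_log_def)
qed

lemma cf_log_concat:
  assumes "\<And>w. w \<in> set ws \<Longrightarrow> 0 \<notin> set w"
  shows "cf_log (concat ws) \<le> (\<Sum>w\<leftarrow>ws. cf_log w + 2 * ln 2)"
  using assms
proof (induction ws)
  case (Cons w ws)
  then show ?case using cf_log_append[of w "concat ws"] by auto
qed (simp add: cf_log_def)

lemma cf_fold_diff_le:
  assumes "0 \<notin> set w" "0 \<le> s" "s \<le> 1" "0 \<le> t" "t \<le> 1"
  shows "\<bar>cf_fold w s - cf_fold w t\<bar> \<le> \<bar>s - t\<bar> * exp (- cf_log w)"
proof -
  have p: "0 < cf_den w 0" using assms by (intro cf_den_pos) auto
  have "(cf_den w 0)\<^sup>2 \<le> cf_den w s * cf_den w t"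
    using cf_den_distortion[of w s] cf_den_distortion[of w t] p assms
    by (auto simp: power2_eq_square intro!: mult_mono)
  moreover have "exp (- cf_log w) = 1 / (cf_den w 0)\<^sup>2"
    using p by (simp add: cf_log_def exp_minus exp_double field_simps)
  ultimately show ?thesis
    using p by (subst cf_fold_diff) (auto simp: assms intro!: divide_left_mono mult_pos_pos cf_den_pos)
qed

text \<open>Each of the two denominators may be twice its value at 0, whence the factor 4.\<close>

lemma cf_fold_diff_ge:
  assumes "0 \<notin> set w" "0 \<le> s" "s \<le> 1" "0 \<le> t" "t \<le> 1"
  shows "\<bar>s - t\<bar> * exp (- cf_log w) \<le> 4 * \<bar>cf_fold w s - cf_fold w t\<bar>"
proof -
  have p: "0 < cf_den w 0" using assms by (intro cf_den_pos) auto
  have "cf_den w s * cf_den w t \<le> (2 * cf_den w 0) * (2 * cf_den w 0)"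
    using cf_den_distortion[of w s] cf_den_distortion[of w t] p assms
    by (intro mult_mono) (auto intro: order.trans[OF less_imp_le[OF p]])
  then have "\<bar>s - t\<bar> / (4 * (cf_den w 0)\<^sup>2) \<le> \<bar>s - t\<bar> / (cf_den w s * cf_den w t)"
    using p assms by (intro divide_left_mono) (auto simp: power2_eq_square intro!: mult_pos_pos cf_den_pos)
  moreover have "exp (- cf_log w) = 1 / (cf_den w 0)\<^sup>2"
    using p by (simp add: cf_log_def exp_minus exp_double field_simps)
  ultimately show ?thesis
    by (subst cf_fold_diff) (auto simp: assms)
qed

section \<open>Digit words along orbits of the Gauss map\<close>

definition cf_word :: "real \<Rightarrow> nat \<Rightarrow> nat list" where
  "cf_word x n = map (\<lambda>i. nat \<lfloor>1 / (gauss_map ^^ i) x\<rfloor>) [0..<n]"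

lemma length_cf_word [simp]: "length (cf_word x n) = n"
  by (simp add: cf_word_def)

lemma cf_word_Suc: "cf_word x (Suc n) = nat \<lfloor>1 / x\<rfloor> # cf_word (gauss_map x) n"
  unfolding cf_word_def upt_conv_Cons[OF zero_less_Suc] map_Suc_upt[symmetric]
  by (simp add: funpow_swap1 del: upt_Suc map_Suc_upt)

text \<open>Points whose orbit avoids the endpoints; on \<open>(0,1)\<close> these are the irrational numbers.\<close>

definition cf_points :: "real set" where
  "cf_points = {x. \<forall>n. (gauss_map ^^ n) x \<in> {0<..<1}}"

lemma cf_pointsD: "x \<in> cf_points \<Longrightarrow> 0 < x" "x \<in> cf_points \<Longrightarrow> x < 1"
  unfolding cf_points_def using funpow_0[of gauss_map x] by (metis (mono_tags, lifting) greaterThanLessThan_iff mem_Collect_eq)+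

lemma gauss_map_cf_points: "x \<in> cf_points \<Longrightarrow> gauss_map x \<in> cf_points"
  unfolding cf_points_def by (auto simp: funpow_swap1[symmetric]; metis funpow_simps_right(2) o_apply greaterThanLessThan_iff funpow.simps(2))

lemma funpow_gauss_map_cf_points: "x \<in> cf_points \<Longrightarrow> (gauss_map ^^ n) x \<in> cf_points"
  by (induction n) (auto simp: gauss_map_cf_points)

lemma cf_points_expand:
  assumes "x \<in> cf_points"
  shows "x = 1 / (real (nat \<lfloor>1 / x\<rfloor>) + gauss_map x)" "0 < nat \<lfloor>1 / x\<rfloor>"
proof -
  have "1 / x \<ge> 1" using cf_pointsD[OF assms] by simp
  then have "\<lfloor>1 / x\<rfloor> \<ge> 1" by (simp only: le_floor_iff of_int_1)
  then show "0 < nat \<lfloor>1 / x\<rfloor>" by simp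
  have "real (nat \<lfloor>1 / x\<rfloor>) + gauss_map x = 1 / x"
    using order.trans[OF zero_le_one \<open>\<lfloor>1 / x\<rfloor> \<ge> 1\<close>] by (simp add: gauss_map_def)
  then show "x = 1 / (real (nat \<lfloor>1 / x\<rfloor>) + gauss_map x)" by simp
qed

lemma cf_word_nonzero: "x \<in> cf_points \<Longrightarrow> 0 \<notin> set (cf_word x n)"
  using cf_points_expand(2)[OF funpow_gauss_map_cf_points, of x] unfolding cf_word_def set_map
  by (metis (no_types, lifting) image_iff less_irrefl)

lemma cf_fold_cf_word: "x \<in> cf_points \<Longrightarrow> cf_fold (cf_word x n) ((gauss_map ^^ n) x) = x"
proof (induction n arbitrary: x)
  case (Suc n)
  then show ?case
    using Suc.IH[OF gauss_map_cf_points[OF Suc.prems]] cf_points_expand(1)[OF Suc.prems]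
    by (simp add: cf_word_Suc funpow_swap1)
qed (simp add: cf_word_def)

text \<open>Since 1/x is the first digit plus \<open>gauss_map x\<close>, every factor of the
  denominator, evaluated at the tail, is the reciprocal of an orbit point. Its logarithm is thus
  exactly a Birkhoff sum.\<close>

lemma ln_cf_den_cf_word:
  "x \<in> cf_points \<Longrightarrow> ln (cf_den (cf_word x n) ((gauss_map ^^ n) x)) = (\<Sum>i<n. - ln ((gauss_map ^^ i) x))"
proof (induction n arbitrary: x)
  case (Suc n)
  have g: "gauss_map x \<in> cf_points" by (rule gauss_map_cf_points[OF Suc.prems])
  have "cf_den (cf_word x (Suc n)) ((gauss_map ^^ Suc n) x) =
      1 / x * cf_den (cf_word (gauss_map x) n) ((gauss_map ^^ n) (gauss_map x))"
  proof -
    have "real (nat \<lfloor>1 / x\<rfloor>) + gauss_map x = 1 / x"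
      using arg_cong[OF cf_points_expand(1)[OF Suc.prems], of "\<lambda>y. 1 / y"] by simp
    then show ?thesis
      using cf_fold_cf_word[OF g, of n] by (simp add: cf_word_Suc funpow_swap1)
  qed
  moreover have "cf_den (cf_word (gauss_map x) n) ((gauss_map ^^ n) (gauss_map x)) > 0"
    using cf_word_nonzero[OF g] cf_pointsD(1)[OF funpow_gauss_map_cf_points[OF g]]
    by (intro cf_den_pos) (auto intro: less_imp_le)
  ultimately have "ln (cf_den (cf_word x (Suc n)) ((gauss_map ^^ Suc n) x)) =
      - ln x + (\<Sum>i<n. - ln ((gauss_map ^^ i) (gauss_map x)))"
    using Suc.IH[OF g] cf_pointsD[OF Suc.prems] by (simp add: ln_mult ln_div)
  then show ?case by (simp add: sum.lessThan_Suc_shift funpow_swap1 del: sum.lessThan_Suc)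
qed (simp add: cf_word_def)

text \<open>Replacing the tail by 0 lowers the denominator by at most a factor 2. So
  \<open>cf_log\<close> is, up to \<open>2 * ln 2\<close>, the Birkhoff sum of the integrand of the
  Lyapunov exponent.\<close>

lemma cf_log_cf_word_bounds:
  assumes "x \<in> cf_points"
  shows "cf_log (cf_word x n) \<le> (\<Sum>i<n. - 2 * ln ((gauss_map ^^ i) x))"
    "(\<Sum>i<n. - 2 * ln ((gauss_map ^^ i) x)) \<le> cf_log (cf_word x n) + 2 * ln 2"
proof -
  let ?w = "cf_word x n" and ?t = "(gauss_map ^^ n) x"
  have nz: "0 \<notin> set ?w" by (rule cf_word_nonzero[OF assms])
  have t: "0 \<le> ?t" "?t \<le> 1"
    using cf_pointsD[OF funpow_gauss_map_cf_points[OF assms, of n]] by auto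
  have eq: "(\<Sum>i<n. - 2 * ln ((gauss_map ^^ i) x)) = 2 * ln (cf_den ?w ?t)"
    unfolding ln_cf_den_cf_word[OF assms] by (simp add: sum_distrib_left)
  have p: "0 < cf_den ?w 0" "0 < cf_den ?w ?t" using nz t by (auto intro: cf_den_pos)
  have d: "cf_den ?w 0 \<le> cf_den ?w ?t" "cf_den ?w ?t \<le> 2 * cf_den ?w 0"
    using cf_den_distortion[OF nz t] by auto
  show "cf_log ?w \<le> (\<Sum>i<n. - 2 * ln ((gauss_map ^^ i) x))"
    unfolding eq cf_log_def using d p by simp
  have "ln (cf_den ?w ?t) \<le> ln (2 * cf_den ?w 0)" using d p by (intro ln_mono) auto
  then show "(\<Sum>i<n. - 2 * ln ((gauss_map ^^ i) x)) \<le> cf_log ?w + 2 * ln 2"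
    unfolding eq cf_log_def using p by (simp add: ln_mult)
qed

lemma irrational_cf_points:
  assumes "x \<in> {0<..<1} - \<rat>"
  shows "x \<in> cf_points"
proof -
  have step: "gauss_map y \<in> {0<..<1} - \<rat>" if "y \<in> {0<..<1} - \<rat>" for y
  proof -
    have irr: "gauss_map y \<notin> \<rat>"
    proof
      assume "gauss_map y \<in> \<rat>"
      then have "gauss_map y + of_int \<lfloor>1 / y\<rfloor> \<in> \<rat>" by (intro Rats_add Rats_of_int)
      then have "inverse (1 / y) \<in> \<rat>" unfolding gauss_map_def by (intro Rats_inverse) simp
      then show False using that by simp
    qed
    have "0 \<le> gauss_map y" "gauss_map y < 1" unfolding gauss_map_def by linarith+
    moreover have "gauss_map y \<noteq> 0" using irr by auto
    ultimately show ?thesis using irr by auto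
  qed
  have "(gauss_map ^^ n) x \<in> {0<..<1} - \<rat>" for n
    by (induction n) (use assms step in auto)
  then show ?thesis unfolding cf_points_def by auto
qed

text \<open>Euclid's algorithm: the Gauss map sends p/q to (q mod p)/p, whose denominator is
  smaller, so no orbit of a rational number stays inside (0,1).\<close>

lemma cf_points_irrational:
  assumes "x \<in> cf_points"
  shows "x \<notin> \<rat>"
proof
  have "\<forall>p. real p / real q \<notin> cf_points" for q
  proof (induction q rule: less_induct)
    case (less q)
    show ?case
    proof (intro allI notI)
      fix p assume r: "real p / real q \<in> cf_points"
      have pq: "0 < p" "0 < q" "p < q"
        using cf_pointsD[OF r] by (auto simp: field_simps zero_less_divide_iff)
      have "gauss_map (real p / real q) = real (q mod p) / real p"
        using pq by (simp add: gauss_map_def floor_divide_of_nat_eq field_simps of_nat_mod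
            flip: of_nat_mult of_nat_add)
      then have "real (q mod p) / real p \<in> cf_points"
        using gauss_map_cf_points[OF r] by simp
      then show False using less[of p] pq by auto
    qed
  qed note no = this
  assume "x \<in> \<rat>"
  then obtain m n :: int where mn: "n > 0" "x = of_int m / of_int n"
    by (auto elim!: Rats_cases')
  then have "m \<ge> 0" using cf_pointsD(1)[OF assms] by (auto simp: zero_less_divide_iff)
  then have "x = real (nat m) / real (nat n)" using mn by simp
  then show False using no assms by metis
qed

section \<open>Infinite continued fractions with prescribed digits\<close>

definition cf_lim :: "(nat \<Rightarrow> nat) \<Rightarrow> real" where
  "cf_lim d = lim (\<lambda>n. cf_fold (map d [0..<n]) 0)"

lemma cf_fold_convergent:
  assumes "\<And>i. 0 < d i"
  shows "(\<lambda>n. cf_fold (map d [0..<n]) 0) \<longlonglongrightarrow> cf_lim d"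
proof -
  let ?c = "\<lambda>n. cf_fold (map d [0..<n]) 0"
  have nz: "0 \<notin> set (map d xs)" for xs
    using assms by (auto simp: image_iff)
  \<comment> \<open>All convergents from the n-th on lie in the image of [0,1] under the Moebius map
    of the first \<open>n\<close> digits, whose length decays exponentially.\<close>
  have bound: "\<bar>?c m - ?c n\<bar> \<le> exp (- (real (n - 1) * ln 2))" if "n \<le> m" for m n
  proof -
    let ?t = "cf_fold (map d [n..<m]) 0"
    have t: "0 \<le> ?t" "?t \<le> 1" by (intro cf_fold_nonneg cf_fold_le_one nz order.refl zero_le_one)+
    have "?c m = cf_fold (map d [0..<n]) ?t"
      using upt_add_eq_append[of 0 n "m - n"] that by (simp flip: cf_fold_append map_append)
    then have "\<bar>?c m - ?c n\<bar> \<le> \<bar>?t - 0\<bar> * exp (- cf_log (map d [0..<n]))"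
      using cf_fold_diff_le[OF nz, of ?t 0] t by simp
    also have "\<dots> \<le> 1 * exp (- (real (n - 1) * ln 2))"
      using t cf_log_growth[OF nz, of "[0..<n]"] by (intro mult_mono) auto
    finally show ?thesis by simp
  qed
  have "Cauchy ?c"
  proof (rule metric_CauchyI)
    fix e :: real assume e: "e > 0"
    obtain n where n: "(1/2::real) ^ n < e / 2"
      using real_arch_pow_inv[of "e / 2" "1/2"] e by auto
    have "exp (- (real (Suc n - 1) * ln 2)) = (1/2::real) ^ n"
      by (simp add: exp_minus exp_of_nat_mult power_one_over inverse_eq_divide)
    then have b: "\<bar>?c m - ?c (Suc n)\<bar> < e / 2" if "Suc n \<le> m" for m
      using bound[OF that] n by linarith
    show "\<exists>N. \<forall>m\<ge>N. \<forall>k\<ge>N. dist (?c m) (?c k) < e"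
    proof (intro exI allI impI)
      fix m k assume "Suc n \<le> m" "Suc n \<le> k"
      then show "dist (?c m) (?c k) < e" using b[of m] b[of k] unfolding dist_real_def by linarith
    qed
  qed
  then show ?thesis
    unfolding cf_lim_def by (simp add: Cauchy_convergent_iff convergent_LIMSEQ_iff)
qed

lemma cf_lim_bounds:
  assumes "\<And>i. 0 < d i"
  shows "0 \<le> cf_lim d" "cf_lim d \<le> 1"
proof -
  have nz: "0 \<notin> set (map d xs)" for xs
    using assms by (auto simp: image_iff)
  show "0 \<le> cf_lim d"
    by (rule LIMSEQ_le_const[OF cf_fold_convergent[OF assms]]) (auto intro: cf_fold_nonneg)
  show "cf_lim d \<le> 1"
    by (rule LIMSEQ_le_const2[OF cf_fold_convergent[OF assms]])
      (intro exI allI impI cf_fold_le_one nz order.refl zero_le_one)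
qed

lemma cf_lim_expand:
  assumes "\<And>i. 0 < d i"
  shows "cf_lim d = 1 / (real (d 0) + cf_lim (\<lambda>i. d (Suc i)))"
proof -
  have "(\<lambda>n. cf_fold (map d [0..<Suc n]) 0) = (\<lambda>n. 1 / (real (d 0) + cf_fold (map (\<lambda>i. d (Suc i)) [0..<n]) 0))"
    unfolding upt_conv_Cons[OF zero_less_Suc] map_Suc_upt[symmetric]
    by (simp add: comp_def del: upt_Suc map_Suc_upt)
  moreover have "(\<lambda>n. 1 / (real (d 0) + cf_fold (map (\<lambda>i. d (Suc i)) [0..<n]) 0)) \<longlonglongrightarrow>
      1 / (real (d 0) + cf_lim (\<lambda>i. d (Suc i)))"
  proof (intro tendsto_intros cf_fold_convergent assms)
    show "real (d 0) + cf_lim (\<lambda>i. d (Suc i)) \<noteq> 0"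
      using cf_lim_bounds(1)[of "\<lambda>i. d (Suc i)", OF assms] assms[of 0] by linarith
  qed
  ultimately have "(\<lambda>n. cf_fold (map d [0..<Suc n]) 0) \<longlonglongrightarrow> 1 / (real (d 0) + cf_lim (\<lambda>i. d (Suc i)))"
    by simp
  moreover have "(\<lambda>n. cf_fold (map d [0..<Suc n]) 0) \<longlonglongrightarrow> cf_lim d"
    using LIMSEQ_Suc[OF cf_fold_convergent[OF assms]] .
  ultimately show ?thesis using LIMSEQ_unique by blast
qed

lemma cf_lim_strict_bounds:
  assumes "\<And>i. 0 < d i"
  shows "0 < cf_lim d" "cf_lim d < 1"
proof -
  have pos: "0 < cf_lim e" if "\<And>i. 0 < e i" for e
    using cf_lim_expand[of e, OF that] cf_lim_bounds(1)[of "\<lambda>i. e (Suc i)", OF that] that[of 0]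
    by (simp add: add_pos_nonneg)
  show "0 < cf_lim d" by (rule pos[OF assms])
  have "0 < cf_lim (\<lambda>i. d (Suc i))" by (rule pos) (rule assms)
  then have "1 < real (d 0) + cf_lim (\<lambda>i. d (Suc i))" using assms[of 0] by linarith
  then show "cf_lim d < 1" using cf_lim_expand[of d] assms by simp
qed

lemma floor_cf_lim:
  assumes "\<And>i. 0 < d i"
  shows "\<lfloor>1 / cf_lim d\<rfloor> = int (d 0)"
  using cf_lim_expand[of d] cf_lim_strict_bounds[of "\<lambda>i. d (Suc i)"] assms
  by (simp add: floor_unique)

lemma gauss_map_cf_lim:
  assumes "\<And>i. 0 < d i"
  shows "gauss_map (cf_lim d) = cf_lim (\<lambda>i. d (Suc i))"
  using cf_lim_expand[of d] floor_cf_lim[of d] assms by (simp add: gauss_map_def)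

lemma funpow_gauss_map_cf_lim:
  assumes "\<And>i. 0 < d i"
  shows "(gauss_map ^^ n) (cf_lim d) = cf_lim (\<lambda>i. d (i + n))"
proof (induction n)
  case (Suc n)
  then show ?case using gauss_map_cf_lim[of "\<lambda>i. d (i + n)"] assms by simp
qed simp

lemma cf_lim_cf_points:
  assumes "\<And>i. 0 < d i"
  shows "cf_lim d \<in> cf_points"
  unfolding cf_points_def
  using cf_lim_strict_bounds[of "\<lambda>i. d (i + n)" for n] assms
  by (auto simp: funpow_gauss_map_cf_lim[of d, OF assms])

lemma cf_digit_cf_lim:
  assumes "\<And>i. 0 < d i"
  shows "cf_digit (cf_lim d) (Suc n) = d n"
  using floor_cf_lim[of "\<lambda>i. d (i + n)"] assms
  by (simp add: cf_digit_def funpow_gauss_map_cf_lim[of d, OF assms])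

lemma cf_word_cf_lim:
  assumes "\<And>i. 0 < d i"
  shows "cf_word (cf_lim d) n = map d [0..<n]"
proof -
  have "nat \<lfloor>1 / (gauss_map ^^ i) (cf_lim d)\<rfloor> = d i" for i
    using cf_digit_cf_lim[of d i, OF assms] by (simp add: cf_digit_def)
  then show ?thesis by (simp add: cf_word_def)
qed

text \<open>Bounded digits keep tails away from 1: the tail of \<open>u\<close> is at least 1/(K+1),
  so \<open>u\<close> is at most 1 - 1/(K+2). Hence \<open>d 0 + u\<close> and
  \<open>e 0 + v\<close> differ by at least 1/(K+2) even if \<open>e 0\<close> is
  \<open>d 0 + 1\<close>. Dividing by the two denominators, each at most K+2, gives the
  cube.\<close>

lemma cf_lim_separation_first_digit:
  assumes d: "\<And>i. 0 < d i" "\<And>i. d i \<le> K" and e: "\<And>i. 0 < e i" "\<And>i. e i \<le> K"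
    and "d 0 < e 0"
  shows "1 / (real K + 2) ^ 3 \<le> cf_lim d - cf_lim e"
proof -
  define u where "u = cf_lim (\<lambda>i. d (Suc i))"
  define v where "v = cf_lim (\<lambda>i. e (Suc i))"
  have lower: "1 / (real K + 1) \<le> cf_lim f" if "\<And>i. 0 < f i" "\<And>i. f i \<le> K" for f
  proof -
    have "real (f 0) + cf_lim (\<lambda>i. f (Suc i)) \<le> real K + 1"
      using that(2)[of 0] cf_lim_bounds(2)[of "\<lambda>i. f (Suc i)"] that(1) by simp
    moreover have "0 < real (f 0) + cf_lim (\<lambda>i. f (Suc i))"
      using that(1)[of 0] cf_lim_bounds(1)[of "\<lambda>i. f (Suc i)"] that(1) by (simp add: add_pos_nonneg)
    ultimately show ?thesis
      using cf_lim_expand[of f] that(1) by (simp add: frac_le)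
  qed
  have "1 + 1 / (real K + 1) \<le> real (d 1) + cf_lim (\<lambda>i. d (Suc (Suc i)))"
    using d(1)[of 1] lower[of "\<lambda>i. d (Suc (Suc i))"] d by (simp add: Suc_le_eq add_mono)
  then have "u \<le> 1 / (1 + 1 / (real K + 1))"
    using cf_lim_expand[of "\<lambda>i. d (Suc i)"] d unfolding u_def
    by (simp add: frac_le add_pos_nonneg)
  also have "\<dots> = 1 - 1 / (real K + 2)" by (simp add: field_simps)
  finally have u: "u \<le> 1 - 1 / (real K + 2)" .
  have v: "0 \<le> v" "v \<le> 1" "0 \<le> u" using cf_lim_bounds d e unfolding v_def u_def by auto
  have p: "0 < real (d 0) + u" "0 < real (e 0) + v" using d(1)[of 0] e(1)[of 0] v by auto
  have "cf_lim d - cf_lim e = ((real (e 0) + v) - (real (d 0) + u)) / ((real (d 0) + u) * (real (e 0) + v))"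
  proof -
    have "cf_lim d = 1 / (real (d 0) + u)" "cf_lim e = 1 / (real (e 0) + v)"
      using cf_lim_expand[of d] cf_lim_expand[of e] d e unfolding u_def v_def by auto
    then show ?thesis using p by (simp add: diff_frac_eq)
  qed
  also have "\<dots> \<ge> (1 / (real K + 2)) / ((real K + 2) * (real K + 2))"
  proof (rule frac_le)
    have "real (d 0) + 1 \<le> real (e 0)" using assms(5) by linarith
    then show "1 / (real K + 2) \<le> (real (e 0) + v) - (real (d 0) + u)" using u v by linarith
    then show "0 \<le> (real (e 0) + v) - (real (d 0) + u)" by (rule order.trans[rotated]) simp
    have "u \<le> 1" using u by (rule order.trans) simp
    then show "(real (d 0) + u) * (real (e 0) + v) \<le> (real K + 2) * (real K + 2)"
      using d(2)[of 0] e(2)[of 0] p v by (intro mult_mono) auto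
    show "0 < (real (d 0) + u) * (real (e 0) + v)" using p by simp
  qed
  finally show ?thesis by (simp add: power3_eq_cube mult.assoc)
qed

text \<open>The Moebius map of the common prefix carries the separation of the tails over to the
  points. Since adjacent cylinders touch, only a digit bound yields such an estimate; it turns
  closeness of points into a long common prefix.\<close>

lemma cf_lim_separation:
  assumes d: "\<And>i. 0 < d i" "\<And>i. d i \<le> K" and e: "\<And>i. 0 < e i" "\<And>i. e i \<le> K"
    and "\<And>i. i < j \<Longrightarrow> d i = e i" "d j \<noteq> e j"
  shows "exp (- cf_log (map d [0..<j])) / (real K + 2) ^ 3 \<le> 4 * \<bar>cf_lim d - cf_lim e\<bar>"
proof -
  define x where "x = cf_lim (\<lambda>i. d (i + j))"
  define y where "y = cf_lim (\<lambda>i. e (i + j))"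
  have xy: "1 / (real K + 2) ^ 3 \<le> \<bar>x - y\<bar>"
  proof (cases "d j < e j")
    case True
    then show ?thesis
      using cf_lim_separation_first_digit[of "\<lambda>i. d (i + j)" K "\<lambda>i. e (i + j)"] d e
      unfolding x_def y_def by fastforce
  next
    case False
    then show ?thesis
      using cf_lim_separation_first_digit[of "\<lambda>i. e (i + j)" K "\<lambda>i. d (i + j)"] d e assms(6)
      unfolding x_def y_def by fastforce
  qed
  have w: "map d [0..<j] = map e [0..<j]" using assms(5) by simp
  have "cf_lim d = cf_fold (map d [0..<j]) x"
    using cf_fold_cf_word[OF cf_lim_cf_points[of d, OF d(1)], of j]
    by (simp add: cf_word_cf_lim[of d, OF d(1)] funpow_gauss_map_cf_lim[of d, OF d(1)] x_def)
  moreover have "cf_lim e = cf_fold (map d [0..<j]) y"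
    using cf_fold_cf_word[OF cf_lim_cf_points[of e, OF e(1)], of j]
    by (simp add: cf_word_cf_lim[of e, OF e(1)] funpow_gauss_map_cf_lim[of e, OF e(1)] y_def w)
  moreover have "0 \<notin> set (map d [0..<j])" using d(1) by (auto simp: image_iff)
  ultimately have "\<bar>x - y\<bar> * exp (- cf_log (map d [0..<j])) \<le> 4 * \<bar>cf_lim d - cf_lim e\<bar>"
    using cf_fold_diff_ge[of "map d [0..<j]" x y] cf_lim_bounds d e unfolding x_def y_def by auto
  moreover have "1 / (real K + 2) ^ 3 * exp (- cf_log (map d [0..<j])) \<le> \<bar>x - y\<bar> * exp (- cf_log (map d [0..<j]))"
    using xy by (rule mult_right_mono) simp
  ultimately show ?thesis by simp
qed

section \<open>Entropy of finite-valued random variables\<close>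

text \<open>Entropy is attached to maps rather than partitions, so that joins become pairs, iterated
  joins become lists, and refinement becomes functional dependence.\<close>

definition rv_entropy :: "'a measure \<Rightarrow> ('a \<Rightarrow> 'b) \<Rightarrow> real" where
  "rv_entropy M X = (\<Sum>y\<in>X ` space M.
     - measure M (X -` {y} \<inter> space M) * ln (measure M (X -` {y} \<inter> space M)))"

lemma rv_entropy_superset:
  assumes "finite A" "X ` space M \<subseteq> A"
  shows "rv_entropy M X = (\<Sum>y\<in>A. - measure M (X -` {y} \<inter> space M) * ln (measure M (X -` {y} \<inter> space M)))"
  unfolding rv_entropy_def
proof (rule sum.mono_neutral_left)
  show "\<forall>y\<in>A - X ` space M. - measure M (X -` {y} \<inter> space M) * ln (measure M (X -` {y} \<inter> space M)) = 0"
  proof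
    fix y assume "y \<in> A - X ` space M"
    then have "X -` {y} \<inter> space M = {}" by auto
    then show "- measure M (X -` {y} \<inter> space M) * ln (measure M (X -` {y} \<inter> space M)) = 0" by simp
  qed
qed (use assms in auto)

lemma rv_entropy_cong:
  assumes "\<And>x. x \<in> space M \<Longrightarrow> X x = Y x"
  shows "rv_entropy M X = rv_entropy M Y"
proof -
  have "X -` {y} \<inter> space M = Y -` {y} \<inter> space M" for y using assms by auto
  moreover have "X ` space M = Y ` space M" using assms by auto
  ultimately show ?thesis by (simp add: rv_entropy_def)
qed

context prob_space
begin

interpretation information_space M "exp 1"
  by unfold_locales simp

lemma rv_entropy_eq:
  assumes "simple_function M X"
  shows "rv_entropy M X = entropy_Pow X"
  unfolding rv_entropy_def entropy_simple_distributed[OF simple_distributedI[OF assms measure_nonneg refl]]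
  by (simp add: log_def sum_negf)

lemma rv_entropy_nonneg: "0 \<le> rv_entropy M X"
  unfolding rv_entropy_def
proof (rule sum_nonneg)
  fix y
  have "ln (prob (X -` {y} \<inter> space M)) \<le> 0"
    by (cases "prob (X -` {y} \<inter> space M) = 0") (auto simp: zero_less_measure_iff)
  then show "0 \<le> - prob (X -` {y} \<inter> space M) * ln (prob (X -` {y} \<inter> space M))"
    by (simp add: mult_nonneg_nonpos)
qed

text \<open>Data processing: the last hypothesis makes \<open>Z\<close> a function of
  \<open>X\<close> on the space, and \<open>SOME\<close> picks a preimage to define that
  function.\<close>

lemma rv_entropy_mono:
  assumes "simple_function M X" "simple_function M Z"
    and "\<And>x y. x \<in> space M \<Longrightarrow> y \<in> space M \<Longrightarrow> X x = X y \<Longrightarrow> Z x = Z y"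
  shows "rv_entropy M Z \<le> rv_entropy M X"
proof -
  define f where "f v = Z (SOME x. x \<in> space M \<and> X x = v)" for v
  have "Z x = (f \<circ> X) x" if "x \<in> space M" for x
    using someI[of "\<lambda>y. y \<in> space M \<and> X y = X x" x] assms(3) that unfolding f_def comp_def by metis
  then have "rv_entropy M Z = rv_entropy M (f \<circ> X)" by (rule rv_entropy_cong)
  also have "\<dots> \<le> rv_entropy M X"
    using entropy_data_processing[OF assms(1), of f] rv_entropy_eq[OF assms(1)]
      rv_entropy_eq[OF simple_function_compose[OF assms(1), of f]] by simp
  finally show ?thesis .
qed

lemma expectation_simple:
  assumes X: "simple_function M X"
  shows "integrable M (\<lambda>x. h (X x) :: real)"
    and "(\<integral>x. h (X x) \<partial>M) = (\<Sum>y\<in>X ` space M. prob (X -` {y} \<inter> space M) * h y)"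
proof -
  note fin = simple_functionD(1)[OF X]
  have meas: "X -` {y} \<inter> space M \<in> sets M" for y
    using simple_functionD(2)[OF X] .
  have eq: "h (X x) = (\<Sum>y\<in>X ` space M. indicator (X -` {y} \<inter> space M) x * h y)" if "x \<in> space M" for x
  proof -
    have "(\<Sum>y\<in>X ` space M. indicator (X -` {y} \<inter> space M) x * h y) = (\<Sum>y\<in>X ` space M. if y = X x then h y else 0)"
      using that by (intro sum.cong) (auto simp: indicator_def)
    then show ?thesis using that fin by simp
  qed
  have int: "integrable M (\<lambda>x. \<Sum>y\<in>X ` space M. indicator (X -` {y} \<inter> space M) x * h y)"
    using meas by (auto intro!: integrable_mult_left integrable_real_indicator simp: less_top[symmetric])
  show "integrable M (\<lambda>x. h (X x))"
    using int by (rule Bochner_Integration.integrable_cong[THEN iffD1, rotated 2]) (auto simp: eq[symmetric])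
  have "(\<integral>x. h (X x) \<partial>M) = (\<integral>x. (\<Sum>y\<in>X ` space M. indicator (X -` {y} \<inter> space M) x * h y) \<partial>M)"
    by (rule Bochner_Integration.integral_cong) (auto simp: eq)
  also have "\<dots> = (\<Sum>y\<in>X ` space M. prob (X -` {y} \<inter> space M) * h y)"
    using meas by (subst Bochner_Integration.integral_sum)
      (auto intro!: integrable_mult_left integrable_real_indicator sum.cong simp: less_top[symmetric] Int_absorb2)
  finally show "(\<integral>x. h (X x) \<partial>M) = (\<Sum>y\<in>X ` space M. prob (X -` {y} \<inter> space M) * h y)" .
qed

lemma rv_entropy_expectation:
  assumes "simple_function M X"
  shows "rv_entropy M X = (\<integral>x. - ln (prob (X -` {X x} \<inter> space M)) \<partial>M)"
  using expectation_simple(2)[OF assms, of "\<lambda>y. - ln (prob (X -` {y} \<inter> space M))"]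
  by (simp add: rv_entropy_def)

text \<open>Nonnegativity of the conditional mutual information of \<open>X\<close> and
  \<open>Y\<close> given \<open>Z\<close>, expanded into four entropies. In conditional form:
  conditioning on more cannot increase entropy.\<close>

lemma rv_entropy_submodular:
  assumes X: "simple_function M X" and Y: "simple_function M Y" and Z: "simple_function M Z"
  shows "rv_entropy M (\<lambda>x. (X x, Y x, Z x)) + rv_entropy M Z
    \<le> rv_entropy M (\<lambda>x. (X x, Z x)) + rv_entropy M (\<lambda>x. (Y x, Z x))"
proof -
  note sp = simple_function_Pair
  note sd = simple_distributedI[OF _ measure_nonneg refl]
  let ?p = "\<lambda>W y. prob (W -` {y} \<inter> space M)"
  let ?XYZ = "\<lambda>x. (X x, Y x, Z x)" and ?XZ = "\<lambda>x. (X x, Z x)" and ?YZ = "\<lambda>x. (Y x, Z x)"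
  let ?h = "\<lambda>(x, y, z). - ln (?p Z z) - ln (?p ?XYZ (x, y, z)) + ln (?p ?XZ (x, z)) + ln (?p ?YZ (y, z))"
  have simp3: "simple_function M ?XYZ" by (intro sp X Y Z)
  have mono: "prob A \<le> prob B" if "A \<subseteq> B" "B \<in> sets M" for A B
    using that by (intro finite_measure_mono)
  \<comment> \<open>An atom of the joint law either has mass 0 and contributes nothing, or all its
    marginals are positive and the logarithm of the quotient splits.\<close>
  have pos: "?p ?XYZ (x, y, z) = 0 \<or>
      (0 < ?p ?XYZ (x, y, z) \<and> 0 < ?p ?XZ (x, z) \<and> 0 < ?p ?YZ (y, z) \<and> 0 < ?p Z z)" for x y z
  proof -
    have "?p ?XYZ (x, y, z) \<le> ?p ?XZ (x, z)" "?p ?XYZ (x, y, z) \<le> ?p ?YZ (y, z)" "?p ?XYZ (x, y, z) \<le> ?p Z z"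
      by (auto intro!: mono simple_functionD(2)[OF sp[OF X Z]] simple_functionD(2)[OF sp[OF Y Z]]
          simple_functionD(2)[OF Z])
    then show ?thesis using measure_nonneg[of M "?XYZ -` {(x, y, z)} \<inter> space M"] by linarith
  qed
  have "0 \<le> conditional_mutual_information_Pow X Y Z" by (rule conditional_mutual_information_nonneg[OF X Y Z])
  also have "\<dots> = (\<Sum>(x, y, z)\<in>?XYZ ` space M. ?p ?XYZ (x, y, z) *
      log (exp 1) (?p ?XYZ (x, y, z) / (?p ?XZ (x, z) * (?p ?YZ (y, z) / ?p Z z))))"
    by (rule conditional_mutual_information_eq[OF sd[OF Z] sd[OF sp[OF Y Z]] sd[OF sp[OF X Z]] sd[OF simp3]])
  also have "\<dots> = (\<Sum>v\<in>?XYZ ` space M. ?p ?XYZ v * - ?h v)"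
  proof (rule sum.cong[OF refl], clarify)
    fix x y z
    show "?p ?XYZ (x, y, z) * log (exp 1) (?p ?XYZ (x, y, z) / (?p ?XZ (x, z) * (?p ?YZ (y, z) / ?p Z z)))
      = ?p ?XYZ (x, y, z) * - (- ln (?p Z z) - ln (?p ?XYZ (x, y, z)) + ln (?p ?XZ (x, z)) + ln (?p ?YZ (y, z)))"
      using pos[of x y z] by (auto simp: log_def ln_div ln_mult)
  qed
  also have "\<dots> = (\<integral>x. - ?h (?XYZ x) \<partial>M)"
    by (rule expectation_simple(2)[OF simp3, symmetric])
  also have "\<dots> = (\<integral>x. - (- ln (?p Z (Z x))) - (- ln (?p ?XYZ (?XYZ x)))
      + (- ln (?p ?XZ (?XZ x))) + (- ln (?p ?YZ (?YZ x))) \<partial>M)"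
    by (rule Bochner_Integration.integral_cong) auto
  also have "\<dots> = - rv_entropy M Z - rv_entropy M ?XYZ + rv_entropy M ?XZ + rv_entropy M ?YZ"
    using expectation_simple(1)[OF Z, of "\<lambda>y. - ln (?p Z y)"]
      expectation_simple(1)[OF simp3, of "\<lambda>y. - ln (?p ?XYZ y)"]
      expectation_simple(1)[OF sp[OF X Z], of "\<lambda>y. - ln (?p ?XZ y)"]
      expectation_simple(1)[OF sp[OF Y Z], of "\<lambda>y. - ln (?p ?YZ y)"]
    unfolding rv_entropy_expectation[OF Z] rv_entropy_expectation[OF simp3]
      rv_entropy_expectation[OF sp[OF X Z]] rv_entropy_expectation[OF sp[OF Y Z]]
    by simp
  finally show ?thesis by linarith
qed

lemma rv_entropy_Pair_le:
  assumes X: "simple_function M X" and Y: "simple_function M Y"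
  shows "rv_entropy M (\<lambda>x. (X x, Y x)) \<le> rv_entropy M X + rv_entropy M Y"
proof -
  \<comment> \<open>Conditioning on a constant turns submodularity into subadditivity.\<close>
  have c: "simple_function M (\<lambda>_. ())" by simp
  note sp = simple_function_Pair
  have "rv_entropy M (\<lambda>x. (X x, Y x)) \<le> rv_entropy M (\<lambda>x. (X x, Y x, ()))"
    by (rule rv_entropy_mono) (auto intro!: sp X Y c)
  also have "\<dots> \<le> rv_entropy M (\<lambda>x. (X x, ())) + rv_entropy M (\<lambda>x. (Y x, ()))"
    using rv_entropy_submodular[OF X Y c] rv_entropy_nonneg[of "\<lambda>_. ()"] by linarith
  also have "\<dots> \<le> rv_entropy M X + rv_entropy M Y"
    by (intro add_mono rv_entropy_mono) (auto intro!: sp X Y c)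
  finally show ?thesis .
qed

end

lemma continuous_on_xlnx: "continuous_on {0..} (\<lambda>x::real. - x * ln x)"
  unfolding continuous_on_eq_continuous_within
proof
  fix x :: real assume x: "x \<in> {0..}"
  show "continuous (at x within {0..}) (\<lambda>x. - x * ln x)"
  proof (cases "x = 0")
    case True
    have "((\<lambda>x::real. - x * ln x) \<longlongrightarrow> 0) (at_right 0)"
    proof (rule Lim_transform_eventually)
      show "((\<lambda>x::real. ln (inverse x) / inverse x) \<longlongrightarrow> 0) (at_right 0)"
        by (rule filterlim_compose[OF ln_x_over_x_tendsto_0 filterlim_inverse_at_top_right])
      show "\<forall>\<^sub>F x::real in at_right 0. ln (inverse x) / inverse x = - x * ln x"
        unfolding eventually_at_right_field by (intro exI[of _ 1]) (auto simp: ln_inverse inverse_eq_divide ln_div)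
    qed
    moreover have "at (0::real) within {0..} = at_right 0"
      by (rule at_within_nhd[of _ "UNIV"]) auto
    ultimately show ?thesis using True by (simp add: continuous_within)
  next
    case False
    then have "x > 0" using x by simp
    then show ?thesis by (intro continuous_intros) auto
  qed
qed

text \<open>Both entropies are sums of the continuous function -x ln x over a fixed finite set of
  values. As the disagreement vanishes, the joint law tends to the law of \<open>Y\<close> on the
  diagonal, so both sums tend to the entropy of \<open>Y\<close>.\<close>

lemma (in prob_space) conditional_entropy_tendsto_zero:
  assumes Y: "simple_function M Y" and Z: "\<And>m. simple_function M (Z m)"
    and L: "finite L" "\<And>x. Y x \<in> L" "\<And>m x. Z m x \<in> L"
    and lim: "(\<lambda>m. prob {x \<in> space M. Y x \<noteq> Z m x}) \<longlonglongrightarrow> 0"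
  shows "(\<lambda>m. rv_entropy M (\<lambda>x. (Y x, Z m x)) - rv_entropy M (Z m)) \<longlonglongrightarrow> 0"
proof -
  let ?\<eta> = "\<lambda>x::real. - x * ln x"
  have YZ: "simple_function M (\<lambda>x. (Y x, Z m x))" for m by (intro simple_function_Pair Y Z)
  have eta_lim: "(\<lambda>m. ?\<eta> (f m)) \<longlonglongrightarrow> ?\<eta> a" if "f \<longlonglongrightarrow> a" "\<And>m. 0 \<le> f m" for f a
  proof (rule continuous_on_tendsto_compose[OF continuous_on_xlnx that(1)])
    show "a \<in> {0..}" using LIMSEQ_le_const[OF that(1), of 0] that(2) by auto
  qed (use that in auto)
  have ev: "Y -` {i} \<inter> space M \<in> sets M" "Z m -` {i} \<inter> space M \<in> sets M"
    "(\<lambda>x. (Y x, Z m x)) -` {v} \<inter> space M \<in> sets M" for i m v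
    by (rule simple_functionD(2)[OF Y] simple_functionD(2)[OF Z] simple_functionD(2)[OF YZ])+
  have D: "{x \<in> space M. Y x \<noteq> Z m x} \<in> sets M" for m
  proof -
    have "{x \<in> space M. Y x \<noteq> Z m x} = (\<Union>i\<in>L. (Y -` {i} \<inter> space M) - (Z m -` {i} \<inter> space M))"
      using L by auto
    then show ?thesis using ev L by auto
  qed
  have close: "f \<longlonglongrightarrow> a" if "\<And>m. \<bar>f m - a\<bar> \<le> prob {x \<in> space M. Y x \<noteq> Z m x}" for f a
    by (rule Lim_transform2[OF tendsto_const[of a]], rule Lim_null_comparison[OF _ lim])
      (use that in \<open>auto simp: abs_minus_commute\<close>)
  have single: "(\<lambda>m. prob (Z m -` {i} \<inter> space M)) \<longlonglongrightarrow> prob (Y -` {i} \<inter> space M)" for i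
  proof (rule close)
    fix m
    have "prob (Z m -` {i} \<inter> space M) \<le> prob ((Y -` {i} \<inter> space M) \<union> {x \<in> space M. Y x \<noteq> Z m x})"
      "prob (Y -` {i} \<inter> space M) \<le> prob ((Z m -` {i} \<inter> space M) \<union> {x \<in> space M. Y x \<noteq> Z m x})"
      using ev D by (auto intro!: finite_measure_mono)
    then show "\<bar>prob (Z m -` {i} \<inter> space M) - prob (Y -` {i} \<inter> space M)\<bar> \<le> prob {x \<in> space M. Y x \<noteq> Z m x}"
      using measure_Un_le[OF ev(1)[of i] D[of m]] measure_Un_le[OF ev(2)[of m i] D[of m]]
      by linarith
  qed
  have joint: "(\<lambda>m. prob ((\<lambda>x. (Y x, Z m x)) -` {(i, j)} \<inter> space M)) \<longlonglongrightarrow>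
      (if i = j then prob (Y -` {i} \<inter> space M) else 0)" for i j
  proof (rule close)
    fix m
    let ?E = "(\<lambda>x. (Y x, Z m x)) -` {(i, j)} \<inter> space M" and ?D = "{x \<in> space M. Y x \<noteq> Z m x}"
    show "\<bar>prob ?E - (if i = j then prob (Y -` {i} \<inter> space M) else 0)\<bar> \<le> prob ?D"
    proof (cases "i = j")
      case True
      have "prob ?E \<le> prob (Y -` {i} \<inter> space M)"
        using ev by (auto intro!: finite_measure_mono)
      moreover have "prob (Y -` {i} \<inter> space M) \<le> prob (?E \<union> ?D)"
        using ev D True by (auto intro!: finite_measure_mono)
      ultimately show ?thesis
        using measure_Un_le[OF ev(3)[of m "(i, j)"] D[of m]] True by simp
    next
      case False
      then have "prob ?E \<le> prob ?D" using D by (auto intro!: finite_measure_mono)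
      then show ?thesis using False by simp
    qed
  qed
  have 1: "rv_entropy M (Z m) = (\<Sum>i\<in>L. ?\<eta> (prob (Z m -` {i} \<inter> space M)))" for m
    using L by (intro rv_entropy_superset) auto
  have 2: "rv_entropy M (\<lambda>x. (Y x, Z m x)) =
      (\<Sum>v\<in>L \<times> L. ?\<eta> (prob ((\<lambda>x. (Y x, Z m x)) -` {v} \<inter> space M)))" for m
    using L by (intro rv_entropy_superset) auto
  have l1: "(\<lambda>m. rv_entropy M (Z m)) \<longlonglongrightarrow> (\<Sum>i\<in>L. ?\<eta> (prob (Y -` {i} \<inter> space M)))"
    unfolding 1 by (intro tendsto_sum eta_lim single) simp
  have "(\<lambda>m. rv_entropy M (\<lambda>x. (Y x, Z m x))) \<longlonglongrightarrow>
      (\<Sum>v\<in>L \<times> L. ?\<eta> (if fst v = snd v then prob (Y -` {fst v} \<inter> space M) else 0))"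
    unfolding 2
  proof (intro tendsto_sum eta_lim)
    fix v show "(\<lambda>m. prob ((\<lambda>x. (Y x, Z m x)) -` {v} \<inter> space M)) \<longlonglongrightarrow>
       (if fst v = snd v then prob (Y -` {fst v} \<inter> space M) else 0)"
      using joint[of "fst v" "snd v"] by simp
  qed simp
  also have "(\<Sum>v\<in>L \<times> L. ?\<eta> (if fst v = snd v then prob (Y -` {fst v} \<inter> space M) else 0)) =
      (\<Sum>i\<in>L. \<Sum>j\<in>L. if j = i then ?\<eta> (prob (Y -` {i} \<inter> space M)) else 0)"
    unfolding sum.cartesian_product by (intro sum.cong) auto
  also have "\<dots> = (\<Sum>i\<in>L. ?\<eta> (prob (Y -` {i} \<inter> space M)))"
    using L(1) by (intro sum.cong refl) (subst sum.delta, auto)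
  finally show ?thesis using tendsto_diff[OF _ l1] by fastforce
qed

section \<open>Entropy of a measure-preserving transformation\<close>

definition itinerary :: "('a \<Rightarrow> 'b) \<Rightarrow> ('a \<Rightarrow> 'a) \<Rightarrow> nat \<Rightarrow> 'a \<Rightarrow> 'b list" where
  "itinerary X T n x = map (\<lambda>i. X ((T ^^ i) x)) [0..<n]"

lemma itinerary_Suc: "itinerary X T (Suc n) x = itinerary X T n x @ [X ((T ^^ n) x)]"
  by (simp add: itinerary_def)

lemma itinerary_add: "itinerary X T (m + n) x = itinerary X T m x @ itinerary X T n ((T ^^ m) x)"
proof -
  have "[0..<m + n] = [0..<m] @ map (\<lambda>i. i + m) [0..<n]"
    using upt_add_eq_append[of 0 m n] map_add_upt[of m n] by (simp add: add.commute)
  then show ?thesis by (simp add: itinerary_def funpow_add comp_def)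
qed

lemma itinerary_eq_iff:
  "itinerary X T n x = itinerary X T n y \<longleftrightarrow> (\<forall>i<n. X ((T ^^ i) x) = X ((T ^^ i) y))"
  by (auto simp: itinerary_def list_eq_iff_nth_eq)

text \<open>Fekete's lemma: divide \<open>n\<close> by a near-optimal \<open>m\<close>; the quotient
  is handled by subadditivity and the remainder costs at most a constant.\<close>

lemma subadditive_tendsto_Inf:
  fixes a :: "nat \<Rightarrow> real"
  assumes sub: "\<And>m n. a (m + n) \<le> a m + a n" and nn: "\<And>n. 0 \<le> a n"
  shows "(\<lambda>n. a n / n) \<longlonglongrightarrow> (INF n\<in>{1..}. a n / n)"
proof -
  define L where "L = (INF n\<in>{1..}. a n / n)"
  have bdd: "bdd_below ((\<lambda>n. a n / n) ` {1..})" using nn by (auto intro!: bdd_belowI[of _ 0])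
  have low: "L \<le> a n / n" if "n \<ge> 1" for n unfolding L_def using that bdd by (intro cINF_lower) auto
  have mult: "a (q * m) \<le> q * a m" if "q \<ge> 1" for q m
    using that
  proof (induction q rule: nat_induct_at_least)
    case (Suc q)
    then show ?case using sub[of m "q * m"] by (simp add: algebra_simps)
  qed simp
  have "\<exists>N. \<forall>n\<ge>N. \<bar>a n / n - L\<bar> < e" if e: "e > 0" for e
  proof -
    have "\<exists>m\<in>{1..}. a m / m < L + e / 2"
      using cInf_lessD[of "(\<lambda>n. a n / n) ` {1..}" "L + e / 2"] e by (auto simp: L_def)
    then obtain m where m: "m \<ge> 1" "a m / m < L + e / 2" by auto
    define C where "C = (\<Sum>i<m. a i)"
    have C: "a i \<le> C" if "i < m" for i unfolding C_def using that nn by (intro member_le_sum) auto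
    obtain N where N: "real N > 2 * C / e" using reals_Archimedean2 by blast
    show ?thesis
    proof (intro exI allI impI)
      fix n assume n: "n \<ge> max (max N 1) m"
      have "a n \<le> a (n div m * m) + a (n mod m)" using sub[of "n div m * m" "n mod m"] by simp
      also have "\<dots> \<le> (n div m) * a m + C"
        using mult[of "n div m" m] C[of "n mod m"] m n by (intro add_mono) (auto simp: div_greater_zero_iff Suc_le_eq)
      also have "(n div m) * a m \<le> n / m * a m"
        using of_nat_div_le_of_nat[of n m, where 'a=real] nn by (intro mult_right_mono) auto
      finally have "a n / n \<le> a m / m + C / n" using n by (simp add: field_simps)
      moreover have "C / n < e / 2"
      proof -
        have "2 * C / e < n" using N n by linarith
        then show ?thesis using e n by (simp add: field_simps)
      qed
      ultimately show "\<bar>a n / n - L\<bar> < e" using low[of n] n m by linarith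
    qed
  qed
  then show ?thesis unfolding L_def[symmetric] by (intro LIMSEQ_I) auto
qed

definition part_of :: "'a set set \<Rightarrow> 'a \<Rightarrow> 'a set" where
  "part_of P x = (THE A. A \<in> P \<and> x \<in> A)"

lemma part_of_eq:
  assumes "partition_on S P" "A \<in> P" "x \<in> A"
  shows "part_of P x = A"
  unfolding part_of_def using assms by (intro the_equality) (auto simp: partition_on_def disjoint_def)

lemma part_of_in:
  assumes "partition_on S P" "x \<in> S"
  shows "part_of P x \<in> P" "x \<in> part_of P x"
proof -
  obtain A where "A \<in> P" "x \<in> A" using assms by (auto simp: partition_on_def)
  then show "part_of P x \<in> P" "x \<in> part_of P x" using part_of_eq[OF assms(1)] by auto
qed

locale measure_preserving = prob_space M for M :: "'a measure" +
  fixes T :: "'a \<Rightarrow> 'a"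
  assumes T_measurable [measurable]: "T \<in> M \<rightarrow>\<^sub>M M" and T_invariant: "distr M M T = M"
begin

lemma funpow_measurable [measurable]: "T ^^ n \<in> M \<rightarrow>\<^sub>M M"
proof (induction n)
  case (Suc n)
  then show ?case using measurable_comp[OF Suc T_measurable] by (simp only: funpow.simps)
qed (simp add: id_def)

lemma funpow_invariant: "distr M M (T ^^ n) = M"
proof (induction n)
  case (Suc n)
  have "distr M M (T ^^ Suc n) = distr (distr M M (T ^^ n)) M T"
    by (subst distr_distr) auto
  then show ?case unfolding Suc T_invariant .
qed (simp add: id_def distr_id)

lemma funpow_space: "x \<in> space M \<Longrightarrow> (T ^^ n) x \<in> space M"
  by (rule measurable_space[OF funpow_measurable])

lemma simple_function_funpow:
  assumes "simple_function M X"
  shows "simple_function M (\<lambda>x. X ((T ^^ n) x))"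
proof -
  have sp: "(T ^^ n) ` space M \<subseteq> space M" using funpow_space by auto
  have "(\<lambda>x. X ((T ^^ n) x)) -` A \<inter> space M = (T ^^ n) -` (X -` A \<inter> space M) \<inter> space M" for A
    using sp by auto
  moreover have "(\<lambda>x. X ((T ^^ n) x)) ` space M \<subseteq> X ` space M" using sp by auto
  moreover have "(T ^^ n) -` (X -` A \<inter> space M) \<inter> space M \<in> sets M" for A
    by (rule measurable_sets[OF funpow_measurable simple_functionD(2)[OF assms]])
  ultimately show ?thesis
    using simple_functionD(1)[OF assms] unfolding simple_function_def by (metis finite_subset)
qed

lemma simple_function_itinerary:
  assumes "simple_function M X"
  shows "simple_function M (itinerary X T n)"
proof (induction n)
  case 0
  show ?case by (simp add: itinerary_def[abs_def])
next
  case (Suc n)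
  have "simple_function M ((\<lambda>(u, v). u @ [v]) \<circ> (\<lambda>x. (itinerary X T n x, X ((T ^^ n) x))))"
    by (intro simple_function_compose simple_function_Pair Suc simple_function_funpow assms)
  then show ?case by (simp add: itinerary_Suc[abs_def] comp_def)
qed

lemma rv_entropy_funpow:
  assumes X: "simple_function M X"
  shows "rv_entropy M (\<lambda>x. X ((T ^^ n) x)) = rv_entropy M X"
proof -
  have sp: "(T ^^ n) ` space M \<subseteq> space M" using funpow_space by auto
  have "measure M ((\<lambda>x. X ((T ^^ n) x)) -` {y} \<inter> space M) = measure M (X -` {y} \<inter> space M)" for y
  proof -
    have "measure M (X -` {y} \<inter> space M) = measure (distr M M (T ^^ n)) (X -` {y} \<inter> space M)"
      by (simp add: funpow_invariant)
    also have "\<dots> = measure M ((T ^^ n) -` (X -` {y} \<inter> space M) \<inter> space M)"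
      using simple_functionD(2)[OF X] by (intro measure_distr) auto
    also have "(T ^^ n) -` (X -` {y} \<inter> space M) \<inter> space M = (\<lambda>x. X ((T ^^ n) x)) -` {y} \<inter> space M"
      using sp by auto
    finally show ?thesis by simp
  qed
  moreover have "rv_entropy M (\<lambda>x. X ((T ^^ n) x)) = (\<Sum>y\<in>X ` space M.
      - measure M ((\<lambda>x. X ((T ^^ n) x)) -` {y} \<inter> space M) * ln (measure M ((\<lambda>x. X ((T ^^ n) x)) -` {y} \<inter> space M)))"
    using simple_functionD(1)[OF X] sp by (intro rv_entropy_superset) auto
  ultimately show ?thesis by (simp add: rv_entropy_def)
qed

lemma rv_entropy_itinerary_add:
  assumes X: "simple_function M X"
  shows "rv_entropy M (itinerary X T (m + n)) \<le> rv_entropy M (itinerary X T m) + rv_entropy M (itinerary X T n)"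
proof -
  note si = simple_function_itinerary[OF X]
  have "rv_entropy M (itinerary X T (m + n)) \<le>
      rv_entropy M (\<lambda>x. (itinerary X T m x, itinerary X T n ((T ^^ m) x)))"
    by (rule rv_entropy_mono) (auto intro!: simple_function_Pair si simple_function_funpow simp: itinerary_add)
  also have "\<dots> \<le> rv_entropy M (itinerary X T m) + rv_entropy M (\<lambda>x. itinerary X T n ((T ^^ m) x))"
    by (intro rv_entropy_Pair_le si simple_function_funpow)
  also have "rv_entropy M (\<lambda>x. itinerary X T n ((T ^^ m) x)) = rv_entropy M (itinerary X T n)"
    by (rule rv_entropy_funpow[OF si])
  finally show ?thesis .
qed

lemma rv_entropy_itinerary_tendsto:
  assumes X: "simple_function M X"
  shows "(\<lambda>n. rv_entropy M (itinerary X T n) / n) \<longlonglongrightarrow> (INF n\<in>{1..}. rv_entropy M (itinerary X T n) / n)"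
  by (intro subadditive_tendsto_Inf rv_entropy_itinerary_add rv_entropy_nonneg X)

text \<open>The last term is \<open>n\<close> times the conditional entropy of \<open>X\<close>
  given \<open>Z\<close>: once the \<open>Z\<close>-symbols are known, each \<open>X\<close>-symbol
  costs at most that much, by invariance at every time.\<close>

lemma rv_entropy_itinerary_compare:
  assumes X: "simple_function M X" and Z: "simple_function M Z"
  shows "rv_entropy M (itinerary X T n) \<le> rv_entropy M (itinerary Z T n)
    + n * (rv_entropy M (\<lambda>x. (X x, Z x)) - rv_entropy M Z)"
proof -
  note sp = simple_function_Pair and sX = simple_function_itinerary[OF X] and sZ = simple_function_itinerary[OF Z]
  define c where "c = rv_entropy M (\<lambda>x. (X x, Z x)) - rv_entropy M Z"
  have "rv_entropy M (\<lambda>x. (itinerary X T n x, itinerary Z T n x)) \<le> rv_entropy M (itinerary Z T n) + n * c"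
  proof (induction n)
    case 0
    show ?case by (auto simp: itinerary_def[abs_def] intro!: rv_entropy_mono)
  next
    case (Suc n)
    let ?A = "itinerary X T n" and ?B = "itinerary Z T n"
    let ?a = "\<lambda>x. X ((T ^^ n) x)" and ?b = "\<lambda>x. Z ((T ^^ n) x)"
    note sa = simple_function_funpow[OF X, of n] and sb = simple_function_funpow[OF Z, of n]
    have "rv_entropy M (\<lambda>x. (itinerary X T (Suc n) x, itinerary Z T (Suc n) x)) \<le>
        rv_entropy M (\<lambda>x. (?a x, (?A x, ?B x), ?b x))"
      by (rule rv_entropy_mono) (intro sp sX sZ sa sb, intro sp sX sZ sa sb, simp add: itinerary_Suc)
    \<comment> \<open>The new \<open>X\<close>-symbol is conditioned on the simultaneous
      \<open>Z\<close>-symbol only; forgetting the histories can only increase its conditional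
      entropy.\<close>
    also have "\<dots> \<le> rv_entropy M (\<lambda>x. (?a x, ?b x)) + rv_entropy M (\<lambda>x. ((?A x, ?B x), ?b x)) - rv_entropy M ?b"
      using rv_entropy_submodular[OF sa sp[OF sX[of n] sZ[of n]] sb] by linarith
    also have "rv_entropy M (\<lambda>x. (?a x, ?b x)) = rv_entropy M (\<lambda>x. (X x, Z x))"
      by (rule rv_entropy_funpow[OF sp[OF X Z]])
    also have "rv_entropy M ?b = rv_entropy M Z" by (rule rv_entropy_funpow[OF Z])
    also have "rv_entropy M (\<lambda>x. ((?A x, ?B x), ?b x)) \<le> rv_entropy M (\<lambda>x. (?A x, ?b x, ?B x))"
      by (rule rv_entropy_mono) (auto intro!: sp sX sZ sa sb)
    \<comment> \<open>For the new \<open>Z\<close>-symbol only the \<open>X\<close>-history is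
      forgotten; keeping the \<open>Z\<close>-history lets the entropies of the
      \<open>Z\<close>-itineraries telescope.\<close>
    also have "\<dots> \<le> rv_entropy M (\<lambda>x. (?A x, ?B x)) + rv_entropy M (\<lambda>x. (?b x, ?B x)) - rv_entropy M ?B"
      using rv_entropy_submodular[OF sX[of n] sb sZ[of n]] by linarith
    also have "rv_entropy M (\<lambda>x. (?b x, ?B x)) \<le> rv_entropy M (itinerary Z T (Suc n))"
      by (rule rv_entropy_mono) (intro sp sZ sb, intro sp sZ sb, simp add: itinerary_Suc)
    finally show ?case using Suc.IH by (simp add: c_def algebra_simps)
  qed
  moreover have "rv_entropy M (itinerary X T n) \<le> rv_entropy M (\<lambda>x. (itinerary X T n x, itinerary Z T n x))"
    by (rule rv_entropy_mono) (auto intro!: sp sX sZ)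
  ultimately show ?thesis by (simp add: c_def)
qed

lemma simple_function_part_of:
  assumes "finite P" "partition_on (space M) P" "P \<subseteq> sets M"
  shows "simple_function M (part_of P)"
proof -
  have im: "part_of P ` space M \<subseteq> P"
    using part_of_in[OF assms(2)] by auto
  have "part_of P -` {A} \<inter> space M = (if A \<in> P then A else {})" for A
  proof (cases "A \<in> P")
    case True
    then have "A \<subseteq> space M" using assms(2) by (auto simp: partition_on_def)
    then show ?thesis using True part_of_in[OF assms(2)] part_of_eq[OF assms(2) True] by auto
  next
    case False
    then show ?thesis using im by auto
  qed
  then show ?thesis
    using im assms unfolding simple_function_def by (auto intro: finite_subset)
qed

text \<open>Nonempty cells correspond one to one, through \<open>g\<close>, to the itineraries that
  occur; the empty set is the only other possible member and contributes 0.\<close>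

lemma partition_entropy_iterated_partition:
  assumes "finite P" "partition_on (space M) P" "P \<subseteq> sets M"
  shows "partition_entropy M (iterated_partition M T P n) = rv_entropy M (itinerary (part_of P) T n)"
proof -
  define I where "I = itinerary (part_of P) T n"
  define g where "g y = I -` {y} \<inter> space M" for y
  define Q where "Q = iterated_partition M T P n"
  have po: "part_of P ((T ^^ i) x) \<in> P" "(T ^^ i) x \<in> A \<longleftrightarrow> part_of P ((T ^^ i) x) = A"
    if "x \<in> space M" "A \<in> P" for x i A
    using part_of_in[OF assms(2) funpow_space[OF that(1)]] part_of_eq[OF assms(2) that(2)] by blast+
  have cell: "{x \<in> space M. \<forall>i<n. (T ^^ i) x \<in> A i} = g (I z)"
    if "z \<in> space M" "\<And>i. i < n \<Longrightarrow> A i \<in> P" "\<And>i. i < n \<Longrightarrow> A i = part_of P ((T ^^ i) z)" for A z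
    unfolding g_def I_def using that po(2) by (auto simp: itinerary_eq_iff)
  have sub1: "g ` I ` space M \<subseteq> Q"
  proof clarify
    fix z assume z: "z \<in> space M"
    have "part_of P ((T ^^ i) z) \<in> P" for i using part_of_in[OF assms(2) funpow_space[OF z]] by blast
    then show "g (I z) \<in> Q"
      unfolding Q_def iterated_partition_def using cell[OF z, of "\<lambda>i. part_of P ((T ^^ i) z)"]
      by (intro CollectI exI[of _ "\<lambda>i. part_of P ((T ^^ i) z)"]) auto
  qed
  have sub2: "Q \<subseteq> insert {} (g ` I ` space M)"
  proof
    fix B assume "B \<in> Q"
    then obtain A where A: "A \<in> {..<n} \<rightarrow> P" "B = {x \<in> space M. \<forall>i<n. (T ^^ i) x \<in> A i}"
      unfolding Q_def iterated_partition_def by auto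
    show "B \<in> insert {} (g ` I ` space M)"
    proof (cases "B = {}")
      case False
      then obtain z where z: "z \<in> space M" "\<And>i. i < n \<Longrightarrow> (T ^^ i) z \<in> A i" using A by auto
      have "A i \<in> P" "A i = part_of P ((T ^^ i) z)" if "i < n" for i
        using A(1) z(2)[OF that] po(2)[OF z(1), of "A i" i] that by auto
      then have "B = g (I z)" unfolding A(2) using z(1) by (intro cell) auto
      then show ?thesis using z by auto
    qed simp
  qed
  have fin: "finite (I ` space M)"
    using simple_functionD(1)[OF simple_function_itinerary[OF simple_function_part_of[OF assms]]] unfolding I_def .
  have inj: "inj_on g (I ` space M)"
  proof (rule inj_onI, clarify)
    fix y z assume "y \<in> space M" "g (I y) = g (I z)"
    then have "y \<in> g (I z)" by (auto simp: g_def)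
    then show "I y = I z" by (simp add: g_def)
  qed
  have "partition_entropy M Q = (\<Sum>A\<in>g ` I ` space M. - measure M A * ln (measure M A))"
    unfolding partition_entropy_def using sub1 sub2 fin
    by (intro sum.mono_neutral_right) (auto intro: finite_subset)
  also have "\<dots> = rv_entropy M I"
    unfolding rv_entropy_def sum.reindex[OF inj] by (simp add: g_def)
  finally show ?thesis unfolding Q_def I_def .
qed

lemma entropy_wrt_partition_eq:
  assumes "finite P" "partition_on (space M) P" "P \<subseteq> sets M"
  shows "entropy_wrt_partition M T P = (INF n\<in>{1..}. rv_entropy M (itinerary (part_of P) T n) / n)"
  unfolding entropy_wrt_partition_def partition_entropy_iterated_partition[OF assms]
  using rv_entropy_itinerary_tendsto[OF simple_function_part_of[OF assms]] by (rule limI)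

lemma measure_entropy_ge:
  assumes X: "simple_function M X"
  shows "ennreal (INF n\<in>{1..}. rv_entropy M (itinerary X T n) / n) \<le> measure_entropy M T"
proof -
  define P where "P = (\<lambda>y. X -` {y} \<inter> space M) ` X ` space M"
  have P: "finite P" "partition_on (space M) P" "P \<subseteq> sets M"
    using simple_functionD[OF X] unfolding P_def partition_on_def disjoint_def by auto
  have eq: "part_of P x = X -` {X x} \<inter> space M" if "x \<in> space M" for x
    using that by (intro part_of_eq[OF P(2)]) (auto simp: P_def)
  have iff: "part_of P x = part_of P y \<longleftrightarrow> X x = X y" if "x \<in> space M" "y \<in> space M" for x y
    using that unfolding eq[OF that(1)] eq[OF that(2)] by auto
  note si = simple_function_itinerary[OF X] and sp = simple_function_itinerary[OF simple_function_part_of[OF P]]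
  have "rv_entropy M (itinerary (part_of P) T n) = rv_entropy M (itinerary X T n)" for n
    by (intro antisym rv_entropy_mono si sp) (auto simp: itinerary_eq_iff iff funpow_space)
  then have "entropy_wrt_partition M T P = (INF n\<in>{1..}. rv_entropy M (itinerary X T n) / n)"
    by (simp add: entropy_wrt_partition_eq[OF P])
  then show ?thesis
    unfolding measure_entropy_def using P by (intro SUP_upper2[of P]) auto
qed

text \<open>By subadditivity the entropy rate is an infimum, so the lower bound holds for every
  positive \<open>n\<close> and not only asymptotically.\<close>

lemma measure_entropy_gt_obtains:
  assumes "ennreal c < measure_entropy M T" "0 \<le> c"
  obtains X :: "'a \<Rightarrow> 'a set" where "simple_function M X" "\<And>n. n \<ge> 1 \<Longrightarrow> n * c < rv_entropy M (itinerary X T n)"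
proof -
  obtain P where P: "finite P" "partition_on (space M) P" "P \<subseteq> sets M"
    and c: "ennreal c < ennreal (entropy_wrt_partition M T P)"
    using assms unfolding measure_entropy_def less_SUP_iff by auto
  have c: "c < (INF n\<in>{1..}. rv_entropy M (itinerary (part_of P) T n) / n)"
    using c assms(2) unfolding entropy_wrt_partition_eq[OF P] by (simp add: ennreal_less_iff)
  have "n * c < rv_entropy M (itinerary (part_of P) T n)" if "n \<ge> 1" for n
  proof -
    have "(INF n\<in>{1..}. rv_entropy M (itinerary (part_of P) T n) / n) \<le> rv_entropy M (itinerary (part_of P) T n) / n"
      using that by (intro cINF_lower bdd_belowI[of _ 0]) (auto intro!: divide_nonneg_nonneg rv_entropy_nonneg)
    then have "c < rv_entropy M (itinerary (part_of P) T n) / n" using c by linarith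
    then show ?thesis using that by (simp add: field_simps)
  qed
  then show ?thesis using that[OF simple_function_part_of[OF P]] by blast
qed

end

section \<open>Independent identically distributed blocks of digits\<close>

text \<open>Hoeffding's inequality makes the probabilities of a deviation by \<open>k * e\<close>
  decay geometrically, so Borel-Cantelli applies for each \<open>e\<close>.\<close>

lemma (in prob_space) strong_law_bounded:
  fixes X :: "nat \<Rightarrow> 'a \<Rightarrow> real"
  assumes indep: "indep_vars (\<lambda>_. borel) X UNIV"
    and bound: "\<And>i x. \<bar>X i x\<bar> \<le> C" and mean: "\<And>i. expectation (X i) = m"
  shows "AE x in M. (\<lambda>k. (\<Sum>i<k. X i x) / k) \<longlonglongrightarrow> m"
proof -
  \<comment> \<open>The added 1 keeps the interval from -D to D nondegenerate when \<open>C\<close>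
    is 0.\<close>
  define D where "D = C + 1"
  have D: "D > 0" "\<And>i x. \<bar>X i x\<bar> \<le> D"
    using order.trans[OF abs_ge_zero bound[of 0 undefined]] unfolding D_def
    by (auto intro: order.trans[OF bound])
  have meas [measurable]: "X i \<in> borel_measurable M" for i
    using indep by (auto simp: indep_vars_def)
  have ev: "AE x in M. \<forall>\<^sub>F k in sequentially. \<bar>(\<Sum>i<k. X i x) - k * m\<bar> < k * e" if e: "e > 0" for e :: real
  proof -
    define A where "A k = {x \<in> space M. \<bar>(\<Sum>i<k. X i x) - k * m\<bar> \<ge> k * e}" for k :: nat
    define r where "r = exp (- e\<^sup>2 / (2 * D\<^sup>2))"
    have pb: "prob (A k) \<le> 2 * r ^ k" if k: "k > 0" for k
    proof -
      interpret indep_interval_bounded_random_variables M "{..<k}" X "\<lambda>_. - D" "\<lambda>_. D"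
      proof
        show "indep_vars (\<lambda>_. borel) X {..<k}" by (rule indep_vars_subset[OF indep]) auto
        show "AE x in M. X i x \<in> {- D..D}" for i using D(2)[of i] by (auto simp: abs_le_iff minus_le_iff)
      qed auto
      interpret Hoeffding_ineq M "{..<k}" X "\<lambda>_. - D" "\<lambda>_. D" "\<Sum>i<k. expectation (X i)"
        by unfold_locales auto
      have "prob (A k) \<le> 2 * exp (- 2 * (k * e)\<^sup>2 / (\<Sum>i<k. (D - - D)\<^sup>2))"
        using Hoeffding_ineq_abs_ge[of "k * e"] e k D unfolding A_def by (simp add: mean)
      also have "- 2 * (k * e)\<^sup>2 / (\<Sum>i<k. (D - - D)\<^sup>2) = k * (- e\<^sup>2 / (2 * D\<^sup>2))"
        using k D by (simp add: field_simps power2_eq_square)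
      also have "exp \<dots> = r ^ k" unfolding r_def by (rule exp_of_nat_mult)
      finally show ?thesis .
    qed
    have "AE x in M. \<forall>\<^sub>F k in sequentially. x \<in> space M - A k"
    proof (rule borel_cantelli_AE1)
      show "A k \<in> sets M" for k unfolding A_def by measurable
      have "0 < r" "r < 1" using D e unfolding r_def by auto
      then have "summable (\<lambda>k. 2 * r ^ k)" by (intro summable_mult summable_geometric) auto
      then show "summable (\<lambda>k. measure M (A k))"
        by (rule summable_comparison_test'[of _ 1]) (use pb in auto)
    qed (simp add: less_top[symmetric])
    then show ?thesis
      by (rule AE_mp) (auto intro!: AE_I2 elim: eventually_mono simp: A_def not_le)
  qed
  \<comment> \<open>Restricting to countably many tolerances leaves a single null set.\<close>
  have "AE x in M. \<forall>j. \<forall>\<^sub>F k in sequentially. \<bar>(\<Sum>i<k. X i x) - k * m\<bar> < k * (1 / Suc j)"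
    unfolding AE_all_countable by (intro allI ev) simp
  then show ?thesis
  proof (rule AE_mp, intro AE_I2 impI)
    fix x assume *: "\<forall>j. \<forall>\<^sub>F k in sequentially. \<bar>(\<Sum>i<k. X i x) - k * m\<bar> < k * (1 / Suc j)"
    show "(\<lambda>k. (\<Sum>i<k. X i x) / k) \<longlonglongrightarrow> m"
    proof (rule tendstoI)
      fix e :: real assume "e > 0"
      then obtain j where j: "1 / Suc j < e" using reals_Archimedean[of e] by (auto simp: inverse_eq_divide)
      show "\<forall>\<^sub>F k in sequentially. dist ((\<Sum>i<k. X i x) / k) m < e"
        using *[rule_format, of j] eventually_gt_at_top[of 0]
      proof eventually_elim
        case (elim k)
        then have "\<bar>(\<Sum>i<k. X i x) / k - m\<bar> = \<bar>(\<Sum>i<k. X i x) - k * m\<bar> / k"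
          by (simp add: field_simps abs_divide)
        also have "\<dots> < 1 / Suc j" using elim by (simp add: divide_less_eq mult.commute)
        finally show ?case using j by (simp add: dist_real_def)
      qed
    qed
  qed
qed

definition pmf_entropy :: "'a pmf \<Rightarrow> real" where
  "pmf_entropy q = (\<Sum>w\<in>set_pmf q. - pmf q w * ln (pmf q w))"

locale block_process =
  fixes q :: "nat list pmf" and n :: nat
  assumes fin: "finite (set_pmf q)"
    and len: "\<And>w. w \<in> set_pmf q \<Longrightarrow> length w = n"
    and nz: "\<And>w. w \<in> set_pmf q \<Longrightarrow> 0 \<notin> set w"
    and n_pos: "0 < n"
begin

text \<open>Outside a null set \<^term>\<open>block v = v\<close>; the detour makes all digits positive everywhere.\<close>

definition block :: "nat list \<Rightarrow> nat list" where
  "block v = (if v \<in> set_pmf q then v else (SOME w. w \<in> set_pmf q))"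

abbreviation S :: "(nat \<Rightarrow> nat list) measure" where
  "S \<equiv> \<Pi>\<^sub>M i\<in>UNIV. measure_pmf q"

definition shift :: "(nat \<Rightarrow> nat list) \<Rightarrow> nat \<Rightarrow> nat list" where
  "shift \<omega> = (\<lambda>i. \<omega> (Suc i))"

definition digit :: "(nat \<Rightarrow> nat list) \<Rightarrow> nat \<Rightarrow> nat" where
  "digit \<omega> j = block (\<omega> (j div n)) ! (j mod n)"

text \<open>Finiteness of the support bounds all digits of the random points at once; the separation
  of points depends on this bound.\<close>

definition K :: nat where
  "K = Max (\<Union>w\<in>set_pmf q. set w)"

sublocale product_prob_space "\<lambda>_. measure_pmf q" "UNIV :: nat set"
  by unfold_locales

lemma block_in: "block v \<in> set_pmf q"
  unfolding block_def using set_pmf_not_empty[of q] by (auto intro: someI_ex)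

lemma length_block: "length (block v) = n" by (rule len[OF block_in])

lemma digit_in: "digit \<omega> j \<in> set (block (\<omega> (j div n)))"
  unfolding digit_def using n_pos by (intro nth_mem) (simp add: length_block)

lemma digit_pos: "0 < digit \<omega> j"
  using digit_in[of \<omega> j] nz[OF block_in] by (metis gr0I)

lemma le_K: "w \<in> set_pmf q \<Longrightarrow> a \<in> set w \<Longrightarrow> a \<le> K"
  unfolding K_def using fin by (intro Max_ge) auto

lemma digit_le: "digit \<omega> j \<le> K"
  using le_K[OF block_in digit_in] .

lemma digit_shift: "digit (shift \<omega>) j = digit \<omega> (j + n)"
  using n_pos by (simp add: digit_def shift_def)

lemma map_digit: "map (digit \<omega>) [0..<k * n] = concat (map (\<lambda>i. block (\<omega> i)) [0..<k])"
proof (induction k)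
  case (Suc k)
  have "map (digit \<omega>) [k * n..<k * n + n] = block (\<omega> k)"
    by (rule nth_equalityI) (auto simp: length_block digit_def)
  moreover have "[0..<Suc k * n] = [0..<k * n] @ [k * n..<k * n + n]"
    using upt_add_eq_append[of 0 "k * n" n] by (simp add: add.commute)
  ultimately show ?case using Suc by simp
qed simp

lemma digit_eq_imp_block_eq:
  assumes "\<And>j. j < n \<Longrightarrow> digit \<omega> (i * n + j) = digit \<omega>' (i * n + j)"
  shows "block (\<omega> i) = block (\<omega>' i)"
proof (rule nth_equalityI)
  fix j assume "j < length (block (\<omega> i))"
  then show "block (\<omega> i) ! j = block (\<omega>' i) ! j"
    using assms[of j] by (simp add: length_block digit_def)
qed (simp add: length_block)

lemma space_S: "space S = UNIV" by (simp add: space_PiM)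

lemma component_measurable: "g \<in> UNIV \<rightarrow> space N \<Longrightarrow> (\<lambda>\<omega>. g (\<omega> i)) \<in> S \<rightarrow>\<^sub>M N"
  by (rule measurable_compose[OF measurable_component_singleton]) auto

lemma shift_measurable [measurable]: "shift \<in> S \<rightarrow>\<^sub>M S"
  unfolding shift_def[abs_def] by (intro measurable_PiM_single') (auto simp: space_PiM)

lemma distr_shift: "distr S S shift = S"
  using distr_PiM_reindex[of UNIV "\<lambda>_. measure_pmf q" Suc UNIV]
  by (simp add: shift_def[abs_def] prob_space_measure_pmf restrict_def)

sublocale shift: measure_preserving S shift
  by unfold_locales (auto simp: distr_shift)

lemma funpow_shift: "(shift ^^ k) \<omega> i = \<omega> (i + k)"
  by (induction k arbitrary: i) (auto simp: shift_def)

lemma simple_function_block: "simple_function S (\<lambda>\<omega>. block (\<omega> 0))"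
  unfolding simple_function_eq_measurable
proof
  show "finite ((\<lambda>\<omega>. block (\<omega> 0)) ` space S)" using fin block_in by (auto intro: finite_subset)
qed (rule component_measurable, simp)

lemma itinerary_block: "itinerary (\<lambda>\<omega>. block (\<omega> 0)) shift k \<omega> = map (\<lambda>i. block (\<omega> i)) [0..<k]"
  by (simp add: itinerary_def funpow_shift)

lemma AE_block: "AE v in measure_pmf q. block v = v"
  by (simp add: AE_measure_pmf_iff block_def)

lemma prob_block_cylinder:
  assumes "\<And>i. i < k \<Longrightarrow> w i \<in> set_pmf q"
  shows "prob {\<omega>. \<forall>i<k. block (\<omega> i) = w i} = (\<Prod>i<k. pmf q (w i))"
proof -
  have *: "measure_pmf.prob q {v. block v = w i} = pmf q (w i)" if "i < k" for i
  proof -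
    have "measure_pmf.prob q {v. block v = w i} = measure_pmf.prob q {w i}"
      by (rule measure_pmf.finite_measure_eq_AE) (use AE_block in \<open>auto elim!: AE_mp\<close>)
    then show ?thesis by (simp add: measure_pmf_single)
  qed
  have "emeasure S {\<omega> \<in> space S. \<forall>i\<in>{..<k}. \<omega> i \<in> {v. block v = w i}} = (\<Prod>i<k. emeasure q {v. block v = w i})"
    by (rule emeasure_PiM_Collect) auto
  also have "\<dots> = ennreal (\<Prod>i<k. pmf q (w i))"
  proof -
    have "(\<Prod>i<k. measure_pmf.prob q {v. block v = w i}) = (\<Prod>i<k. pmf q (w i))"
      by (rule prod.cong) (auto simp: *)
    then show ?thesis by (simp add: measure_pmf.emeasure_eq_measure prod_ennreal)
  qed
  finally show ?thesis
    by (simp add: space_S measure_def prod_nonneg lessThan_def)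
qed

lemma expectation_block:
  fixes f :: "nat list \<Rightarrow> real"
  shows "expectation (\<lambda>\<omega>. f (block (\<omega> i))) = (\<Sum>w\<in>set_pmf q. pmf q w * f w)"
proof -
  have "expectation (\<lambda>\<omega>. f (block (\<omega> i))) = (\<integral>v. f (block v) \<partial>distr S (measure_pmf q) (\<lambda>\<omega>. \<omega> i))"
    by (rule integral_distr[symmetric]) auto
  also have "\<dots> = (\<integral>v. f (block v) \<partial>measure_pmf q)"
    using PiM_component[of i] by simp
  also have "\<dots> = (\<integral>v. f v \<partial>measure_pmf q)"
    by (rule integral_cong_AE) (use AE_block in \<open>auto elim!: AE_mp\<close>)
  also have "\<dots> = (\<Sum>w\<in>set_pmf q. pmf q w * f w)"
    using fin by (subst integral_measure_pmf[of "set_pmf q"]) (auto simp: mult.commute)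
  finally show ?thesis .
qed

lemma indep_components: "indep_vars (\<lambda>_. measure_pmf q) (\<lambda>i \<omega>. \<omega> i) UNIV"
  by (subst indep_vars_iff_distr_eq_PiM) (auto simp: PiM_component restrict_def space_PiM distr_id)

lemma strong_law_block:
  fixes f :: "nat list \<Rightarrow> real"
  shows "AE \<omega> in S. (\<lambda>k. (\<Sum>i<k. f (block (\<omega> i))) / k) \<longlonglongrightarrow> (\<Sum>w\<in>set_pmf q. pmf q w * f w)"
proof (rule strong_law_bounded)
  show "indep_vars (\<lambda>_. borel) (\<lambda>i \<omega>. f (block (\<omega> i))) UNIV"
    by (rule indep_vars_compose2[OF indep_components]) auto
  show "\<bar>f (block (\<omega> i))\<bar> \<le> (\<Sum>w\<in>set_pmf q. \<bar>f w\<bar>)" for i \<omega>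
    using fin block_in by (intro member_le_sum) auto
qed (rule expectation_block)

lemma rv_entropy_blocks:
  "rv_entropy S (itinerary (\<lambda>\<omega>. block (\<omega> 0)) shift k) = k * pmf_entropy q"
proof -
  let ?I = "itinerary (\<lambda>\<omega>. block (\<omega> 0)) shift k"
  have pr: "prob (?I -` {?I \<omega>} \<inter> space S) = (\<Prod>i<k. pmf q (block (\<omega> i)))" for \<omega>
  proof -
    have "?I -` {?I \<omega>} \<inter> space S = {\<omega>'. \<forall>i<k. block (\<omega>' i) = block (\<omega> i)}"
      by (auto simp: itinerary_eq_iff funpow_shift space_S)
    then show ?thesis by (simp add: prob_block_cylinder block_in)
  qed
  have pp: "0 < pmf q (block v)" for v using block_in by (simp add: pmf_positive)
  have "rv_entropy S ?I = (\<integral>\<omega>. - ln (prob (?I -` {?I \<omega>} \<inter> space S)) \<partial>S)"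
    by (rule rv_entropy_expectation[OF shift.simple_function_itinerary[OF simple_function_block]])
  also have "\<dots> = (\<integral>\<omega>. (\<Sum>i<k. - ln (pmf q (block (\<omega> i)))) \<partial>S)"
    unfolding pr using pp by (subst ln_prod) (auto simp: sum_negf less_imp_neq[THEN not_sym])
  also have "\<dots> = (\<Sum>i<k. (\<integral>\<omega>. - ln (pmf q (block (\<omega> i))) \<partial>S))"
  proof (rule Bochner_Integration.integral_sum)
    fix i
    show "integrable S (\<lambda>\<omega>. - ln (pmf q (block (\<omega> i))))"
      using fin block_in by (intro integrable_const_bound[where B="\<Sum>w\<in>set_pmf q. \<bar>- ln (pmf q w)\<bar>"])
        (auto intro!: AE_I2 member_le_sum[of _ _ "\<lambda>w. \<bar>ln (pmf q w)\<bar>"] component_measurable)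
  qed
  also have "\<dots> = k * pmf_entropy q"
    unfolding expectation_block[of "\<lambda>w. - ln (pmf q w)"] pmf_entropy_def by simp
  finally show ?thesis .
qed

text \<open>The offset \<open>\<kappa>\<close> allows reading to start inside a block: raising it by
  1 is one application of the Gauss map, raising it by \<open>n\<close> is one shift of the block
  sequence.\<close>

definition point :: "nat \<Rightarrow> (nat \<Rightarrow> nat list) \<Rightarrow> real" where
  "point \<kappa> \<omega> = cf_lim (\<lambda>j. digit \<omega> (j + \<kappa>))"

lemma point_cf_points: "point \<kappa> \<omega> \<in> cf_points"
  unfolding point_def by (rule cf_lim_cf_points) (rule digit_pos)

lemma funpow_gauss_map_point: "(gauss_map ^^ i) (point \<kappa> \<omega>) = point (i + \<kappa>) \<omega>"
  unfolding point_def by (subst funpow_gauss_map_cf_lim) (auto simp: digit_pos add.assoc)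

lemma cf_digit_point: "cf_digit (point \<kappa> \<omega>) (Suc i) = digit \<omega> (i + \<kappa>)"
  unfolding point_def by (rule cf_digit_cf_lim) (rule digit_pos)

lemma cf_word_point: "cf_word (point 0 \<omega>) i = map (digit \<omega>) [0..<i]"
  unfolding point_def by (subst cf_word_cf_lim) (auto simp: digit_pos)

lemma point_n: "point n \<omega> = point 0 (shift \<omega>)"
  by (simp add: point_def digit_shift)

lemma digit_measurable [measurable]: "(\<lambda>\<omega>. digit \<omega> j) \<in> S \<rightarrow>\<^sub>M count_space UNIV"
  unfolding digit_def[abs_def] by (rule component_measurable) auto

lemma point_measurable [measurable]: "point \<kappa> \<in> borel_measurable S"
proof -
  \<comment> \<open>Induction on the number of remaining digits, since \<open>cf_fold\<close>
    unfolds from the left.\<close>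
  have "(\<lambda>\<omega>. cf_fold (map (\<lambda>j. digit \<omega> (j + \<kappa>)) [a..<m]) 0) \<in> borel_measurable S" for a m
  proof (induction "m - a" arbitrary: a)
    case 0
    then show ?case by simp
  next
    case (Suc k)
    have "(\<lambda>\<omega>. cf_fold (map (\<lambda>j. digit \<omega> (j + \<kappa>)) [Suc a..<m]) 0) \<in> borel_measurable S"
      using Suc by (intro Suc(1)) auto
    moreover have "[a..<m] = a # [Suc a..<m]" using Suc by (intro upt_conv_Cons) auto
    ultimately show ?case by simp
  qed
  note meas = this
  have lim: "(\<lambda>m. cf_fold (map (\<lambda>j. digit \<omega> (j + \<kappa>)) [0..<m]) 0) \<longlonglongrightarrow> point \<kappa> \<omega>" for \<omega>
    using cf_fold_convergent[of "\<lambda>j. digit \<omega> (j + \<kappa>)", OF digit_pos] by (simp only: point_def)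
  show ?thesis
    using lim meas
    by (rule borel_measurable_LIMSEQ_real[where u = "\<lambda>m \<omega>. cf_fold (map (\<lambda>j. digit \<omega> (j + \<kappa>)) [0..<m]) 0"])
qed

end

section \<open>Invariant measures of the Gauss map\<close>

lemma gauss_map_measurable [measurable]: "gauss_map \<in> borel_measurable borel"
  unfolding gauss_map_def[abs_def] by measurable

lemma phi_measurable [measurable]: "phi \<gamma> \<in> borel_measurable borel"
  unfolding phi_def[abs_def] cf_digit_def by simp

text \<open>Avoiding the endpoints places \<open>x\<close> strictly inside the branch with first
  digit \<open>a\<close>; on it the Gauss map is 1/y - a.\<close>

lemma deriv_gauss_map:
  assumes "x \<in> cf_points"
  shows "ln \<bar>deriv gauss_map x\<bar> = - 2 * ln x"
proof -
  define a where "a = \<lfloor>1 / x\<rfloor>"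
  have x: "0 < x" "x < 1" using cf_pointsD[OF assms] by auto
  have a: "1 \<le> a" using cf_points_expand(2)[OF assms] by (simp add: a_def)
  have "0 < gauss_map x" "gauss_map x < 1"
    using cf_pointsD[OF gauss_map_cf_points[OF assms]] by auto
  then have xa: "real_of_int a < 1 / x" "1 / x < real_of_int a + 1"
    by (auto simp: gauss_map_def a_def)
  define U where "U = {1 / (real_of_int a + 1)<..<1 / real_of_int a}"
  have xU: "x \<in> U" using xa x a by (auto simp: U_def field_simps)
  have eq: "1 / y - real_of_int a = gauss_map y" if "y \<in> U" for y
  proof -
    have "0 < 1 / (real_of_int a + 1)" using a by simp
    then have "0 < y" using that unfolding U_def greaterThanLessThan_iff by (meson order.strict_trans)
    then have "real_of_int a < 1 / y" "1 / y < real_of_int a + 1"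
      using that a by (auto simp: U_def field_simps)
    then have "\<lfloor>1 / y\<rfloor> = a" by (intro floor_unique) auto
    then show ?thesis by (simp add: gauss_map_def)
  qed
  have "((\<lambda>y. 1 / y - real_of_int a) has_field_derivative - 1 / x\<^sup>2) (at x)"
    using x by (auto intro!: derivative_eq_intros simp: power2_eq_square)
  then have "(gauss_map has_field_derivative - 1 / x\<^sup>2) (at x)"
    by (rule has_field_derivative_transform_within_open[OF _ _ xU eq]) (simp add: U_def)
  then have "deriv gauss_map x = - 1 / x\<^sup>2" by (rule DERIV_imp_deriv)
  then show ?thesis using x by (simp add: ln_div ln_realpow)
qed

lemma gauss_invariant_measures_preserving:
  assumes "\<mu> \<in> gauss_invariant_measures"
  shows "measure_preserving \<mu> gauss_map"
proof -
  have \<mu>: "prob_space \<mu>" "sets \<mu> = sets borel" "distr \<mu> borel gauss_map = \<mu>"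
    using assms by (auto simp: gauss_invariant_measures_def)
  interpret prob_space \<mu> by fact
  show ?thesis
  proof
    show "gauss_map \<in> \<mu> \<rightarrow>\<^sub>M \<mu>" using \<mu>(2) by (simp cong: measurable_cong_sets)
    have "distr \<mu> \<mu> gauss_map = distr \<mu> borel gauss_map" using \<mu>(2) by (intro distr_cong) auto
    then show "distr \<mu> \<mu> gauss_map = \<mu>" using \<mu>(3) by simp
  qed
qed

text \<open>By invariance almost every point has its image in (0,1], which excludes the point 1,
  whose image is 0. Invariance under the iterates extends this to whole orbits.\<close>

lemma AE_cf_points:
  assumes "\<mu> \<in> gauss_invariant_measures"
  shows "AE x in \<mu>. x \<in> cf_points"
proof -
  interpret measure_preserving \<mu> gauss_map by (rule gauss_invariant_measures_preserving[OF assms])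
  have sets [measurable_cong]: "sets \<mu> = sets borel" and one: "emeasure \<mu> {0<..1} = 1"
    using assms by (auto simp: gauss_invariant_measures_def)
  have AE1: "AE x in \<mu>. x \<in> {0<..1}"
    using one by (intro AE_prob_1) (simp add: emeasure_eq_measure)
  have "AE x in \<mu>. gauss_map x \<in> {0<..1}"
    by (rule AE_distrD[OF T_measurable]) (unfold T_invariant, rule AE1)
  with AE1 have AE2: "AE x in \<mu>. x \<in> {0<..<1}"
  proof eventually_elim
    case (elim x)
    then have "x \<noteq> 1" by (auto simp: gauss_map_def)
    then show ?case using elim by auto
  qed
  have "AE x in \<mu>. (gauss_map ^^ n) x \<in> {0<..<1}" for n
    by (rule AE_distrD[OF funpow_measurable]) (unfold funpow_invariant, rule AE2)
  then show ?thesis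
    unfolding cf_points_def mem_Collect_eq AE_all_countable by blast
qed

lemma lyapunov_exponent_eq:
  assumes "\<mu> \<in> gauss_invariant_measures"
  shows "lyapunov_exponent \<mu> = (\<integral>\<^sup>+ x. ennreal (- 2 * ln x) \<partial>\<mu>)"
  unfolding lyapunov_exponent_def
  by (rule nn_integral_cong_AE) (use AE_cf_points[OF assms] in \<open>auto elim!: AE_mp simp: deriv_gauss_map\<close>)

text \<open>Together with finiteness this permits cancelling the exponent in quotients of extended
  reals.\<close>

lemma lyapunov_exponent_pos:
  assumes "\<mu> \<in> gauss_invariant_measures"
  shows "lyapunov_exponent \<mu> \<noteq> 0"
proof
  interpret measure_preserving \<mu> gauss_map by (rule gauss_invariant_measures_preserving[OF assms])
  have sets [measurable_cong]: "sets \<mu> = sets borel"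
    using assms by (auto simp: gauss_invariant_measures_def)
  assume "lyapunov_exponent \<mu> = 0"
  then have "AE x in \<mu>. ennreal (- 2 * ln x) = 0"
    unfolding lyapunov_exponent_eq[OF assms] by (subst (asm) nn_integral_0_iff_AE) measurable
  with AE_cf_points[OF assms] have "AE x in \<mu>. False"
  proof eventually_elim
    case (elim x)
    have "ln x < 0" using cf_pointsD[OF elim(1)] by simp
    then show ?case using elim(2) by (simp add: ennreal_eq_0_iff)
  qed
  then show False using AE_const by simp
qed

lemma rv_entropy_distr:
  assumes f: "f \<in> M \<rightarrow>\<^sub>M N" and V: "simple_function N V" and "space M \<noteq> {}"
  shows "simple_function M (\<lambda>x. V (f x))" "rv_entropy (distr M N f) V = rv_entropy M (\<lambda>x. V (f x))"
proof -
  have sp: "f ` space M \<subseteq> space N" using measurable_space[OF f] by auto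
  have eq: "f -` (V -` {y} \<inter> space N) \<inter> space M = (\<lambda>x. V (f x)) -` {y} \<inter> space M" for y
    using sp by auto
  have sub: "(\<lambda>x. V (f x)) ` space M \<subseteq> V ` space N" using sp by auto
  have "(\<lambda>x. V (f x)) -` {y} \<inter> space M \<in> sets M" for y
    using measurable_sets[OF f simple_functionD(2)[OF V, of "{y}"]] unfolding eq .
  then show "simple_function M (\<lambda>x. V (f x))"
    unfolding simple_function_def using finite_subset[OF sub simple_functionD(1)[OF V]] by blast
  show "rv_entropy (distr M N f) V = rv_entropy M (\<lambda>x. V (f x))"
    unfolding rv_entropy_superset[OF simple_functionD(1)[OF V] sub]
    unfolding rv_entropy_def by (simp only: measure_distr[OF f simple_functionD(2)[OF V]] eq space_distr)
qed

section \<open>The invariant measure generated by a block process\<close>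

lemma sum_lessThan_cyclic:
  fixes f :: "nat \<Rightarrow> 'a::comm_monoid_add"
  assumes "f n = f 0" "0 < n"
  shows "(\<Sum>i<n. f (Suc i)) = (\<Sum>i<n. f i)"
proof -
  obtain m where m: "n = Suc m" using assms by (cases n) auto
  have "(\<Sum>i<n. f (Suc i)) = (\<Sum>i<m. f (Suc i)) + f 0" using assms m by simp
  also have "\<dots> = (\<Sum>i<n. f i)" unfolding m sum.lessThan_Suc_shift by (simp add: add.commute)
  finally show ?thesis .
qed

definition digit_sum :: "real \<Rightarrow> nat list \<Rightarrow> real" where
  "digit_sum \<gamma> w = (\<Sum>a\<leftarrow>w. real a powr \<gamma>)"

lemma digit_sum_nonneg: "0 \<le> digit_sum \<gamma> w"
  unfolding digit_sum_def by (intro sum_list_nonneg) auto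

context block_process
begin

definition phase :: "nat measure" where
  "phase = measure_pmf (pmf_of_set {..<n})"

text \<open>
  The block Bernoulli measure is only invariant under \<open>G\<^sup>n\<close>; starting at a uniformly
  distributed position inside the first block makes it invariant under \<open>G\<close>.
\<close>

definition stationary :: "(nat \<times> (nat \<Rightarrow> nat list)) measure" where
  "stationary = phase \<Otimes>\<^sub>M S"

text \<open>The law of \<kappa> sits on \<open>{..<n}\<close>, but its space is all of
  \<open>nat\<close>; reducing modulo \<open>n\<close> gives the phase finitely many values
  everywhere, as simple functions require.\<close>

definition stationary_point :: "nat \<times> (nat \<Rightarrow> nat list) \<Rightarrow> real" where
  "stationary_point = (\<lambda>(\<kappa>, \<omega>). point (\<kappa> mod n) \<omega>)"

definition block_measure :: "real measure" where
  "block_measure = distr stationary borel stationary_point"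

sublocale phase: prob_space phase
  unfolding phase_def by (rule prob_space_measure_pmf)

sublocale stationary: pair_prob_space phase S
  by unfold_locales

lemma space_stationary: "space stationary = UNIV"
  by (simp add: stationary_def space_pair_measure space_S phase_def)

lemma stationary_prob_space: "prob_space stationary"
  unfolding stationary_def by (rule stationary.prob_space_axioms)

lemma measurable_stationary:
  assumes "\<And>\<kappa>. (\<lambda>\<omega>. f (\<kappa>, \<omega>)) \<in> S \<rightarrow>\<^sub>M N"
  shows "f \<in> stationary \<rightarrow>\<^sub>M N"
proof -
  have "sets stationary = sets (count_space UNIV \<Otimes>\<^sub>M S)"
    unfolding stationary_def phase_def by (intro sets_pair_measure_cong) auto
  then show ?thesis
    using measurable_pair_measure_countable1[of UNIV f S N] assms by (simp cong: measurable_cong_sets)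
qed

lemma stationary_point_measurable [measurable]: "stationary_point \<in> borel_measurable stationary"
  by (rule measurable_stationary) (simp add: stationary_point_def)

lemma nn_integral_stationary:
  assumes f: "f \<in> borel_measurable stationary"
  shows "(\<integral>\<^sup>+ x. f x \<partial>stationary) = (\<Sum>\<kappa><n. \<integral>\<^sup>+ \<omega>. f (\<kappa>, \<omega>) \<partial>S) / n"
proof -
  have "(\<integral>\<^sup>+ x. f x \<partial>stationary) = (\<integral>\<^sup>+ \<kappa>. \<integral>\<^sup>+ \<omega>. f (\<kappa>, \<omega>) \<partial>S \<partial>phase)"
    using f unfolding stationary_def by (intro P.nn_integral_fst[symmetric])
  also have "\<dots> = (\<Sum>\<kappa><n. \<integral>\<^sup>+ \<omega>. f (\<kappa>, \<omega>) \<partial>S) / n"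
    unfolding phase_def using n_pos by (subst nn_integral_pmf_of_set) auto
  finally show ?thesis .
qed

lemma nn_integral_block_measure:
  assumes [measurable]: "f \<in> borel_measurable borel"
  shows "(\<integral>\<^sup>+ x. f x \<partial>block_measure) = (\<integral>\<^sup>+ \<omega>. (\<Sum>\<kappa><n. f (point \<kappa> \<omega>)) \<partial>S) / n"
proof -
  have "(\<integral>\<^sup>+ x. f x \<partial>block_measure) = (\<integral>\<^sup>+ x. f (stationary_point x) \<partial>stationary)"
    unfolding block_measure_def by (rule nn_integral_distr) auto
  also have "\<dots> = (\<Sum>\<kappa><n. \<integral>\<^sup>+ \<omega>. f (point \<kappa> \<omega>) \<partial>S) / n"
  proof (subst nn_integral_stationary)
    show "(\<lambda>x. f (stationary_point x)) \<in> borel_measurable stationary" by measurable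
  qed (simp add: stationary_point_def)
  also have "(\<Sum>\<kappa><n. \<integral>\<^sup>+ \<omega>. f (point \<kappa> \<omega>) \<partial>S) = (\<integral>\<^sup>+ \<omega>. (\<Sum>\<kappa><n. f (point \<kappa> \<omega>)) \<partial>S)"
    by (rule nn_integral_sum[symmetric]) measurable
  finally show ?thesis .
qed

lemma sets_block_measure [measurable_cong, simp]: "sets block_measure = sets borel"
  by (simp add: block_measure_def)

lemma block_measure_prob_space: "prob_space block_measure"
  unfolding block_measure_def by (rule prob_space.prob_space_distr[OF stationary_prob_space]) measurable

lemma nn_integral_shift:
  assumes [measurable]: "f \<in> borel_measurable S"
  shows "(\<integral>\<^sup>+ \<omega>. f (shift \<omega>) \<partial>S) = (\<integral>\<^sup>+ \<omega>. f \<omega> \<partial>S)"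
  using nn_integral_distr[of shift S S f] by (simp add: distr_shift)

text \<open>The Gauss map moves the phases 0,...,n-1 to 1,...,n, and phase \<open>n\<close> is phase
  0 of the shifted block sequence, which has the same law. The sum over the phases is therefore
  unchanged.\<close>

lemma block_measure_invariant: "block_measure \<in> gauss_invariant_measures"
proof -
  interpret B: prob_space block_measure by (rule block_measure_prob_space)
  have "stationary_point x \<in> {0<..1}" for x
    using cf_pointsD[OF point_cf_points] by (auto simp: stationary_point_def less_imp_le split: prod.split)
  then have "AE x in block_measure. x \<in> {0<..1}"
    unfolding block_measure_def by (subst AE_distr_iff) (auto simp del: greaterThanAtMost_iff)
  then have 1: "emeasure block_measure {0<..1} = 1"
    using B.prob_eq_1[of "{0<..1}"] by (simp add: B.emeasure_eq_measure)
  have 2: "distr block_measure borel gauss_map = block_measure"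
  proof (rule measure_eqI)
    fix A assume "A \<in> sets (distr block_measure borel gauss_map)"
    then have A [measurable]: "A \<in> sets borel" by simp
    have "emeasure (distr block_measure borel gauss_map) A = (\<integral>\<^sup>+ x. indicator A (gauss_map x) \<partial>block_measure)"
    proof -
      have "emeasure (distr block_measure borel gauss_map) A =
          (\<integral>\<^sup>+ x. indicator A x \<partial>distr block_measure borel gauss_map)" by simp
      also have "\<dots> = (\<integral>\<^sup>+ x. indicator A (gauss_map x) \<partial>block_measure)"
        by (rule nn_integral_distr) measurable
      finally show ?thesis .
    qed
    also have "\<dots> = (\<integral>\<^sup>+ \<omega>. (\<Sum>\<kappa><n. indicator A (gauss_map (point \<kappa> \<omega>))) \<partial>S) / n"
      by (rule nn_integral_block_measure) measurable
    also have "(\<lambda>\<omega>. \<Sum>\<kappa><n. indicator A (gauss_map (point \<kappa> \<omega>))) = (\<lambda>\<omega>. \<Sum>\<kappa><n. indicator A (point (Suc \<kappa>) \<omega>))"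
      using funpow_gauss_map_point[of 1] by simp
    also have "(\<integral>\<^sup>+ \<omega>. (\<Sum>\<kappa><n. indicator A (point (Suc \<kappa>) \<omega>)) \<partial>S) = (\<Sum>\<kappa><n. \<integral>\<^sup>+ \<omega>. indicator A (point (Suc \<kappa>) \<omega>) \<partial>S)"
      by (rule nn_integral_sum) measurable
    also have "\<dots> = (\<Sum>\<kappa><n. \<integral>\<^sup>+ \<omega>. indicator A (point \<kappa> \<omega>) \<partial>S)"
    proof -
      let ?f = "\<lambda>\<kappa>. \<integral>\<^sup>+ \<omega>. indicator A (point \<kappa> \<omega>) \<partial>S"
      have "?f n = ?f 0"
        unfolding point_n by (rule nn_integral_shift) measurable
      then show ?thesis using n_pos by (rule sum_lessThan_cyclic)
    qed
    also have "\<dots> = (\<integral>\<^sup>+ \<omega>. (\<Sum>\<kappa><n. indicator A (point \<kappa> \<omega>)) \<partial>S)"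
      by (rule nn_integral_sum[symmetric]) measurable
    also have "\<dots> / n = (\<integral>\<^sup>+ x. indicator A x \<partial>block_measure)"
      by (rule nn_integral_block_measure[symmetric]) measurable
    also have "\<dots> = emeasure block_measure A" by simp
    finally show "emeasure (distr block_measure borel gauss_map) A = emeasure block_measure A" .
  qed simp
  show ?thesis
    unfolding gauss_invariant_measures_def using 1 2 block_measure_prob_space by simp
qed

lemma nn_integral_block:
  assumes "\<And>w. w \<in> set_pmf q \<Longrightarrow> 0 \<le> f w"
  shows "(\<integral>\<^sup>+ \<omega>. ennreal (f (block (\<omega> 0))) \<partial>S) = ennreal (\<Sum>w\<in>set_pmf q. pmf q w * f w)"
proof -
  have "integrable S (\<lambda>\<omega>. f (block (\<omega> 0)))"
    by (rule expectation_simple(1)[OF simple_function_block])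
  then show ?thesis
    using assms block_in by (subst nn_integral_eq_integral) (auto simp: expectation_block)
qed

text \<open>Summed over the phases, the first digits run exactly once through the digits of block
  0.\<close>

lemma block_measure_phi:
  fixes \<gamma> :: real
  defines "m \<equiv> (\<Sum>w\<in>set_pmf q. pmf q w * digit_sum \<gamma> w)"
  shows "integrable block_measure (phi \<gamma>)" "(\<integral>x. phi \<gamma> x \<partial>block_measure) = - (m / n)"
proof -
  have m: "0 \<le> m" unfolding m_def by (intro sum_nonneg mult_nonneg_nonneg digit_sum_nonneg) auto
  have "(\<integral>\<^sup>+ x. ennreal (- phi \<gamma> x) \<partial>block_measure) = (\<integral>\<^sup>+ \<omega>. (\<Sum>\<kappa><n. ennreal (- phi \<gamma> (point \<kappa> \<omega>))) \<partial>S) / n"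
    by (rule nn_integral_block_measure) measurable
  also have "(\<lambda>\<omega>. \<Sum>\<kappa><n. ennreal (- phi \<gamma> (point \<kappa> \<omega>))) = (\<lambda>\<omega>. ennreal (digit_sum \<gamma> (block (\<omega> 0))))"
  proof
    fix \<omega>
    have "(\<Sum>\<kappa><n. ennreal (- phi \<gamma> (point \<kappa> \<omega>))) = ennreal (\<Sum>\<kappa><n. real (digit \<omega> \<kappa>) powr \<gamma>)"
      using cf_digit_point[of _ \<omega> 0] by (simp add: phi_def)
    also have "(\<Sum>\<kappa><n. real (digit \<omega> \<kappa>) powr \<gamma>) = digit_sum \<gamma> (block (\<omega> 0))"
      unfolding digit_sum_def sum_list_sum_nth by (intro sum.cong) (auto simp: length_block digit_def)
    finally show "(\<Sum>\<kappa><n. ennreal (- phi \<gamma> (point \<kappa> \<omega>))) = ennreal (digit_sum \<gamma> (block (\<omega> 0)))" .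
  qed
  also have "(\<integral>\<^sup>+ \<omega>. ennreal (digit_sum \<gamma> (block (\<omega> 0))) \<partial>S) = ennreal m"
    unfolding m_def by (rule nn_integral_block) (rule digit_sum_nonneg)
  also have "ennreal m / n = ennreal (m / n)"
    using m n_pos by (simp add: divide_ennreal ennreal_of_nat_eq_real_of_nat)
  finally have nn: "(\<integral>\<^sup>+ x. ennreal (- phi \<gamma> x) \<partial>block_measure) = ennreal (m / n)" .
  have pos: "0 \<le> - phi \<gamma> x" for x by (simp add: phi_def)
  have i: "integrable block_measure (\<lambda>x. - phi \<gamma> x)"
    using nn pos by (intro integrableI_nonneg) auto
  then show "integrable block_measure (phi \<gamma>)" by simp
  have "(\<integral>x. - phi \<gamma> x \<partial>block_measure) = m / n"
    using nn pos m by (subst integral_eq_nn_integral) (auto intro!: AE_I2)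
  then show "(\<integral>x. phi \<gamma> x \<partial>block_measure) = - (m / n)" by simp
qed

text \<open>The sum over the phases is the Birkhoff sum over the first \<open>n\<close> orbit
  points, which distortion compares with \<open>cf_log\<close> of block 0.\<close>

lemma lyapunov_exponent_block_measure:
  "lyapunov_exponent block_measure \<le> ennreal (((\<Sum>w\<in>set_pmf q. pmf q w * cf_log w) + 2 * ln 2) / n)"
proof -
  have "lyapunov_exponent block_measure = (\<integral>\<^sup>+ \<omega>. (\<Sum>\<kappa><n. ennreal (- 2 * ln (point \<kappa> \<omega>))) \<partial>S) / n"
    unfolding lyapunov_exponent_eq[OF block_measure_invariant] by (rule nn_integral_block_measure) measurable
  also have "(\<integral>\<^sup>+ \<omega>. (\<Sum>\<kappa><n. ennreal (- 2 * ln (point \<kappa> \<omega>))) \<partial>S) \<le>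
      (\<integral>\<^sup>+ \<omega>. ennreal (cf_log (block (\<omega> 0)) + 2 * ln 2) \<partial>S)"
  proof (rule nn_integral_mono)
    fix \<omega>
    have pos: "0 \<le> - 2 * ln (point \<kappa> \<omega>)" for \<kappa>
      using cf_pointsD[OF point_cf_points[of \<kappa> \<omega>]] by simp
    have "(\<Sum>\<kappa><n. - 2 * ln ((gauss_map ^^ \<kappa>) (point 0 \<omega>))) \<le> cf_log (cf_word (point 0 \<omega>) n) + 2 * ln 2"
      by (rule cf_log_cf_word_bounds(2)[OF point_cf_points])
    also have "cf_word (point 0 \<omega>) n = block (\<omega> 0)"
      using map_digit[of \<omega> 1] by (simp add: cf_word_point)
    finally show "(\<Sum>\<kappa><n. ennreal (- 2 * ln (point \<kappa> \<omega>))) \<le> ennreal (cf_log (block (\<omega> 0)) + 2 * ln 2)"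
      using pos by (subst sum_ennreal) (auto intro!: ennreal_leI simp: funpow_gauss_map_point)
  qed
  also have "(\<integral>\<^sup>+ \<omega>. ennreal (cf_log (block (\<omega> 0)) + 2 * ln 2) \<partial>S) =
      ennreal (\<Sum>w\<in>set_pmf q. pmf q w * (cf_log w + 2 * ln 2))"
    by (rule nn_integral_block) (use nz cf_log_nonneg in \<open>auto intro!: add_nonneg_nonneg\<close>)
  also have "(\<Sum>w\<in>set_pmf q. pmf q w * (cf_log w + 2 * ln 2)) = (\<Sum>w\<in>set_pmf q. pmf q w * cf_log w) + 2 * ln 2"
    using sum_pmf_eq_1[OF fin order.refl] by (simp add: distrib_left sum.distrib flip: sum_distrib_right)
  finally have "lyapunov_exponent block_measure \<le> ennreal ((\<Sum>w\<in>set_pmf q. pmf q w * cf_log w) + 2 * ln 2) / n"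
    by (simp add: divide_right_mono_ennreal)
  moreover have "0 \<le> (\<Sum>w\<in>set_pmf q. pmf q w * cf_log w) + 2 * ln 2"
    using nz cf_log_nonneg by (intro add_nonneg_nonneg sum_nonneg) auto
  ultimately show ?thesis
    using n_pos by (simp add: divide_ennreal ennreal_of_nat_eq_real_of_nat)
qed

text \<open>A window of (j+1)n digits, together with the phase from which it is read, reveals the
  \<open>j\<close> blocks after block 0. The phase has a fixed entropy \<open>c\<close>, which
  disappears after division by the window length.\<close>

lemma measure_entropy_block_measure:
  "ennreal (pmf_entropy q / n) \<le> measure_entropy block_measure gauss_map"
proof -
  interpret B: measure_preserving block_measure gauss_map
    by (rule gauss_invariant_measures_preserving[OF block_measure_invariant])
  interpret M2: prob_space stationary by (rule stationary_prob_space)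
  \<comment> \<open>The cap \<open>K\<close> changes no digit of a point produced by the process,
    but makes \<open>Z\<close> finite-valued on the whole line.\<close>
  define Z where "Z x = min (nat \<lfloor>1 / x\<rfloor>) K" for x :: real
  have Z: "simple_function block_measure Z"
    unfolding simple_function_eq_measurable
  proof
    have "Z ` space block_measure \<subseteq> {..K}" by (auto simp: Z_def)
    then show "finite (Z ` space block_measure)" by (rule finite_subset) simp
    show "Z \<in> block_measure \<rightarrow>\<^sub>M count_space UNIV" unfolding Z_def by measurable
  qed
  define c where "c = rv_entropy stationary (\<lambda>(\<kappa>, \<omega>). \<kappa> mod n)"
  have phase: "simple_function stationary (\<lambda>(\<kappa>, \<omega>). \<kappa> mod n)"
    unfolding simple_function_eq_measurable
  proof
    have "(\<lambda>(\<kappa>, \<omega>). \<kappa> mod n) ` space stationary \<subseteq> {..<n}" using n_pos by auto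
    then show "finite ((\<lambda>(\<kappa>, \<omega>). \<kappa> mod n) ` space stationary)" by (rule finite_subset) simp
  qed (rule measurable_stationary, simp)
  let ?b = "\<lambda>j. itinerary (\<lambda>\<omega>. block (\<omega> 0)) shift j"
  have lower: "j * pmf_entropy q - c \<le> rv_entropy block_measure (itinerary Z gauss_map (Suc j * n))" for j
  proof -
    let ?V = "\<lambda>x. itinerary Z gauss_map (Suc j * n) (stationary_point x)"
    have sb: "simple_function S (\<lambda>\<omega>. ?b j (shift \<omega>))"
      using shift.simple_function_funpow[OF shift.simple_function_itinerary[OF simple_function_block, of j], of 1] by simp
    have snd_distr: "distr stationary S snd = S"
    proof (rule measure_eqI)
      fix A assume "A \<in> sets (distr stationary S snd)"
      then have A: "A \<in> sets S" by simp
      then have "emeasure (distr stationary S snd) A = emeasure stationary (space phase \<times> A)"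
        using sets.sets_into_space[OF A]
        by (auto simp: emeasure_distr stationary_def space_pair_measure intro!: arg_cong[where f="emeasure _"])
      also have "\<dots> = emeasure phase (space phase) * emeasure S A"
        unfolding stationary_def by (rule P.emeasure_pair_measure_Times) (use A in auto)
      finally show "emeasure (distr stationary S snd) A = emeasure S A"
        by (simp add: phase.emeasure_space_1)
    qed simp
    have snd_meas: "snd \<in> stationary \<rightarrow>\<^sub>M S" unfolding stationary_def by simp
    have V_nth: "?V (\<kappa>, \<omega>) ! i = digit \<omega> (i + \<kappa> mod n)" if "i < Suc j * n" for \<kappa> \<omega> i
    proof -
      have "nat \<lfloor>1 / point (i + \<kappa> mod n) \<omega>\<rfloor> = digit \<omega> (i + \<kappa> mod n)"
        using cf_digit_point[of "i + \<kappa> mod n" \<omega> 0] by (simp add: cf_digit_def)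
      then show ?thesis
        using that digit_le[of \<omega> "i + \<kappa> mod n"]
        by (simp add: itinerary_def stationary_point_def funpow_gauss_map_point Z_def)
    qed
    have V: "simple_function stationary ?V"
      using rv_entropy_distr(1)[OF stationary_point_measurable, of "itinerary Z gauss_map (Suc j * n)"]
        B.simple_function_itinerary[OF Z, of "Suc j * n"] space_stationary
      by (auto simp: simple_function_def block_measure_def cong: measurable_cong_sets)
    have "j * pmf_entropy q = rv_entropy S (?b j)" by (rule rv_entropy_blocks[symmetric])
    also have "\<dots> = rv_entropy S (\<lambda>\<omega>. ?b j (shift \<omega>))"
      using shift.rv_entropy_funpow[OF shift.simple_function_itinerary[OF simple_function_block, of j], of 1] by simp
    also have "\<dots> = rv_entropy (distr stationary S snd) (\<lambda>\<omega>. ?b j (shift \<omega>))" by (simp add: snd_distr)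
    also have "\<dots> = rv_entropy stationary (\<lambda>x. ?b j (shift (snd x)))"
      by (rule rv_entropy_distr(2)[OF snd_meas sb]) (simp add: space_stationary)
    also have "\<dots> \<le> rv_entropy stationary (\<lambda>x. (?V x, (\<lambda>(\<kappa>, \<omega>). \<kappa> mod n) x))"
    proof (rule M2.rv_entropy_mono)
      show "simple_function stationary (\<lambda>x. ?b j (shift (snd x)))"
        by (rule rv_entropy_distr(1)[OF snd_meas sb]) (simp add: space_stationary)
      show "simple_function stationary (\<lambda>x. (?V x, (\<lambda>(\<kappa>, \<omega>). \<kappa> mod n) x))"
        by (intro simple_function_Pair V phase)
      fix x y :: "nat \<times> (nat \<Rightarrow> nat list)"
      obtain \<kappa> \<omega> \<kappa>' \<omega>' where xy: "x = (\<kappa>, \<omega>)" "y = (\<kappa>', \<omega>')" by (cases x, cases y) auto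
      assume "(?V x, (\<lambda>(\<kappa>, \<omega>). \<kappa> mod n) x) = (?V y, (\<lambda>(\<kappa>, \<omega>). \<kappa> mod n) y)"
      then have eq: "?V (\<kappa>, \<omega>) = ?V (\<kappa>', \<omega>')" "\<kappa>' mod n = \<kappa> mod n" by (auto simp: xy)
      have "block (\<omega> (Suc i)) = block (\<omega>' (Suc i))" if "i < j" for i
      proof (rule digit_eq_imp_block_eq)
        fix l assume l: "l < n"
        \<comment> \<open>The place of letter \<open>l\<close> of block \<open>Suc i\<close> in a
          window that begins \<open>\<kappa> mod n\<close> digits into block 0. Block 0 itself may
          be cut, hence the comparison with the shifted sequence.\<close>
        define m where "m = Suc i * n + l - \<kappa> mod n"
        have "\<kappa> mod n < n" using n_pos by simp
        then have m: "m + \<kappa> mod n = Suc i * n + l" by (simp add: m_def)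
        have "Suc (Suc i) * n \<le> Suc j * n" using that by (intro mult_right_mono) auto
        then have "m < Suc j * n" using l m by simp
        then show "digit \<omega> (Suc i * n + l) = digit \<omega>' (Suc i * n + l)"
          using V_nth[of m \<kappa> \<omega>] V_nth[of m \<kappa>' \<omega>'] eq m by simp
      qed
      then show "?b j (shift (snd x)) = ?b j (shift (snd y))"
        by (simp add: xy itinerary_block shift_def)
    qed
    also have "\<dots> \<le> rv_entropy stationary ?V + c"
      unfolding c_def by (rule M2.rv_entropy_Pair_le[OF V phase])
    also have "rv_entropy stationary ?V = rv_entropy block_measure (itinerary Z gauss_map (Suc j * n))"
      unfolding block_measure_def
      using B.simple_function_itinerary[OF Z, of "Suc j * n"] space_stationary
      by (intro rv_entropy_distr(2)[symmetric] stationary_point_measurable)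
        (auto simp: simple_function_def block_measure_def)
    finally show ?thesis by simp
  qed
  let ?h = "\<lambda>m. rv_entropy block_measure (itinerary Z gauss_map m) / m"
  have "(\<lambda>j. ?h (Suc j * n)) \<longlonglongrightarrow> (INF m\<in>{1..}. ?h m)"
    using LIMSEQ_subseq_LIMSEQ[OF B.rv_entropy_itinerary_tendsto[OF Z], of "\<lambda>j. Suc j * n"] n_pos
    by (simp add: comp_def strict_mono_def)
  moreover have "(\<lambda>j. (j * pmf_entropy q - c) / (Suc j * n)) \<longlonglongrightarrow> pmf_entropy q / n"
  proof -
    have "(\<lambda>j. (j / Suc j * pmf_entropy q - c * inverse (Suc j)) / n) \<longlonglongrightarrow> (1 * pmf_entropy q - c * 0) / n"
      using n_pos by (intro tendsto_intros LIMSEQ_n_over_Suc_n LIMSEQ_inverse_real_of_nat) auto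
    moreover have "(j / Suc j * pmf_entropy q - c * inverse (Suc j)) / n = (j * pmf_entropy q - c) / (Suc j * n)" for j
    proof -
      have "(j / Suc j * pmf_entropy q - c * inverse (Suc j)) / n = ((j * pmf_entropy q - c) / Suc j) / n"
        by (simp only: diff_divide_distrib divide_inverse) (simp add: algebra_simps)
      then show ?thesis by (simp only: divide_divide_eq_left of_nat_mult)
    qed
    ultimately show ?thesis by simp
  qed
  moreover have "(j * pmf_entropy q - c) / (Suc j * n) \<le> ?h (Suc j * n)" for j
    using lower[of j] by (intro divide_right_mono) auto
  ultimately have "pmf_entropy q / n \<le> (INF m\<in>{1..}. ?h m)"
    by (intro LIMSEQ_le) auto
  then show ?thesis
    using B.measure_entropy_ge[OF Z] by (meson ennreal_leI order.trans)
qed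

lemma block_measure_dimension:
  assumes s: "0 \<le> s" "s * ((\<Sum>w\<in>set_pmf q. pmf q w * cf_log w) + 2 * ln 2) \<le> pmf_entropy q"
  shows "lyapunov_exponent block_measure < \<infinity>"
    "ennreal s \<le> measure_entropy block_measure gauss_map / lyapunov_exponent block_measure"
proof -
  let ?L = "(\<Sum>w\<in>set_pmf q. pmf q w * cf_log w) + 2 * ln 2"
  have L: "0 \<le> ?L" using nz cf_log_nonneg by (intro add_nonneg_nonneg sum_nonneg) auto
  show fin: "lyapunov_exponent block_measure < \<infinity>"
    using lyapunov_exponent_block_measure by (rule order.strict_trans1) simp
  have "ennreal s * lyapunov_exponent block_measure \<le> ennreal s * ennreal (?L / n)"
    by (intro mult_left_mono lyapunov_exponent_block_measure) auto
  also have "\<dots> = ennreal (s * ?L / n)" using s L by (simp add: ennreal_mult'' flip: ennreal_mult)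
  also have "\<dots> \<le> ennreal (pmf_entropy q / n)" using s by (intro ennreal_leI divide_right_mono) auto
  also have "\<dots> \<le> measure_entropy block_measure gauss_map" by (rule measure_entropy_block_measure)
  finally have *: "ennreal s * lyapunov_exponent block_measure \<le> measure_entropy block_measure gauss_map" .
  then have "ennreal s * lyapunov_exponent block_measure / lyapunov_exponent block_measure
      \<le> measure_entropy block_measure gauss_map / lyapunov_exponent block_measure"
    by (rule divide_right_mono_ennreal)
  then show "ennreal s \<le> measure_entropy block_measure gauss_map / lyapunov_exponent block_measure"
    using fin lyapunov_exponent_pos[OF block_measure_invariant] ennreal_mult_divide_eq by (simp add: less_top)
qed

end

section \<open>The lower bound for the dimension\<close>

text \<open>The incomplete last block has fewer than \<open>n\<close> terms, each at most
  \<open>D\<close>, and vanishes in the limit; on complete blocks only the normalisation changes, by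
  the ratio of \<open>N div n\<close> to \<open>N\<close>.\<close>

lemma block_average_tendsto:
  fixes g :: "nat \<Rightarrow> real"
  assumes g: "\<And>j. 0 \<le> g j" "\<And>j. g j \<le> D" and n: "0 < n"
    and lim: "(\<lambda>k. (\<Sum>j<k * n. g j) / k) \<longlonglongrightarrow> real n * \<alpha>"
  shows "(\<lambda>N. (\<Sum>j<N. g j) / N) \<longlonglongrightarrow> \<alpha>"
proof -
  have div_top: "filterlim (\<lambda>N. N div n) at_top at_top"
    unfolding filterlim_at_top
  proof
    fix Z
    show "\<forall>\<^sub>F N in at_top. Z \<le> N div n"
      using eventually_ge_at_top[of "Z * n"] by eventually_elim (use n in \<open>simp add: less_eq_div_iff_mult_less_eq\<close>)
  qed
  have small: "(\<lambda>N. f N / N) \<longlonglongrightarrow> 0" if "\<And>N. 0 \<le> f N" "\<And>N. f N \<le> C" for f :: "nat \<Rightarrow> real" and C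
  proof (rule tendsto_sandwich[where f = "\<lambda>_. 0" and h = "\<lambda>N. C / real N"])
    show "(\<lambda>N. C / real N) \<longlonglongrightarrow> 0" by (rule lim_const_over_n)
  qed (use that in \<open>auto intro!: always_eventually divide_right_mono\<close>)
  have ratio: "(\<lambda>N. real (N div n) / N) \<longlonglongrightarrow> 1 / n"
  proof (rule Lim_transform_eventually)
    show "(\<lambda>N. 1 / n - (real (N mod n) / n) / N) \<longlonglongrightarrow> 1 / n"
      using tendsto_diff[OF tendsto_const small[of "\<lambda>N. real (N mod n) / n" 1]] n by (simp add: less_imp_le)
    show "\<forall>\<^sub>F N in sequentially. 1 / n - (real (N mod n) / n) / N = real (N div n) / N"
      using eventually_gt_at_top[of 0]
    proof eventually_elim
      case (elim N)
      have "real N = real (N div n) * n + real (N mod n)" by (simp flip: of_nat_mult of_nat_add)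
      then have "real (N mod n) = real N - real (N div n) * n" by linarith
      then show ?case using elim n by (simp add: diff_divide_distrib)
    qed
  qed
  have main: "(\<lambda>N. (\<Sum>j<N div n * n. g j) / N) \<longlonglongrightarrow> \<alpha>"
  proof (rule Lim_transform_eventually)
    show "(\<lambda>N. (\<Sum>j<N div n * n. g j) / real (N div n) * (real (N div n) / N)) \<longlonglongrightarrow> \<alpha>"
      using tendsto_mult[OF filterlim_compose[OF lim div_top] ratio] n by simp
    show "\<forall>\<^sub>F N in sequentially. (\<Sum>j<N div n * n. g j) / real (N div n) * (real (N div n) / N) = (\<Sum>j<N div n * n. g j) / N"
      using eventually_ge_at_top[of n]
    proof eventually_elim
      case (elim N)
      then have "0 < N div n" using n by (simp add: div_greater_zero_iff)
      then show ?case by simp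
    qed
  qed
  have sum_split: "(\<Sum>j<N. g j) = (\<Sum>j<N div n * n. g j) + (\<Sum>j=N div n * n..<N. g j)" for N
    unfolding lessThan_atLeast0 by (rule sum.atLeastLessThan_concat[symmetric]) auto
  have rest: "(\<lambda>N. (\<Sum>j=N div n * n..<N. g j) / N) \<longlonglongrightarrow> 0"
  proof (rule small)
    fix N
    show "0 \<le> (\<Sum>j=N div n * n..<N. g j)" using g by (intro sum_nonneg) auto
    have "(\<Sum>j=N div n * n..<N. g j) \<le> real (card {N div n * n..<N}) * D"
      using g by (intro sum_bounded_above) auto
    also have "\<dots> \<le> real n * D"
    proof (intro mult_right_mono)
      have "N - N div n * n = N mod n" by (simp add: minus_div_mult_eq_mod)
      then show "real (card {N div n * n..<N}) \<le> real n" using n by (simp add: less_imp_le)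
      show "0 \<le> D" using order.trans[OF g(1)[of 0] g(2)[of 0]] .
    qed
    finally show "(\<Sum>j=N div n * n..<N. g j) \<le> real n * D" .
  qed
  show ?thesis
    using tendsto_add[OF main rest] by (simp only: add_divide_distrib[symmetric] sum_split[symmetric] add_0_right)
qed

context block_process
begin

lemma AE_point_cf_mean_set:
  assumes \<gamma>: "\<gamma> > 0" and mean: "(\<Sum>w\<in>set_pmf q. pmf q w * digit_sum \<gamma> w) = real n * \<alpha>"
  shows "AE \<omega> in S. point 0 \<omega> \<in> cf_mean_set \<alpha> \<gamma>"
  using strong_law_block[of "digit_sum \<gamma>"]
proof (rule AE_mp, intro AE_I2 impI)
  fix \<omega> :: "nat \<Rightarrow> nat list"
  assume lim: "(\<lambda>k. (\<Sum>i<k. digit_sum \<gamma> (block (\<omega> i))) / k) \<longlonglongrightarrow> (\<Sum>w\<in>set_pmf q. pmf q w * digit_sum \<gamma> w)"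
  let ?g = "\<lambda>j. real (digit \<omega> j) powr \<gamma>"
  have "(\<Sum>i<k. digit_sum \<gamma> (block (\<omega> i))) = (\<Sum>j<k * n. ?g j)" for k
  proof -
    have "(\<Sum>j<k * n. ?g j) = digit_sum \<gamma> (map (digit \<omega>) [0..<k * n])"
      by (simp add: digit_sum_def interv_sum_list_conv_sum_set_nat lessThan_atLeast0 comp_def)
    also have "\<dots> = (\<Sum>i<k. digit_sum \<gamma> (block (\<omega> i)))"
      unfolding map_digit by (induction k) (auto simp: digit_sum_def)
    finally show ?thesis by simp
  qed
  with lim have "(\<lambda>k. (\<Sum>j<k * n. ?g j) / k) \<longlonglongrightarrow> real n * \<alpha>" by (simp add: mean)
  then have "(\<lambda>N. (\<Sum>j<N. ?g j) / N) \<longlonglongrightarrow> \<alpha>"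
    using digit_le \<gamma> n_pos by (intro block_average_tendsto[of ?g "real K powr \<gamma>"]) (auto intro!: powr_mono2)
  moreover have "(\<Sum>j<N. ?g j) = (\<Sum>i=1..N. real (cf_digit (point 0 \<omega>) i) powr \<gamma>)" for N
    by (rule sum.reindex_bij_witness[of _ "\<lambda>i. i - 1" Suc]) (auto simp: cf_digit_point[of 0, simplified])
  ultimately show "point 0 \<omega> \<in> cf_mean_set \<alpha> \<gamma>"
    using cf_pointsD[OF point_cf_points] cf_points_irrational[OF point_cf_points]
    by (simp add: cf_mean_set_def)
qed

text \<open>The sequences along which cylinder probabilities are at most the \<open>s\<close>-th power of the length.\<close>

definition regular :: "real \<Rightarrow> nat \<Rightarrow> (nat \<Rightarrow> nat list) set" where
  "regular s k0 = {\<omega>. \<forall>k\<ge>k0. 0 \<le> (\<Sum>i<k. - ln (pmf q (block (\<omega> i))) - s * (cf_log (block (\<omega> i)) + 2 * ln 2))}"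

lemma regular_measurable [measurable]: "regular s k0 \<in> sets S"
proof -
  have [measurable]: "(\<lambda>\<omega>. - ln (pmf q (block (\<omega> i))) - s * (cf_log (block (\<omega> i)) + 2 * ln 2)) \<in> borel_measurable S" for i
    by (rule component_measurable) auto
  have "{\<omega> \<in> space S. \<forall>k\<in>{k0..}. 0 \<le> (\<Sum>i<k. - ln (pmf q (block (\<omega> i))) - s * (cf_log (block (\<omega> i)) + 2 * ln 2))} \<in> sets S"
    by measurable
  then show ?thesis by (simp add: regular_def space_S Ball_def)
qed

text \<open>By hypothesis the summands in \<open>regular\<close> have positive mean under
  \<open>q\<close>, so almost surely their sums are eventually nonnegative. The sets for k0 = 0, 1,
  ... thus exhaust almost all sequences, and one of them has positive mass.\<close>

lemma ex_regular:
  assumes "s * ((\<Sum>w\<in>set_pmf q. pmf q w * cf_log w) + 2 * ln 2) < pmf_entropy q"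
  obtains k0 where "0 < emeasure S (regular s k0)"
proof -
  let ?Y = "\<lambda>w. - ln (pmf q w) - s * (cf_log w + 2 * ln 2)"
  have "(\<Sum>w\<in>set_pmf q. pmf q w * ?Y w) =
      pmf_entropy q - s * ((\<Sum>w\<in>set_pmf q. pmf q w * cf_log w) + 2 * ln 2 * (\<Sum>w\<in>set_pmf q. pmf q w))"
    by (simp add: pmf_entropy_def sum_distrib_left sum_distrib_right sum.distrib sum_subtractf algebra_simps sum_negf)
  then have mean: "0 < (\<Sum>w\<in>set_pmf q. pmf q w * ?Y w)"
    using assms sum_pmf_eq_1[OF fin order.refl] by simp
  have "AE \<omega> in S. \<omega> \<in> (\<Union>k0. regular s k0)"
    using strong_law_block[of ?Y]
  proof (rule AE_mp, intro AE_I2 impI)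
    fix \<omega> :: "nat \<Rightarrow> nat list"
    assume "(\<lambda>k. (\<Sum>i<k. ?Y (block (\<omega> i))) / k) \<longlonglongrightarrow> (\<Sum>w\<in>set_pmf q. pmf q w * ?Y w)"
    then have "\<forall>\<^sub>F k in sequentially. 0 < (\<Sum>i<k. ?Y (block (\<omega> i))) / k"
      using mean by (rule order_tendstoD)
    then obtain k0 where "\<And>k. k \<ge> k0 \<Longrightarrow> 0 < (\<Sum>i<k. ?Y (block (\<omega> i))) / k"
      unfolding eventually_sequentially by auto
    then have "\<omega> \<in> regular s k0" unfolding regular_def by (auto simp: zero_less_divide_iff less_imp_le)
    then show "\<omega> \<in> (\<Union>k0. regular s k0)" by auto
  qed
  then have one: "emeasure S (\<Union>k0. regular s k0) = 1"
    by (intro emeasure_eq_1_AE) auto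
  have "\<exists>k0. emeasure S (regular s k0) \<noteq> 0"
  proof (rule ccontr)
    assume "\<nexists>k0. emeasure S (regular s k0) \<noteq> 0"
    then have "emeasure S (\<Union>k0. regular s k0) = 0" by (intro emeasure_UN_eq_0) auto
    then show False using one by simp
  qed
  then show ?thesis using that by (auto simp: zero_less_iff_neq_zero)
qed

definition cylinder :: "nat \<Rightarrow> (nat \<Rightarrow> nat list) \<Rightarrow> (nat \<Rightarrow> nat list) set" where
  "cylinder k \<omega> = {\<omega>'. \<forall>i<k. block (\<omega>' i) = block (\<omega> i)}"

lemma cylinder_measurable [measurable]: "cylinder k \<omega> \<in> sets S"
proof -
  have "cylinder k \<omega> = itinerary (\<lambda>\<omega>. block (\<omega> 0)) shift k -` {itinerary (\<lambda>\<omega>. block (\<omega> 0)) shift k \<omega>} \<inter> space S"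
    by (auto simp: cylinder_def itinerary_eq_iff funpow_shift space_S)
  then show ?thesis
    using simple_functionD(2)[OF shift.simple_function_itinerary[OF simple_function_block]] by simp
qed

text \<open>The extra \<open>2 * ln 2\<close> per block in \<open>regular\<close> pays for
  concatenating the blocks, so the product of block probabilities is bounded through the continuant
  of the whole word.\<close>

lemma emeasure_cylinder_le:
  assumes "\<omega> \<in> regular s k0" "k0 \<le> k" "0 \<le> s"
  shows "emeasure S (cylinder k \<omega>) \<le> ennreal (exp (- s * cf_log (map (digit \<omega>) [0..<k * n])))"
proof -
  have p: "0 < pmf q (block v)" for v using block_in by (simp add: pmf_positive)
  have "s * cf_log (map (digit \<omega>) [0..<k * n]) \<le> s * (\<Sum>w\<leftarrow>map (\<lambda>i. block (\<omega> i)) [0..<k]. cf_log w + 2 * ln 2)"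
    unfolding map_digit using nz[OF block_in] by (intro mult_left_mono cf_log_concat assms(3)) auto
  also have "(\<Sum>w\<leftarrow>map (\<lambda>i. block (\<omega> i)) [0..<k]. cf_log w + 2 * ln 2) = (\<Sum>i<k. cf_log (block (\<omega> i)) + 2 * ln 2)"
    by (simp add: comp_def interv_sum_list_conv_sum_set_nat lessThan_atLeast0)
  finally have 1: "s * cf_log (map (digit \<omega>) [0..<k * n]) \<le> (\<Sum>i<k. s * (cf_log (block (\<omega> i)) + 2 * ln 2))"
    by (simp add: sum_distrib_left)
  have "0 \<le> (\<Sum>i<k. - ln (pmf q (block (\<omega> i))) - s * (cf_log (block (\<omega> i)) + 2 * ln 2))"
    using assms by (simp add: regular_def)
  then have 2: "(\<Sum>i<k. ln (pmf q (block (\<omega> i)))) \<le> - s * cf_log (map (digit \<omega>) [0..<k * n])"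
    using 1 by (simp add: sum_subtractf sum_negf)
  have "prob (cylinder k \<omega>) = (\<Prod>i<k. pmf q (block (\<omega> i)))"
    unfolding cylinder_def by (rule prob_block_cylinder) (rule block_in)
  also have "\<dots> = exp (\<Sum>i<k. ln (pmf q (block (\<omega> i))))"
    using p by (simp add: exp_sum)
  also have "\<dots> \<le> exp (- s * cf_log (map (digit \<omega>) [0..<k * n]))" using 2 by simp
  finally show ?thesis by (simp add: emeasure_eq_measure)
qed

lemma cf_log_digits_le: "cf_log (map (digit \<omega>) xs) \<le> 2 * real (length xs) * ln (real K + 1)"
  using cf_log_le[of "map (digit \<omega>) xs" K] digit_pos digit_le by (auto simp: image_iff)

text \<open>Frostman's condition on regular sequences. If \<open>J\<close> is the first position at
  which two of them with points in \<open>U\<close> disagree, then \<open>U\<close> is at least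
  comparable to the cylinder of length \<open>J\<close>, and all of them lie in the cylinder of the
  complete blocks before \<open>J\<close>.\<close>

lemma small_set_in_cylinder:
  assumes s: "0 < s"
  obtains c \<delta> where "0 < c" "0 < \<delta>" "\<delta> \<le> 1"
    "\<And>U. bounded U \<Longrightarrow> diameter U \<le> \<delta> \<Longrightarrow> \<exists>C\<in>sets S.
       regular s k0 \<inter> point 0 -` U \<subseteq> C \<and> emeasure S C \<le> ennreal (c * diameter U powr s)"
proof -
  \<comment> \<open>Cost of rounding \<open>J\<close> down to a block boundary: fewer than
    \<open>n\<close> digits, each at most \<open>K\<close>, and one concatenation.\<close>
  define R where "R = 2 * real n * ln (real K + 1) + 2 * ln 2"
  \<comment> \<open>The factor 4 and the cube come from \<open>cf_lim_separation\<close>.\<close>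
  define c0 where "c0 = 4 * exp R * (real K + 2) ^ 3"
  have c0: "0 < c0" unfolding c0_def by (intro mult_pos_pos zero_less_power) auto
  \<comment> \<open>So small that fewer than \<open>k0\<close> common blocks are impossible, because
    \<open>K\<close> bounds the continuants of such prefixes; the factor 2 makes the contradiction
    strict. The bound 1 serves the later comparison of exponents.\<close>
  define \<delta> where "\<delta> = min 1 (exp (- (2 * real (k0 * n) * ln (real K + 1))) / (2 * c0))"
  have nzd: "0 \<notin> set (map (digit \<omega>) xs)" for \<omega> xs using digit_pos by (auto simp: image_iff)
  show ?thesis
  proof (rule that[of "c0 powr s" \<delta>])
    show "0 < \<delta>" "\<delta> \<le> 1" using c0 by (auto simp: \<delta>_def)
    fix U :: "real set" assume U: "bounded U" "diameter U \<le> \<delta>"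
    define W where "W = regular s k0 \<inter> point 0 -` U"
    have diam: "0 \<le> diameter U" using U(1) by (rule diameter_ge_0)
    show "\<exists>C\<in>sets S. regular s k0 \<inter> point 0 -` U \<subseteq> C \<and> emeasure S C \<le> ennreal (c0 powr s * diameter U powr s)"
    proof (cases "\<exists>j. \<exists>\<omega>\<in>W. \<exists>\<omega>'\<in>W. digit \<omega> j \<noteq> digit \<omega>' j")
      case True
      define J where "J = (LEAST j. \<exists>\<omega>\<in>W. \<exists>\<omega>'\<in>W. digit \<omega> j \<noteq> digit \<omega>' j)"
      obtain \<omega> \<omega>' where w: "\<omega> \<in> W" "\<omega>' \<in> W" "digit \<omega> J \<noteq> digit \<omega>' J"
        using LeastI_ex[OF True] unfolding J_def by auto
      have agree: "digit v j = digit v' j" if "j < J" "v \<in> W" "v' \<in> W" for v v' j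
        using not_less_Least[of j "\<lambda>j. \<exists>\<omega>\<in>W. \<exists>\<omega>'\<in>W. digit \<omega> j \<noteq> digit \<omega>' j"] that unfolding J_def by blast
      define k where "k = J div n"
      have kJ: "k * n \<le> J" "J - k * n < n" unfolding k_def using n_pos by (auto simp: minus_div_mult_eq_mod)
      let ?u = "map (digit \<omega>) [0..<J]" and ?v = "map (digit \<omega>) [0..<k * n]"
      have "?u = ?v @ map (digit \<omega>) [k * n..<J]"
        using upt_add_eq_append[of 0 "k * n" "J - k * n"] kJ by simp
      then have "cf_log ?u \<le> cf_log ?v + cf_log (map (digit \<omega>) [k * n..<J]) + 2 * ln 2"
        using cf_log_append[OF nzd nzd] by simp
      also have "cf_log (map (digit \<omega>) [k * n..<J]) \<le> 2 * real (J - k * n) * ln (real K + 1)"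
        using cf_log_digits_le[of \<omega> "[k * n..<J]"] by simp
      also have "\<dots> \<le> 2 * real n * ln (real K + 1)"
        using kJ(2) by (intro mult_right_mono) auto
      finally have uv: "cf_log ?u \<le> cf_log ?v + R" by (simp add: R_def)
      have "exp (- cf_log ?u) / (real K + 2) ^ 3 \<le> 4 * \<bar>point 0 \<omega> - point 0 \<omega>'\<bar>"
        using cf_lim_separation[of "digit \<omega>" K "digit \<omega>'" J] digit_pos digit_le agree[OF _ w(1,2)] w(3)
        by (simp add: point_def)
      also have "\<bar>point 0 \<omega> - point 0 \<omega>'\<bar> \<le> diameter U"
        using diameter_bounded_bound[OF U(1), of "point 0 \<omega>" "point 0 \<omega>'"] w by (simp add: W_def dist_real_def)
      finally have "exp (- cf_log ?u) \<le> 4 * (real K + 2) ^ 3 * diameter U"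
        by (simp add: field_simps)
      moreover have "exp (- cf_log ?v) \<le> exp R * exp (- cf_log ?u)"
        using uv by (simp flip: exp_add)
      ultimately have dv: "exp (- cf_log ?v) \<le> c0 * diameter U"
      proof -
        have "exp (- cf_log ?v) \<le> exp R * exp (- cf_log ?u)" by fact
        also have "\<dots> \<le> exp R * (4 * (real K + 2) ^ 3 * diameter U)"
          using \<open>exp (- cf_log ?u) \<le> 4 * (real K + 2) ^ 3 * diameter U\<close> by (intro mult_left_mono) auto
        also have "\<dots> = c0 * diameter U" by (simp add: c0_def)
        finally show ?thesis .
      qed
      have "k0 \<le> k"
      proof (rule ccontr)
        assume "\<not> k0 \<le> k"
        then have "k * n \<le> k0 * n" by simp
        then have "2 * real (k * n) * ln (real K + 1) \<le> 2 * real (k0 * n) * ln (real K + 1)"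
          by (intro mult_right_mono mult_left_mono) (auto simp: of_nat_mono simp del: of_nat_mult)
        then have "cf_log ?v \<le> 2 * real (k0 * n) * ln (real K + 1)"
          using cf_log_digits_le[of \<omega> "[0..<k * n]"] by simp
        then have "exp (- (2 * real (k0 * n) * ln (real K + 1))) \<le> exp (- cf_log ?v)" by simp
        also have "\<dots> \<le> c0 * \<delta>" using dv U(2) c0 by (auto intro: order.trans mult_left_mono)
        also have "\<dots> \<le> c0 * (exp (- (2 * real (k0 * n) * ln (real K + 1))) / (2 * c0))"
          using c0 by (intro mult_left_mono) (auto simp: \<delta>_def)
        also have "\<dots> = exp (- (2 * real (k0 * n) * ln (real K + 1))) / 2" using c0 by simp
        finally show False by (simp add: not_le)
      qed
      show ?thesis
      proof (intro bexI conjI)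
        show "regular s k0 \<inter> point 0 -` U \<subseteq> cylinder k \<omega>"
          unfolding cylinder_def
        proof (intro subsetI CollectI allI impI)
          fix v i assume "v \<in> regular s k0 \<inter> point 0 -` U" and i: "i < k"
          then have v: "v \<in> W" by (simp add: W_def)
          show "block (v i) = block (\<omega> i)"
          proof (rule digit_eq_imp_block_eq)
            fix j assume "j < n"
            moreover have "Suc i * n \<le> k * n" using i by (intro mult_right_mono) auto
            ultimately have "i * n + j < J" using kJ(1) by simp
            then show "digit v (i * n + j) = digit \<omega> (i * n + j)" using agree v w(1) by blast
          qed
        qed
        have "emeasure S (cylinder k \<omega>) \<le> ennreal (exp (- s * cf_log ?v))"
          using w(1) \<open>k0 \<le> k\<close> s by (intro emeasure_cylinder_le[of \<omega> s k0]) (auto simp: W_def)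
        also have "exp (- s * cf_log ?v) = exp (- cf_log ?v) powr s" by (simp add: powr_def)
        also have "\<dots> \<le> (c0 * diameter U) powr s" using dv s by (intro powr_mono2) auto
        also have "\<dots> = c0 powr s * diameter U powr s" by (rule powr_mult)
        finally show "emeasure S (cylinder k \<omega>) \<le> ennreal (c0 powr s * diameter U powr s)"
          by (simp add: ennreal_leI)
      qed (rule cylinder_measurable)
    next
      case False
      show ?thesis
      proof (cases "W = {}")
        case True
        then show ?thesis unfolding W_def by (intro bexI[of _ "{}"]) auto
      next
        case False
        then obtain \<omega> where w: "\<omega> \<in> W" by auto
        \<comment> \<open>All sequences over \<open>U\<close> now share all digits. Their common
          cylinder lies in cylinders of arbitrarily many blocks, whose masses tend to 0.\<close>
        let ?C = "\<Inter>k. cylinder k \<omega>"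
        have sub: "W \<subseteq> ?C"
          unfolding cylinder_def using \<open>\<not> (\<exists>j. \<exists>\<omega>\<in>W. \<exists>\<omega>'\<in>W. digit \<omega> j \<noteq> digit \<omega>' j)\<close> w
          by (auto intro!: digit_eq_imp_block_eq)
        have le: "prob ?C \<le> exp (- (s * ln 2)) ^ k" if "k0 \<le> k" for k
        proof -
          have kn: "k + 1 \<le> (k + 1) * n" using mult_le_mono2[of 1 n "k + 1"] n_pos by (metis One_nat_def Suc_leI mult.right_neutral)
          have "emeasure S ?C \<le> emeasure S (cylinder (k + 1) \<omega>)" by (intro emeasure_mono) auto
          also have "\<dots> \<le> ennreal (exp (- s * cf_log (map (digit \<omega>) [0..<(k + 1) * n])))"
            using w that s by (intro emeasure_cylinder_le[of \<omega> s k0]) (auto simp: W_def)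
          finally have "prob ?C \<le> exp (- s * cf_log (map (digit \<omega>) [0..<(k + 1) * n]))"
            by (simp add: emeasure_eq_measure)
          also have "exp (- s * cf_log (map (digit \<omega>) [0..<(k + 1) * n])) \<le> exp (real k * - (s * ln 2))"
          proof -
            have "real k * ln 2 \<le> real ((k + 1) * n - 1) * ln 2"
              using kn by (intro mult_right_mono) (auto simp del: of_nat_diff)
            also have "\<dots> \<le> cf_log (map (digit \<omega>) [0..<(k + 1) * n])"
              using cf_log_growth[OF nzd, of \<omega> "[0..<(k + 1) * n]"] by simp
            finally have "s * (real k * ln 2) \<le> s * cf_log (map (digit \<omega>) [0..<(k + 1) * n])"
              using s by (intro mult_left_mono) auto
            then show ?thesis by (simp add: mult_ac)
          qed
          also have "\<dots> = exp (- (s * ln 2)) ^ k" by (rule exp_of_nat_mult)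
          finally show ?thesis .
        qed
        have "prob ?C \<le> 0"
        proof (rule LIMSEQ_le_const)
          show "(\<lambda>k. exp (- (s * ln 2)) ^ k) \<longlonglongrightarrow> 0"
            using s by (intro LIMSEQ_power_zero) simp
        qed (use le in blast)
        then have "prob ?C = 0" by (intro antisym measure_nonneg)
        then have "emeasure S ?C = 0" by (simp add: emeasure_eq_measure)
        moreover have "?C \<in> sets S" by (rule sets.countable_INT) auto
        ultimately show ?thesis using sub unfolding W_def by (intro bexI[of _ ?C]) auto
      qed
    qed
  qed (use c0 in auto)
qed

text \<open>For \<sigma> < s and diameters at most 1, \<open>diameter U powr s\<close> is at most
  \<open>diam_power \<sigma> U\<close>. Every such cover therefore has sum at least the mass of the
  regular sequences divided by \<open>c\<close>, so the \<sigma>-dimensional measure is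
  positive.\<close>

lemma hausdorff_dim_ge:
  assumes \<gamma>: "\<gamma> > 0" and mean: "(\<Sum>w\<in>set_pmf q. pmf q w * digit_sum \<gamma> w) = real n * \<alpha>"
    and s: "0 < s" "s * ((\<Sum>w\<in>set_pmf q. pmf q w * cf_log w) + 2 * ln 2) < pmf_entropy q"
  shows "ennreal s \<le> hausdorff_dim (cf_mean_set \<alpha> \<gamma>)"
  unfolding hausdorff_dim_def
proof (rule Inf_greatest, clarify)
  fix \<sigma> assume \<sigma>: "0 \<le> \<sigma>" "hausdorff_measure \<sigma> (cf_mean_set \<alpha> \<gamma>) = 0"
  obtain k0 where k0: "0 < emeasure S (regular s k0)" using ex_regular[OF s(2)] by blast
  obtain c \<delta> where c: "0 < c" "0 < \<delta>" "\<delta> \<le> 1"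
    "\<And>U. bounded U \<Longrightarrow> diameter U \<le> \<delta> \<Longrightarrow> \<exists>C\<in>sets S.
       regular s k0 \<inter> point 0 -` U \<subseteq> C \<and> emeasure S C \<le> ennreal (c * diameter U powr s)"
    using small_set_in_cylinder[OF s(1), of k0] by blast
  show "ennreal s \<le> ennreal \<sigma>"
  proof (rule ccontr)
    assume "\<not> ennreal s \<le> ennreal \<sigma>"
    then have lt: "\<sigma> < s" using ennreal_leI not_le by blast
    have "ennreal (prob (regular s k0) / c) \<le> hausdorff_premeasure \<sigma> \<delta> (cf_mean_set \<alpha> \<gamma>)"
      unfolding hausdorff_premeasure_def
    proof (rule INF_greatest, clarify)
      fix U :: "nat \<Rightarrow> real set"
      assume cov: "cf_mean_set \<alpha> \<gamma> \<subseteq> (\<Union>i. U i)" and U: "\<forall>i. bounded (U i) \<and> diameter (U i) \<le> \<delta>"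
      obtain C where C: "\<And>i. C i \<in> sets S" "\<And>i. regular s k0 \<inter> point 0 -` U i \<subseteq> C i"
        "\<And>i. emeasure S (C i) \<le> ennreal (c * diameter (U i) powr s)"
      proof -
        have "\<forall>i. \<exists>C. C \<in> sets S \<and> regular s k0 \<inter> point 0 -` U i \<subseteq> C \<and>
            emeasure S C \<le> ennreal (c * diameter (U i) powr s)"
          using c(4) U unfolding Bex_def by blast
        from choice[OF this] show ?thesis using that by blast
      qed
      define C' where "C' = (\<lambda>i. if U i = {} then {} else C i)"
      have dp: "emeasure S (C' i) \<le> ennreal c * ennreal (diam_power \<sigma> (U i))" for i
      proof (cases "U i = {}")
        case False
        have d: "0 \<le> diameter (U i)" "diameter (U i) \<le> 1"
          using U c(3) diameter_ge_0 by (auto intro: order.trans)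
        have "diameter (U i) powr s \<le> diam_power \<sigma> (U i)"
        proof (cases "\<sigma> = 0")
          case True
          then show ?thesis using False d s powr_le1[of s "diameter (U i)"] by (simp add: diam_power_def)
        next
          case False
          then show ?thesis using \<open>U i \<noteq> {}\<close> d lt by (auto simp: diam_power_def intro!: powr_mono')
        qed
        then have "ennreal (c * diameter (U i) powr s) \<le> ennreal (c * diam_power \<sigma> (U i))"
          using c(1) by (intro ennreal_leI mult_left_mono) auto
        then show ?thesis
          using C(3)[of i] c(1) False by (auto simp: C'_def ennreal_mult' intro: order.trans)
      qed (simp add: C'_def)
      have C'm: "C' i \<in> sets S" for i using C(1) by (simp add: C'_def)
      have "emeasure S (regular s k0) \<le> emeasure S (\<Union>i. C' i)"
      proof (rule emeasure_mono_AE)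
        show "AE \<omega> in S. \<omega> \<in> regular s k0 \<longrightarrow> \<omega> \<in> (\<Union>i. C' i)"
          using AE_point_cf_mean_set[OF \<gamma> mean]
        proof (rule AE_mp, intro AE_I2 impI)
          fix \<omega> assume "point 0 \<omega> \<in> cf_mean_set \<alpha> \<gamma>" "\<omega> \<in> regular s k0"
          then obtain i where "point 0 \<omega> \<in> U i" using cov by auto
          then have "\<omega> \<in> C' i" using C(2)[of i] \<open>\<omega> \<in> regular s k0\<close> by (auto simp: C'_def)
          then show "\<omega> \<in> (\<Union>i. C' i)" by auto
        qed
        show "(\<Union>i. C' i) \<in> sets S" using C'm by auto
      qed
      also have "\<dots> \<le> (\<Sum>i. emeasure S (C' i))"
        using C'm by (intro emeasure_subadditive_countably) auto
      also have "\<dots> \<le> (\<Sum>i. ennreal c * ennreal (diam_power \<sigma> (U i)))"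
        by (intro suminf_le dp) auto
      also have "\<dots> = ennreal c * (\<Sum>i. ennreal (diam_power \<sigma> (U i)))" by simp
      finally have *: "ennreal (prob (regular s k0)) \<le> ennreal c * (\<Sum>i. ennreal (diam_power \<sigma> (U i)))"
        by (simp add: emeasure_eq_measure)
      show "ennreal (prob (regular s k0) / c) \<le> (\<Sum>i. ennreal (diam_power \<sigma> (U i)))"
      proof (cases "\<Sum>i. ennreal (diam_power \<sigma> (U i))")
        case (real x)
        then show ?thesis using * c(1) by (simp add: divide_le_eq mult.commute flip: ennreal_mult)
      qed simp
    qed
    also have "\<dots> \<le> hausdorff_measure \<sigma> (cf_mean_set \<alpha> \<gamma>)"
      unfolding hausdorff_measure_def using c(2) by (intro SUP_upper) auto
    finally have "prob (regular s k0) / c \<le> 0" using \<sigma>(2) by (simp add: ennreal_eq_0_iff)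
    then show False using k0 c(1) by (simp add: emeasure_eq_measure divide_le_0_iff)
  qed
qed

end

section \<open>Finite distributions on words\<close>

text \<open>A finite set with real weights, some possibly 0, keeps every functional a finite sum and
  lets weights be mixed or normalised directly.\<close>

definition word_distribution :: "nat \<Rightarrow> nat list set \<Rightarrow> (nat list \<Rightarrow> real) \<Rightarrow> bool" where
  "word_distribution n W p \<longleftrightarrow> finite W \<and> (\<forall>w\<in>W. length w = n \<and> 0 \<notin> set w \<and> 0 \<le> p w) \<and> (\<Sum>w\<in>W. p w) = 1"

definition word_entropy :: "nat list set \<Rightarrow> (nat list \<Rightarrow> real) \<Rightarrow> real" where
  "word_entropy W p = (\<Sum>w\<in>W. - p w * ln (p w))"

text \<open>Concavity of -x ln x along the segments from \<open>x\<close> to 0 and to 1, where the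
  function vanishes.\<close>

lemma xlnx_mix:
  fixes x t :: real
  assumes "0 \<le> x" "x \<le> 1" "0 \<le> t" "t \<le> 1"
  shows "(1 - t) * (- x * ln x) \<le> - ((1 - t) * x) * ln ((1 - t) * x)"
    and "(1 - t) * (- x * ln x) \<le> - ((1 - t) * x + t) * ln ((1 - t) * x + t)"
proof -
  show "(1 - t) * (- x * ln x) \<le> - ((1 - t) * x) * ln ((1 - t) * x)"
  proof (cases "x = 0 \<or> t = 1")
    case False
    then have p: "0 < x" "0 < 1 - t" using assms by auto
    have "ln (1 - t) \<le> 0" using p assms by simp
    then have "(1 - t) * x * ln (1 - t) \<le> 0" using p by (intro mult_nonneg_nonpos) auto
    moreover have ln_eq: "ln ((1 - t) * x) = ln (1 - t) + ln x" using p by (simp add: ln_mult)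
    have "- ((1 - t) * x) * ln ((1 - t) * x) = (1 - t) * (- x * ln x) - (1 - t) * x * ln (1 - t)"
      unfolding ln_eq by (simp add: algebra_simps)
    ultimately show ?thesis by linarith
  qed auto
  define y where "y = (1 - t) * x + t"
  show "(1 - t) * (- x * ln x) \<le> - ((1 - t) * x + t) * ln ((1 - t) * x + t)"
  proof (cases "y = 0")
    case True
    have "0 \<le> (1 - t) * x" using assms by simp
    then have "t = 0" using True assms unfolding y_def by linarith
    then show ?thesis by simp
  next
    case False
    have "0 \<le> y" using assms unfolding y_def by simp
    then have y: "0 < y" using False by simp
    \<comment> \<open>The graph of -x ln x lies below its tangent at the mixed point
      \<open>y\<close>.\<close>
    have tangent: "- x * ln x \<le> - x * ln y + (y - x)"
    proof (cases "x = 0")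
      case False
      then have "ln (y / x) \<le> y / x - 1" using y assms by (intro ln_le_minus_one) auto
      then have "x * (ln y - ln x) \<le> x * (y / x - 1)" using y False assms by (intro mult_left_mono) (auto simp: ln_div)
      then show ?thesis using False by (simp add: algebra_simps)
    qed (use y in simp)
    have "(1 - t) * (- x * ln x) \<le> (1 - t) * (- x * ln y + (y - x))"
      using tangent assms by (intro mult_left_mono) auto
    also have "\<dots> = - y * ln y + t * (ln y + (1 - y))"
      unfolding y_def by (simp add: algebra_simps)
    also have "t * (ln y + (1 - y)) \<le> 0"
      using ln_le_minus_one[OF y] assms by (intro mult_nonneg_nonpos) auto
    finally show ?thesis by (simp add: y_def)
  qed
qed

text \<open>The witness is the mixture of \<open>p\<close> with the point mass at \<open>v\<close>,
  which may already belong to \<open>W\<close>: expectations are affine in it, and concavity is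
  applied word by word to the entropy.\<close>

lemma word_distribution_mix:
  assumes wd: "word_distribution n W p" and v: "length v = n" "0 \<notin> set v" and t: "0 \<le> t" "t \<le> 1"
  obtains W' p' where "word_distribution n W' p'"
    "\<And>f. (\<Sum>w\<in>W'. p' w * f w) = (1 - t) * (\<Sum>w\<in>W. p w * f w) + t * f v"
    "(1 - t) * word_entropy W p \<le> word_entropy W' p'"
proof -
  define W' where "W' = insert v W"
  \<comment> \<open>\<open>p\<close> is arbitrary outside \<open>W\<close>, so it is set to 0 there
    before \<open>v\<close> joins the support.\<close>
  define p0 where "p0 w = (if w \<in> W then p w else 0)" for w
  define p' where "p' w = (1 - t) * p0 w + (if w = v then t else 0)" for w
  have fin: "finite W" "finite W'" using wd by (auto simp: word_distribution_def W'_def)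
  have p0: "0 \<le> p0 w" for w using wd by (auto simp: p0_def word_distribution_def)
  have ext: "(\<Sum>w\<in>W'. p0 w * f w) = (\<Sum>w\<in>W. p w * f w)" for f
    using fin by (intro sum.mono_neutral_cong_right) (auto simp: W'_def p0_def)
  have sum: "(\<Sum>w\<in>W'. p' w * f w) = (1 - t) * (\<Sum>w\<in>W. p w * f w) + t * f v" for f
  proof -
    have "(\<Sum>w\<in>W'. p' w * f w) = (1 - t) * (\<Sum>w\<in>W'. p0 w * f w) + (\<Sum>w\<in>W'. if w = v then t * f v else 0)"
      unfolding p'_def sum_distrib_left sum.distrib[symmetric] by (intro sum.cong) (auto simp: algebra_simps)
    also have "(\<Sum>w\<in>W'. if w = v then t * f v else 0) = t * f v"
      using fin by (simp add: W'_def)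
    finally show ?thesis by (simp add: ext)
  qed
  have one: "(\<Sum>w\<in>W. p w) = 1" using wd by (simp add: word_distribution_def)
  have "word_distribution n W' p'"
    using wd v t p0 sum[of "\<lambda>_. 1"] one fin unfolding word_distribution_def
    by (auto simp: W'_def p'_def intro!: add_nonneg_nonneg mult_nonneg_nonneg)
  moreover have "(1 - t) * word_entropy W p \<le> word_entropy W' p'"
  proof -
    have le1: "p0 w \<le> 1" for w
    proof (cases "w \<in> W")
      case True
      then have "p w \<le> (\<Sum>w\<in>W. p w)"
        using wd fin by (intro member_le_sum) (auto simp: word_distribution_def)
      then show ?thesis using True one by (simp add: p0_def)
    qed (simp add: p0_def)
    have "word_entropy W p = (\<Sum>w\<in>W'. - p0 w * ln (p0 w))"
      unfolding word_entropy_def using fin by (intro sum.mono_neutral_cong_left) (auto simp: W'_def p0_def)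
    then have "(1 - t) * word_entropy W p = (\<Sum>w\<in>W'. (1 - t) * (- p0 w * ln (p0 w)))"
      by (simp only: sum_distrib_left)
    also have "\<dots> \<le> word_entropy W' p'"
      unfolding word_entropy_def p'_def
      using xlnx_mix(1)[OF p0 le1 t] xlnx_mix(2)[OF p0 le1 t] by (intro sum_mono) simp
    finally show ?thesis .
  qed
  ultimately show ?thesis using that sum by blast
qed

definition variational_dim :: "real \<Rightarrow> real \<Rightarrow> ennreal" where
  "variational_dim \<alpha> \<gamma> = Sup {measure_entropy \<mu> gauss_map / lyapunov_exponent \<mu> | \<mu>.
     \<mu> \<in> gauss_invariant_measures \<and> integrable \<mu> (phi \<gamma>) \<and> (\<integral>x. phi \<gamma> x \<partial>\<mu>) = - \<alpha> \<and>
     lyapunov_exponent \<mu> < \<infinity>}"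

lemma word_distribution_dim:
  assumes wd: "word_distribution n W p" and n: "0 < n" and \<gamma>: "\<gamma> > 0"
    and mean: "(\<Sum>w\<in>W. p w * digit_sum \<gamma> w) = real n * \<alpha>"
    and s: "0 < s" "s * ((\<Sum>w\<in>W. p w * cf_log w) + 2 * ln 2) < word_entropy W p"
  shows "ennreal s \<le> hausdorff_dim (cf_mean_set \<alpha> \<gamma>)" "ennreal s \<le> variational_dim \<alpha> \<gamma>"
proof -
  define p0 where "p0 w = (if w \<in> W then p w else 0)" for w
  define q where "q = embed_pmf p0"
  have fin: "finite W" and p: "\<And>w. w \<in> W \<Longrightarrow> 0 \<le> p w" and one: "(\<Sum>w\<in>W. p w) = 1"
    using wd by (auto simp: word_distribution_def)
  have p0: "0 \<le> p0 w" for w using p by (simp add: p0_def)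
  have "(\<integral>\<^sup>+ w. ennreal (p0 w) \<partial>count_space UNIV) = (\<Sum>w\<in>W. ennreal (p0 w))"
    using fin by (intro nn_integral_count_space'[of W]) (auto simp: p0_def)
  also have "\<dots> = ennreal (\<Sum>w\<in>W. p w)"
    using p by (subst sum_ennreal[symmetric]) (auto simp: p0_def intro!: sum.cong)
  finally have nn: "(\<integral>\<^sup>+ w. ennreal (p0 w) \<partial>count_space UNIV) = 1" by (simp add: one)
  have pmf: "pmf q w = p0 w" for w unfolding q_def by (rule pmf_embed_pmf[OF p0 nn])
  have set_q: "set_pmf q = {w \<in> W. p w \<noteq> 0}"
    by (auto simp: set_pmf_eq pmf p0_def)
  have sums: "(\<Sum>w\<in>set_pmf q. pmf q w * f w) = (\<Sum>w\<in>W. p w * f w)" for f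
    unfolding set_q pmf using fin by (intro sum.mono_neutral_cong_left) (auto simp: p0_def)
  have ent: "pmf_entropy q = word_entropy W p"
    unfolding pmf_entropy_def word_entropy_def set_q pmf
    using fin by (intro sum.mono_neutral_cong_left) (auto simp: p0_def)
  interpret block_process q n
    using wd n by unfold_locales (auto simp: set_q word_distribution_def)
  show "ennreal s \<le> hausdorff_dim (cf_mean_set \<alpha> \<gamma>)"
    using s mean by (intro hausdorff_dim_ge \<gamma>) (simp_all add: sums ent)
  have "ennreal s \<le> measure_entropy block_measure gauss_map / lyapunov_exponent block_measure"
    using s by (intro block_measure_dimension) (simp_all add: sums ent)
  also have "\<dots> \<le> variational_dim \<alpha> \<gamma>"
    unfolding variational_dim_def
  proof (rule Sup_upper, rule CollectI, intro exI[of _ block_measure] conjI refl)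
    show "lyapunov_exponent block_measure < \<infinity>"
      using s by (intro block_measure_dimension[of s]) (simp_all add: sums ent)
    show "integrable block_measure (phi \<gamma>)" by (rule block_measure_phi)
    show "(\<integral>x. phi \<gamma> x \<partial>block_measure) = - \<alpha>"
      using n by (simp add: block_measure_phi sums mean)
  qed (rule block_measure_invariant)
  finally show "ennreal s \<le> variational_dim \<alpha> \<gamma>" .
qed

text \<open>Mix with \<open>M\<close> if the mean is too small and with 1 if it is too large. In the
  first case the distance to \<open>M\<close> is at least 1, in the second the distance to 1 exceeds
  \<alpha> - 1, so a weight proportional to \<delta> suffices.\<close>

lemma adjust_mean:
  fixes \<alpha> \<beta> M \<delta> :: real
  assumes "1 < \<alpha>" "\<alpha> + 1 \<le> M" "\<bar>\<beta> - \<alpha>\<bar> \<le> \<delta>"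
  obtains t a where "0 \<le> t" "t \<le> \<delta> / min 1 (\<alpha> - 1)" "a = 1 \<or> a = M" "(1 - t) * \<beta> + t * a = \<alpha>"
proof -
  have \<delta>: "0 \<le> \<delta>" using assms(3) by linarith
  have m: "0 < min 1 (\<alpha> - 1)" using assms by simp
  have bound: "x / y \<le> \<delta> / min 1 (\<alpha> - 1)" if "x \<le> \<delta>" "min 1 (\<alpha> - 1) \<le> y" for x y
    using that \<delta> m by (intro frac_le) auto
  show ?thesis
  proof (cases "\<beta> \<le> \<alpha>")
    case True
    have d: "1 \<le> M - \<beta>" using True assms by linarith
    show ?thesis
    proof (rule that)
      show "0 \<le> (\<alpha> - \<beta>) / (M - \<beta>)" using True d by simp
      show "(\<alpha> - \<beta>) / (M - \<beta>) \<le> \<delta> / min 1 (\<alpha> - 1)" using assms d by (intro bound) auto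
      show "(1 - (\<alpha> - \<beta>) / (M - \<beta>)) * \<beta> + (\<alpha> - \<beta>) / (M - \<beta>) * M = \<alpha>"
      proof -
        have "(1 - (\<alpha> - \<beta>) / (M - \<beta>)) * \<beta> + (\<alpha> - \<beta>) / (M - \<beta>) * M = \<beta> + (\<alpha> - \<beta>) / (M - \<beta>) * (M - \<beta>)"
          by (simp only: algebra_simps)
        then show ?thesis using d by simp
      qed
    qed simp
  next
    case False
    have d: "\<alpha> - 1 \<le> \<beta> - 1" "0 < \<beta> - 1" using False assms by auto
    show ?thesis
    proof (rule that)
      show "0 \<le> (\<beta> - \<alpha>) / (\<beta> - 1)" using False d by simp
      show "(\<beta> - \<alpha>) / (\<beta> - 1) \<le> \<delta> / min 1 (\<alpha> - 1)" using assms d by (intro bound) auto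
      show "(1 - (\<beta> - \<alpha>) / (\<beta> - 1)) * \<beta> + (\<beta> - \<alpha>) / (\<beta> - 1) * 1 = \<alpha>"
      proof -
        have "(1 - (\<beta> - \<alpha>) / (\<beta> - 1)) * \<beta> + (\<beta> - \<alpha>) / (\<beta> - 1) * 1 = \<beta> - (\<beta> - \<alpha>) / (\<beta> - 1) * (\<beta> - 1)"
          by (simp only: algebra_simps)
        then show ?thesis using d by simp
      qed
    qed simp
  qed
qed

text \<open>\<open>C\<close> may depend on \<delta> but not on \<open>n\<close>: the mean of
  \<open>cf_log\<close> grows at least linearly with the length, so a constant error disappears for
  long words.\<close>

definition almost_optimal_words :: "real \<Rightarrow> real \<Rightarrow> real \<Rightarrow> bool" where
  "almost_optimal_words \<alpha> \<gamma> s \<longleftrightarrow> (\<forall>\<delta>>0. \<exists>C. \<forall>n0. \<exists>n\<ge>n0. \<exists>W p. word_distribution n W p \<and>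
      \<bar>(\<Sum>w\<in>W. p w * digit_sum \<gamma> w) / n - \<alpha>\<bar> \<le> \<delta> \<and>
      s * (\<Sum>w\<in>W. p w * cf_log w) - C \<le> word_entropy W p)"

text \<open>
  Words whose digit mean is only close to \<open>\<alpha>\<close> suffice: mixing with a constant word of small
  probability corrects the mean and hardly changes entropy and size.
\<close>

lemma dim_ge_of_word_distributions:
  assumes \<alpha>: "1 < \<alpha>" and \<gamma>: "0 < \<gamma>" and s: "0 < s'" "s' < s"
    and approx: "almost_optimal_words \<alpha> \<gamma> s"
  shows "ennreal s' \<le> hausdorff_dim (cf_mean_set \<alpha> \<gamma>)" "ennreal s' \<le> variational_dim \<alpha> \<gamma>"
proof -
  \<comment> \<open>A digit whose power exceeds \<alpha> by at least 1; its constant word raises a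
    mean that is too small.\<close>
  obtain A :: nat where A: "(\<alpha> + 1) powr (1 / \<gamma>) \<le> real A" using real_arch_simple by blast
  have "(\<alpha> + 1) = ((\<alpha> + 1) powr (1 / \<gamma>)) powr \<gamma>" using \<alpha> \<gamma> by (simp add: powr_powr)
  also have "\<dots> \<le> real A powr \<gamma>" using A \<gamma> by (intro powr_mono2) auto
  finally have A\<gamma>: "\<alpha> + 1 \<le> real A powr \<gamma>" .
  have A1: "1 \<le> A" using A\<gamma> \<alpha> by (cases A) auto
  define L where "L = ln (real A + 1)"
  have L: "0 < L" using A1 by (simp add: L_def)
  \<comment> \<open>The bound 1/2 keeps \<open>1 - t\<close> at least 1/2. The other bound makes the
    correcting word, of weight at most \<tau> and \<open>cf_log\<close> at most
    \<open>2 * n * L\<close>, cost at most one eighth of \<open>(s - s') * ln 2 * n\<close>.\<close>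
  define \<tau> where "\<tau> = min (1 / 2) ((s - s') * ln 2 / (16 * s' * L))"
  have \<tau>: "0 < \<tau>" "\<tau> \<le> 1 / 2" using s L by (auto simp: \<tau>_def)
  have \<tau>L: "2 * s' * \<tau> * L \<le> (s - s') * ln 2 / 8"
  proof -
    have "2 * s' * L * \<tau> \<le> 2 * s' * L * ((s - s') * ln 2 / (16 * s' * L))"
      using s L by (intro mult_left_mono) (auto simp: \<tau>_def)
    also have "\<dots> = (s - s') * ln 2 / 8" using s L by (simp add: field_simps)
    finally show ?thesis by (simp add: mult_ac)
  qed
  \<comment> \<open>Cancels the denominator in \<open>adjust_mean\<close>, so that \<open>t\<close>
    is at most \<tau>.\<close>
  define \<delta> where "\<delta> = \<tau> * min 1 (\<alpha> - 1)"
  have "0 < \<delta>" using \<tau> \<alpha> by (simp add: \<delta>_def)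
  then obtain C where C: "\<And>n0. \<exists>n\<ge>n0. \<exists>W p. word_distribution n W p \<and>
      \<bar>(\<Sum>w\<in>W. p w * digit_sum \<gamma> w) / n - \<alpha>\<bar> \<le> \<delta> \<and>
      s * (\<Sum>w\<in>W. p w * cf_log w) - C \<le> word_entropy W p"
    using approx unfolding almost_optimal_words_def by blast
  \<comment> \<open>From this length on, \<open>C\<close> and the distortion term together stay
    below one eighth of \<open>(s - s') * ln 2 * n\<close>.\<close>
  obtain n1 :: nat where n1: "8 * (\<bar>C\<bar> + 2 * s' * ln 2) / ((s - s') * ln 2) < real n1"
    using reals_Archimedean2 by blast
  obtain n W p where n: "max 2 n1 \<le> n" and wd: "word_distribution n W p"
    and mean: "\<bar>(\<Sum>w\<in>W. p w * digit_sum \<gamma> w) / n - \<alpha>\<bar> \<le> \<delta>"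
    and ent: "s * (\<Sum>w\<in>W. p w * cf_log w) - C \<le> word_entropy W p"
    using C by blast
  obtain t a where t: "0 \<le> t" "t \<le> \<delta> / min 1 (\<alpha> - 1)" and a: "a = 1 \<or> a = real A powr \<gamma>"
    and ta: "(1 - t) * ((\<Sum>w\<in>W. p w * digit_sum \<gamma> w) / n) + t * a = \<alpha>"
    using adjust_mean[OF \<alpha> A\<gamma> mean] by blast
  have t\<tau>: "t \<le> \<tau>" using t(2) \<alpha> by (simp add: \<delta>_def)
  obtain b where b: "1 \<le> b" "b \<le> A" "real b powr \<gamma> = a"   proof (cases "a = 1")
    case True
    then show ?thesis using that[of 1] A1 by simp
  next
    case False
    then show ?thesis using that[of A] A1 a by simp
  qed
  define v where "v = replicate n b"
  have v: "length v = n" "0 \<notin> set v" using b by (auto simp: v_def)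
  have dv: "digit_sum \<gamma> v = n * a" by (simp add: v_def digit_sum_def sum_list_replicate b)
  have lv: "cf_log v \<le> 2 * n * L"
  proof -
    have "w \<le> A" if "w \<in> set v" for w using that b by (auto simp: v_def)
    then show ?thesis using cf_log_le[OF v(2), of A] v(1) by (simp add: L_def)
  qed
  obtain W' p' where W': "word_distribution n W' p'"
    "\<And>f. (\<Sum>w\<in>W'. p' w * f w) = (1 - t) * (\<Sum>w\<in>W. p w * f w) + t * f v"
    "(1 - t) * word_entropy W p \<le> word_entropy W' p'"
  proof -
    have "t \<le> 1" using t\<tau> \<tau> by linarith
    then show ?thesis using word_distribution_mix[OF wd v t(1)] that by blast
  qed
  have n0: "0 < n" using n by auto
  define len where "len = (\<Sum>w\<in>W. p w * cf_log w)"
  have mean': "(\<Sum>w\<in>W'. p' w * digit_sum \<gamma> w) = real n * \<alpha>"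
  proof -
    have "n * ((1 - t) * (D / n) + t * a) = (1 - t) * D + t * (n * a)" for D
      using n0 by (simp add: distrib_left mult.left_commute)
    then show ?thesis unfolding W'(2) dv ta[symmetric] by simp
  qed
  have len_ge: "real (n - 1) * ln 2 \<le> len"
  proof -
    have "(\<Sum>w\<in>W. p w * (real (n - 1) * ln 2)) \<le> len"
      unfolding len_def using wd cf_log_growth
      by (intro sum_mono mult_left_mono) (auto simp: word_distribution_def)
    then show ?thesis using wd by (simp add: word_distribution_def flip: sum_distrib_right)
  qed
  have "s' * ((\<Sum>w\<in>W'. p' w * cf_log w) + 2 * ln 2) < word_entropy W' p'"
  proof -
    define X where "X = (s - s') * ln 2"
    have X: "0 < X" using s by (simp add: X_def)
    have "8 * (\<bar>C\<bar> + 2 * s' * ln 2) < X * n1"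
      using n1 X unfolding X_def[symmetric] by (simp add: divide_less_eq mult.commute)
    also have "X * n1 \<le> X * n" using n X by simp
    finally have big: "\<bar>C\<bar> + 2 * s' * ln 2 < X * n / 8" by simp
    have "(1 - t) * C \<le> \<bar>C\<bar>"
    proof -
      have "(1 - t) * C \<le> (1 - t) * \<bar>C\<bar>" using t\<tau> \<tau> by (intro mult_left_mono) auto
      also have "\<dots> \<le> 1 * \<bar>C\<bar>" using t by (intro mult_right_mono) auto
      finally show ?thesis by simp
    qed
    moreover have "s' * (t * cf_log v) \<le> X * n / 8"
    proof -
      have "t * cf_log v \<le> \<tau> * (2 * n * L)"
        using t\<tau> t lv cf_log_nonneg[OF v(2)] \<tau> by (intro mult_mono) auto
      then have "s' * (t * cf_log v) \<le> s' * (\<tau> * (2 * n * L))" using s by (intro mult_left_mono) auto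
      also have "\<dots> = n * (2 * s' * \<tau> * L)" by simp
      also have "\<dots> \<le> n * (X / 8)" using \<tau>L by (intro mult_left_mono) (auto simp: X_def)
      finally show ?thesis by (simp add: mult_ac)
    qed
    \<comment> \<open>The gain from lowering \<open>s\<close> to \<open>s'\<close> is at least
      \<open>X * n / 2 - X / 2\<close>, hence at least \<open>X * n / 4\<close> since
      \<open>n\<close> is at least 2; the two losses are at most \<open>X * n / 8\<close> each, one
      of them strictly less.\<close>
    moreover have "3 * X * n / 8 - X / 2 + 0 \<le> (1 - t) * ((s - s') * len) - X * n / 8"
    proof -
      have "1 / 2 * ((s - s') * (real (n - 1) * ln 2)) \<le> (1 - t) * ((s - s') * len)"
        using t\<tau> \<tau> s len_ge by (intro mult_mono mult_left_mono) auto
      moreover have "(s - s') * (real (n - 1) * ln 2) = X * real n - X"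
      proof -
        have "real (n - 1) = real n - 1" using n0 by (simp add: of_nat_diff)
        then show ?thesis by (simp only: X_def) (simp only: algebra_simps)
      qed
      ultimately show ?thesis by linarith
    qed
    moreover have "X * 2 \<le> X * n" using n X by (intro mult_left_mono) auto
    moreover have "(1 - t) * (s * len - C) \<le> word_entropy W' p'"
      using W'(3) mult_left_mono[OF ent, of "1 - t"] t\<tau> \<tau> unfolding len_def by linarith
    then have "(1 - t) * ((s - s') * len) + s' * ((1 - t) * len) - (1 - t) * C \<le> word_entropy W' p'"
      by (simp add: algebra_simps)
    ultimately have "s' * ((1 - t) * len) + s' * (t * cf_log v) + s' * (2 * ln 2) < word_entropy W' p'"
      using big by linarith
    then show ?thesis unfolding W'(2) len_def by (simp add: algebra_simps)
  qed
  then show "ennreal s' \<le> hausdorff_dim (cf_mean_set \<alpha> \<gamma>)" "ennreal s' \<le> variational_dim \<alpha> \<gamma>"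
    using word_distribution_dim[OF W'(1) n0 \<gamma> mean' s(1)] by auto
qed

section \<open>Word distributions of an invariant measure\<close>

text \<open>Truncation leaves finitely many digit values, as simple functions require, and lowers
  continuants, the favourable direction for a bound on the Lyapunov side.\<close>

definition trunc_digit :: "nat \<Rightarrow> real \<Rightarrow> nat" where
  "trunc_digit M x = min (nat \<lfloor>1 / x\<rfloor>) M"

definition trunc_word :: "nat \<Rightarrow> nat \<Rightarrow> real \<Rightarrow> nat list" where
  "trunc_word M = itinerary (trunc_digit M) gauss_map"

lemma trunc_word_eq: "trunc_word M n x = map (\<lambda>a. min a M) (cf_word x n)"
  by (simp add: trunc_word_def itinerary_def cf_word_def trunc_digit_def)

lemma trunc_word_nonzero: "x \<in> cf_points \<Longrightarrow> 1 \<le> M \<Longrightarrow> 0 \<notin> set (trunc_word M n x)"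
  using cf_word_nonzero[of x n] by (auto simp: trunc_word_eq min_def split: if_splits)

lemma cf_log_trunc_word_le:
  assumes "x \<in> cf_points" "1 \<le> M"
  shows "cf_log (trunc_word M n x) \<le> cf_log (cf_word x n)"
proof -
  have "cf_den (trunc_word M n x) 0 \<le> cf_den (cf_word x n) 0"
    using trunc_word_nonzero[OF assms] by (intro cf_den_mono) (auto simp: trunc_word_eq list_all2_conv_all_nth)
  moreover have "0 < cf_den (trunc_word M n x) 0"
    using trunc_word_nonzero[OF assms] by (intro cf_den_pos) auto
  ultimately show ?thesis by (simp add: cf_log_def)
qed

locale gauss_invariant =
  fixes \<mu> :: "real measure"
  assumes invariant: "\<mu> \<in> gauss_invariant_measures"

sublocale gauss_invariant \<subseteq> measure_preserving \<mu> gauss_map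
  by (rule gauss_invariant_measures_preserving[OF invariant])

context gauss_invariant
begin

lemma sets_mu [measurable_cong, simp]: "sets \<mu> = sets borel"
  using invariant by (simp add: gauss_invariant_measures_def)

lemma space_mu [simp]: "space \<mu> = UNIV"
  using sets_eq_imp_space_eq[OF sets_mu] by simp

lemma measurable_mu: "f \<in> \<mu> \<rightarrow>\<^sub>M N \<longleftrightarrow> f \<in> borel \<rightarrow>\<^sub>M N"
  using measurable_cong_sets[OF sets_mu refl, of N] by simp

lemma trunc_digit_simple: "simple_function \<mu> (trunc_digit M)"
  unfolding simple_function_eq_measurable
proof
  have "trunc_digit M ` space \<mu> \<subseteq> {..M}" by (auto simp: trunc_digit_def)
  then show "finite (trunc_digit M ` space \<mu>)" by (rule finite_subset) simp
  show "trunc_digit M \<in> \<mu> \<rightarrow>\<^sub>M count_space UNIV" unfolding trunc_digit_def[abs_def] measurable_mu by measurable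
qed

lemma trunc_word_simple: "simple_function \<mu> (trunc_word M n)"
  unfolding trunc_word_def by (rule simple_function_itinerary[OF trunc_digit_simple])

lemma AE_points: "AE x in \<mu>. x \<in> cf_points"
  by (rule AE_cf_points[OF invariant])

lemma word_distribution_trunc_word:
  assumes M: "1 \<le> M"
  obtains W p where "word_distribution n W p"
    "\<And>f. (\<Sum>w\<in>W. p w * f w) = (\<integral>x. f (trunc_word M n x) \<partial>\<mu>)"
    "word_entropy W p = rv_entropy \<mu> (trunc_word M n)"
proof -
  define V where "V = trunc_word M n"
  have V: "simple_function \<mu> V" unfolding V_def by (rule trunc_word_simple)
  define p where "p w = prob (V -` {w} \<inter> space \<mu>)" for w
  \<comment> \<open>Words with a digit 0 come only from points outside \<open>cf_points\<close>, a
    null set.\<close>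
  define W where "W = {w \<in> V ` space \<mu>. 0 \<notin> set w}"
  have fin: "finite (V ` space \<mu>)" by (rule simple_functionD(1)[OF V])
  have null: "p w = 0" if "w \<in> V ` space \<mu> - W" for w
  proof -
    have "0 \<in> set w" using that by (auto simp: W_def)
    have "AE x in \<mu>. x \<notin> V -` {w} \<inter> space \<mu>"
      using AE_points
    proof eventually_elim
      case (elim x)
      then show ?case using trunc_word_nonzero[OF elim M, of n] \<open>0 \<in> set w\<close> by (auto simp: V_def)
    qed
    then show ?thesis
      unfolding p_def using simple_functionD(2)[OF V] prob_eq_0 by blast
  qed
  have sum: "(\<Sum>w\<in>W. p w * f w) = (\<integral>x. f (V x) \<partial>\<mu>)" for f
    unfolding expectation_simple(2)[OF V] p_def[symmetric]
    using null fin by (intro sum.mono_neutral_left) (auto simp: W_def)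
  have ent: "word_entropy W p = rv_entropy \<mu> V"
    unfolding rv_entropy_def word_entropy_def p_def[symmetric]
    using null fin by (intro sum.mono_neutral_left) (auto simp: W_def)
  have "word_distribution n W p"
    unfolding word_distribution_def
  proof (intro conjI ballI)
    show "(\<Sum>w\<in>W. p w) = 1" using sum[of "\<lambda>_. 1"] prob_space by simp
  qed (use fin in \<open>auto simp: W_def V_def trunc_word_eq p_def\<close>)
  then show ?thesis using that sum ent by (simp add: V_def)
qed

lemma ex_compact_approx:
  assumes B: "B \<in> sets borel" and e: "0 < e"
  shows "\<exists>K. compact K \<and> K \<subseteq> B \<and> prob (B - K) < e"
proof (cases "prob B < e")
  case True
  then show ?thesis by (intro exI[of _ "{}"]) auto
next
  case False
  have "ennreal (prob B - e) < emeasure \<mu> B"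
    using False e by (simp add: emeasure_eq_measure ennreal_less_iff)
  also have "emeasure \<mu> B = (SUP K \<in> {K. K \<subseteq> B \<and> compact K}. emeasure \<mu> K)"
    using B by (intro inner_regular) auto
  finally obtain K where K: "K \<subseteq> B" "compact K" "ennreal (prob B - e) < emeasure \<mu> K"
    unfolding less_SUP_iff by auto
  have Ks: "K \<in> sets \<mu>" using K(2) by (simp add: borel_compact)
  have "prob B - e < prob K"
    using K(3) False by (simp add: emeasure_eq_measure ennreal_less_iff)
  moreover have "prob (B - K) = prob B - prob K"
    using B Ks K(1) by (intro finite_measure_Diff) auto
  ultimately show ?thesis using K by (intro exI[of _ K]) auto
qed

text \<open>The level sets of \<open>X\<close> contain compact sets \<open>K y\<close> of almost
  full mass at positive mutual distance. Once cylinders are shorter than this distance, each meets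
  at most one \<open>K y\<close>, so the first \<open>m\<close> digits tell \<open>X\<close>; a
  large \<open>M\<close> makes truncation invisible with high probability.\<close>

lemma approximate_by_word:
  fixes X :: "real \<Rightarrow> 'b"
  assumes X: "simple_function \<mu> X" and e: "0 < e"
  obtains m M f where "M0 \<le> M" "\<And>w. f w \<in> range X" "prob {x \<in> space \<mu>. X x \<noteq> f (trunc_word M m x)} < e"
proof -
  define L where "L = range X"
  have L: "finite L" "L \<noteq> {}" using simple_functionD(1)[OF X] by (auto simp: L_def)
  \<comment> \<open>Half of \<open>e\<close> is shared among the level sets; the other half is kept
    for the truncation.\<close>
  define e' where "e' = e / (2 * card L)"
  have e': "0 < e'" using e L by (simp add: e'_def card_gt_0_iff)
  have Xs: "X -` {y} \<in> sets borel" for y using simple_functionD(2)[OF X, of "{y}"] by simp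
  have "\<forall>y. \<exists>K. compact K \<and> K \<subseteq> X -` {y} \<and> prob (X -` {y} - K) < e'"
    using ex_compact_approx[OF Xs e'] by blast
  then obtain K where K: "\<And>y. compact (K y)" "\<And>y. K y \<subseteq> X -` {y}" "\<And>y. prob (X -` {y} - K y) < e'"
    by metis
  have "\<forall>\<^sub>F d in at_right 0. \<forall>y\<in>L. \<forall>y'\<in>L. y \<noteq> y' \<longrightarrow> (\<forall>a\<in>K y. \<forall>b\<in>K y'. d \<le> dist a b)"
  proof (intro eventually_ball_finite L(1) ballI)
    fix y y'
    show "\<forall>\<^sub>F d in at_right 0. y \<noteq> y' \<longrightarrow> (\<forall>a\<in>K y. \<forall>b\<in>K y'. d \<le> dist a b)"
    proof (cases "y = y'")
      case False
      have "K y \<inter> K y' = {}" using K(2)[of y] K(2)[of y'] False by auto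
      then obtain d where d: "0 < d" "\<forall>a\<in>K y. \<forall>b\<in>K y'. d \<le> dist a b"
        using separate_compact_closed[OF K(1)[of y] compact_imp_closed[OF K(1)[of y']]] by auto
      show ?thesis
        unfolding eventually_at_right_field
      proof (intro exI[of _ d] conjI allI impI ballI d(1))
        fix c a b assume "c < d" "a \<in> K y" "b \<in> K y'"
        then show "c \<le> dist a b" using d(2) by (meson less_imp_le order.trans)
      qed
    qed simp
  qed
  then have "\<exists>d::real. 0 < d \<and> (\<forall>y\<in>L. \<forall>y'\<in>L. y \<noteq> y' \<longrightarrow> (\<forall>a\<in>K y. \<forall>b\<in>K y'. d \<le> dist a b))"
    unfolding eventually_at_right_field by (metis dense)
  then obtain d :: real where d: "0 < d"
    "\<And>y y' a b. y \<in> L \<Longrightarrow> y' \<in> L \<Longrightarrow> y \<noteq> y' \<Longrightarrow> a \<in> K y \<Longrightarrow> b \<in> K y' \<Longrightarrow> d \<le> dist a b" by blast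
  obtain k where k: "(1/2::real) ^ k < d" using real_arch_pow_inv[of d "1/2"] d(1) by auto
  \<comment> \<open>One digit more than \<open>k\<close>, because the growth bound for continuants
    loses one.\<close>
  define m where "m = Suc k"
  have close: "dist z z' < d" if "z \<in> cf_points" "z' \<in> cf_points" "cf_word z m = cf_word z' m" for z z'
  proof -
    let ?w = "cf_word z m" and ?t = "(gauss_map ^^ m) z" and ?t' = "(gauss_map ^^ m) z'"
    have t: "0 < ?t" "?t < 1" "0 < ?t'" "?t' < 1"
      using cf_pointsD funpow_gauss_map_cf_points that by blast+
    have "\<bar>cf_fold ?w ?t - cf_fold ?w ?t'\<bar> \<le> \<bar>?t - ?t'\<bar> * exp (- cf_log ?w)"
      using t that by (intro cf_fold_diff_le cf_word_nonzero) auto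
    also have "\<dots> \<le> 1 * exp (- (real k * ln 2))"
      using t cf_log_growth[OF cf_word_nonzero[OF that(1)], of m] by (intro mult_mono) (auto simp: m_def)
    also have "exp (- (real k * ln 2)) = (1/2::real) ^ k"
      by (simp add: exp_minus exp_of_nat_mult power_one_over inverse_eq_divide)
    finally show ?thesis
      using k cf_fold_cf_word[OF that(1), of m] cf_fold_cf_word[OF that(2), of m] that(3)
      by (simp add: dist_real_def)
  qed
  \<comment> \<open>By the choice of \<open>m\<close> at most one \<open>y\<close> is related to a
    given word; words related to none receive the default \<open>y0\<close>.\<close>
  define R where "R w y \<longleftrightarrow> y \<in> L \<and> (\<exists>z\<in>K y \<inter> cf_points. cf_word z m = w)" for w y
  obtain y0 where y0: "y0 \<in> L" using L by auto
  define f where "f w = (if \<exists>y. R w y then SOME y. R w y else y0)" for w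
  have fL: "f w \<in> L" for w
  proof (cases "\<exists>y. R w y")
    case True
    then have "R w (f w)" using someI_ex[OF True] by (simp add: f_def)
    then show ?thesis by (simp add: R_def)
  next
    case False
    then show ?thesis using y0 by (simp add: f_def)
  qed
  have f: "f (cf_word x m) = X x" if "x \<in> K (X x)" "x \<in> cf_points" for x
  proof -
    have R: "R (cf_word x m) (X x)" unfolding R_def using that by (auto simp: L_def)
    moreover have "y = X x" if Ry: "R (cf_word x m) y" for y
    proof (rule ccontr)
      assume "y \<noteq> X x"
      obtain z where z: "z \<in> K y" "z \<in> cf_points" "cf_word z m = cf_word x m" "y \<in> L"
        using Ry by (auto simp: R_def)
      have "dist z x < d" using close z \<open>x \<in> cf_points\<close> by blast
      moreover have "d \<le> dist z x"
        using d(2)[of y "X x" z x] z \<open>y \<noteq> X x\<close> \<open>x \<in> K (X x)\<close> by (auto simp: L_def)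
      ultimately show False by simp
    qed
    ultimately show ?thesis
      unfolding f_def using someI[of "R (cf_word x m)" "X x"] by metis
  qed
  \<comment> \<open>Where truncation alters one of the first \<open>m\<close> digits. These sets
    decrease to the empty set, since finitely many digits of one point are bounded.\<close>
  define E where "E M = (\<Union>i<m. {x. M < nat \<lfloor>1 / (gauss_map ^^ i) x\<rfloor>})" for M
  have Es: "E M \<in> sets \<mu>" for M
  proof -
    have "{x \<in> space \<mu>. M < nat \<lfloor>1 / (gauss_map ^^ i) x\<rfloor>} \<in> sets \<mu>" for i
    proof -
      have [measurable]: "gauss_map ^^ i \<in> borel_measurable borel"
        using funpow_measurable[of i] by (simp cong: measurable_cong_sets)
      have "{x \<in> space borel. M < nat \<lfloor>1 / (gauss_map ^^ i) x\<rfloor>} \<in> sets borel" by measurable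
      then show ?thesis by simp
    qed
    then show ?thesis unfolding E_def by auto
  qed
  have "(\<lambda>M. prob (E M)) \<longlonglongrightarrow> prob (\<Inter>M. E M)"
    using Es by (intro finite_Lim_measure_decseq) (auto simp: decseq_def E_def)
  also have "(\<Inter>M. E M) = {}"
  proof (intro equals0I)
    fix x assume "x \<in> (\<Inter>M. E M)"
    then have "x \<in> E (Max ((\<lambda>i. nat \<lfloor>1 / (gauss_map ^^ i) x\<rfloor>) ` {..<m}))" by blast
    then obtain i where "i < m" "Max ((\<lambda>i. nat \<lfloor>1 / (gauss_map ^^ i) x\<rfloor>) ` {..<m}) < nat \<lfloor>1 / (gauss_map ^^ i) x\<rfloor>"
      by (auto simp: E_def)
    then show False using Max_ge[of "(\<lambda>i. nat \<lfloor>1 / (gauss_map ^^ i) x\<rfloor>) ` {..<m}"] by (auto simp: not_le[symmetric])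
  qed
  finally have "(\<lambda>M. prob (E M)) \<longlonglongrightarrow> 0" by simp
  then have "\<forall>\<^sub>F M in sequentially. prob (E M) < e / 2" using e by (intro order_tendstoD) auto
  then have "\<forall>\<^sub>F M in sequentially. prob (E M) < e / 2 \<and> M0 \<le> M"
    using eventually_ge_at_top by (intro eventually_conj) auto
  then obtain M where M: "prob (E M) < e / 2" "M0 \<le> M"
    unfolding eventually_sequentially by blast
  have trunc: "trunc_word M m x = cf_word x m" if "x \<notin> E M" for x
    unfolding trunc_word_eq using that by (auto simp: E_def cf_word_def not_less intro!: map_idI min_absorb1)
  have Ds: "X -` {y} - K y \<in> sets \<mu>" for y
    using Xs[of y] borel_compact[OF K(1)[of y]] by (simp add: sets.Diff)
  have Us: "(\<Union>y\<in>L. X -` {y} - K y) \<in> sets \<mu>" using Ds L(1) by (intro sets.finite_UN) auto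
  have "prob {x \<in> space \<mu>. X x \<noteq> f (trunc_word M m x)} \<le> prob ((\<Union>y\<in>L. X -` {y} - K y) \<union> E M)"
  proof (rule finite_measure_mono_AE)
    show "AE x in \<mu>. x \<in> {x \<in> space \<mu>. X x \<noteq> f (trunc_word M m x)} \<longrightarrow> x \<in> (\<Union>y\<in>L. X -` {y} - K y) \<union> E M"
      using AE_points
    proof eventually_elim
      case (elim x)
      then show ?case using f[of x] trunc[of x] by (auto simp: L_def)
    qed
    show "(\<Union>y\<in>L. X -` {y} - K y) \<union> E M \<in> sets \<mu>"
      using Us Es by (rule sets.Un)
  qed
  also have "\<dots> \<le> prob (\<Union>y\<in>L. X -` {y} - K y) + prob (E M)"
    using Us Es by (rule measure_Un_le)
  also have "prob (\<Union>y\<in>L. X -` {y} - K y) \<le> (\<Sum>y\<in>L. prob (X -` {y} - K y))"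
    using L(1) Ds by (intro finite_measure_subadditive_finite) auto
  also have "\<dots> \<le> (\<Sum>y\<in>L. e')" using K(3) by (intro sum_mono less_imp_le)
  also have "\<dots> = e / 2" using L by (simp add: e'_def card_gt_0_iff)
  finally have "prob {x \<in> space \<mu>. X x \<noteq> f (trunc_word M m x)} < e" using M(1) by linarith
  then show ?thesis using that[of M f m] fL M(2) by (auto simp: L_def)
qed

text \<open>All codes take values in the range of \<open>X\<close>, the fixed finite set that
  continuity of the conditional entropy requires.\<close>

lemma conditional_entropy_small:
  fixes X :: "real \<Rightarrow> 'b"
  assumes X: "simple_function \<mu> X" and e: "0 < e"
  obtains m M f where "M0 \<le> M"
    "rv_entropy \<mu> (\<lambda>x. (X x, f (trunc_word M m x))) - rv_entropy \<mu> (\<lambda>x. f (trunc_word M m x) :: 'b) < e"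
proof -
  have "\<forall>k. \<exists>m M f. M0 \<le> M \<and> (\<forall>w. f w \<in> range X) \<and>
      prob {x \<in> space \<mu>. X x \<noteq> f (trunc_word M m x)} < 1 / Suc k"
  proof
    fix k :: nat
    have "0 < 1 / real (Suc k)" by simp
    then obtain M f m where "M0 \<le> M" "\<And>w. f w \<in> range X"
      "prob {x \<in> space \<mu>. X x \<noteq> f (trunc_word M m x)} < 1 / real (Suc k)"
      by (rule approximate_by_word[OF X, where ?M0.0 = M0]) blast
    then show "\<exists>m M f. M0 \<le> M \<and> (\<forall>w. f w \<in> range X) \<and>
      prob {x \<in> space \<mu>. X x \<noteq> f (trunc_word M m x)} < 1 / Suc k" by blast
  qed
  from choice[OF this] obtain m where "\<forall>k. \<exists>M f. M0 \<le> M \<and> (\<forall>w. f w \<in> range X) \<and>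
      prob {x \<in> space \<mu>. X x \<noteq> f (trunc_word M (m k) x)} < 1 / Suc k" ..
  from choice[OF this] obtain M where "\<forall>k. \<exists>f. M0 \<le> M k \<and> (\<forall>w. f w \<in> range X) \<and>
      prob {x \<in> space \<mu>. X x \<noteq> f (trunc_word (M k) (m k) x)} < 1 / Suc k" ..
  from choice[OF this] obtain f where *: "\<forall>k. M0 \<le> M k \<and> (\<forall>w. f k w \<in> range X) \<and>
      prob {x \<in> space \<mu>. X x \<noteq> f k (trunc_word (M k) (m k) x)} < 1 / Suc k" ..
  then have mMf: "\<And>k. M0 \<le> M k" "\<And>k w. f k w \<in> range X"
    "\<And>k. prob {x \<in> space \<mu>. X x \<noteq> f k (trunc_word (M k) (m k) x)} < 1 / Suc k" by blast+
  have "(\<lambda>k. rv_entropy \<mu> (\<lambda>x. (X x, f k (trunc_word (M k) (m k) x))) - rv_entropy \<mu> (\<lambda>x. f k (trunc_word (M k) (m k) x))) \<longlonglongrightarrow> 0"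
  proof (rule conditional_entropy_tendsto_zero[OF X])
    show "simple_function \<mu> (\<lambda>x. f k (trunc_word (M k) (m k) x))" for k
      using simple_function_compose[OF trunc_word_simple, of "f k"] by (simp add: comp_def)
    show "finite (range X)" using simple_functionD(1)[OF X] by simp
    show "(\<lambda>k. prob {x \<in> space \<mu>. X x \<noteq> f k (trunc_word (M k) (m k) x)}) \<longlonglongrightarrow> 0"
    proof (rule tendsto_sandwich[OF _ _ tendsto_const LIMSEQ_inverse_real_of_nat])
      show "\<forall>\<^sub>F k in sequentially. prob {x \<in> space \<mu>. X x \<noteq> f k (trunc_word (M k) (m k) x)} \<le> inverse (real (Suc k))"
        using mMf(3) by (auto simp: inverse_eq_divide intro!: always_eventually less_imp_le)
    qed auto
  qed (use mMf in auto)
  then have "\<forall>\<^sub>F k in sequentially. rv_entropy \<mu> (\<lambda>x. (X x, f k (trunc_word (M k) (m k) x))) - rv_entropy \<mu> (\<lambda>x. f k (trunc_word (M k) (m k) x)) < e"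
    using e by (intro order_tendstoD) auto
  then obtain k where "rv_entropy \<mu> (\<lambda>x. (X x, f k (trunc_word (M k) (m k) x))) - rv_entropy \<mu> (\<lambda>x. f k (trunc_word (M k) (m k) x)) < e"
    unfolding eventually_sequentially by blast
  then show ?thesis using that mMf(1) by blast
qed

text \<open>A finite-level form of the Kolmogorov-Sinai generator theorem: \<open>X\<close> has
  conditional entropy below \<open>h - h'\<close> given a function \<open>Z\<close> of
  \<open>m\<close> truncated digits, and \<open>n\<close> symbols of \<open>Z\<close> are read off
  from \<open>n + m\<close> such digits.\<close>

lemma rv_entropy_trunc_word_ge:
  fixes X :: "real \<Rightarrow> 'b"
  assumes X: "simple_function \<mu> X" "\<And>n. n \<ge> 1 \<Longrightarrow> n * h < rv_entropy \<mu> (itinerary X gauss_map n)" and h': "h' < h"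
  obtains m M where "M0 \<le> M" "\<And>n. n \<ge> 1 \<Longrightarrow> n * h' \<le> rv_entropy \<mu> (trunc_word M (n + m))"
proof -
  have "0 < h - h'" using h' by simp
  then obtain m M and f :: "nat list \<Rightarrow> 'b" where M: "M0 \<le> M"
    and small: "rv_entropy \<mu> (\<lambda>x. (X x, f (trunc_word M m x))) - rv_entropy \<mu> (\<lambda>x. f (trunc_word M m x)) < h - h'"
    by (rule conditional_entropy_small[OF X(1), where ?M0.0 = M0]) blast
  define Z where "Z x = f (trunc_word M m x)" for x
  have Z: "simple_function \<mu> Z"
    using simple_function_compose[OF trunc_word_simple, of f] by (simp add: comp_def Z_def[abs_def])
  have "n * h' \<le> rv_entropy \<mu> (trunc_word M (n + m))" if n: "n \<ge> 1" for n
  proof -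
    have "n * h < rv_entropy \<mu> (itinerary X gauss_map n)" using X(2) n .
    also have "\<dots> \<le> rv_entropy \<mu> (itinerary Z gauss_map n) + n * (rv_entropy \<mu> (\<lambda>x. (X x, Z x)) - rv_entropy \<mu> Z)"
      by (rule rv_entropy_itinerary_compare[OF X(1) Z])
    also have "\<dots> \<le> rv_entropy \<mu> (itinerary Z gauss_map n) + n * (h - h')"
      using small unfolding Z_def[abs_def] by (intro add_left_mono mult_left_mono) auto
    also have "rv_entropy \<mu> (itinerary Z gauss_map n) \<le> rv_entropy \<mu> (trunc_word M (n + m))"
    proof (rule rv_entropy_mono[OF trunc_word_simple simple_function_itinerary[OF Z]])
      fix x y assume "trunc_word M (n + m) x = trunc_word M (n + m) y"
      then have eq: "trunc_digit M ((gauss_map ^^ i) x) = trunc_digit M ((gauss_map ^^ i) y)" if "i < n + m" for i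
        using that by (simp add: trunc_word_def itinerary_eq_iff)
      have "trunc_word M m ((gauss_map ^^ i) x) = trunc_word M m ((gauss_map ^^ i) y)" if "i < n" for i
        unfolding trunc_word_def itinerary_eq_iff
      proof (intro allI impI)
        fix j assume "j < m"
        then show "trunc_digit M ((gauss_map ^^ j) ((gauss_map ^^ i) x)) = trunc_digit M ((gauss_map ^^ j) ((gauss_map ^^ i) y))"
          using eq[of "j + i"] that by (simp add: funpow_add)
      qed
      then show "itinerary Z gauss_map n x = itinerary Z gauss_map n y"
        by (simp add: itinerary_eq_iff Z_def)
    qed
    finally show ?thesis by (simp add: algebra_simps)
  qed
  then show ?thesis using that M by blast
qed

lemma integral_funpow:
  fixes g :: "real \<Rightarrow> real"
  assumes "integrable \<mu> g"
  shows "integrable \<mu> (\<lambda>x. g ((gauss_map ^^ i) x))" "(\<integral>x. g ((gauss_map ^^ i) x) \<partial>\<mu>) = (\<integral>x. g x \<partial>\<mu>)"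
proof -
  have "integrable (distr \<mu> \<mu> (gauss_map ^^ i)) g" unfolding funpow_invariant by (rule assms)
  then show "integrable \<mu> (\<lambda>x. g ((gauss_map ^^ i) x))" by (rule integrable_distr[OF funpow_measurable])
  have "(\<integral>x. g x \<partial>distr \<mu> \<mu> (gauss_map ^^ i)) = (\<integral>x. g ((gauss_map ^^ i) x) \<partial>\<mu>)"
    by (rule integral_distr[OF funpow_measurable borel_measurable_integrable[OF assms]])
  then show "(\<integral>x. g ((gauss_map ^^ i) x) \<partial>\<mu>) = (\<integral>x. g x \<partial>\<mu>)" unfolding funpow_invariant by simp
qed

text \<open>Truncation lowers the continuant, which is at most the denominator at the tail; the
  logarithm of the latter is a Birkhoff sum, integrated term by term through invariance.\<close>

lemma expectation_cf_log_trunc_word_le: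
  assumes M: "1 \<le> M" and fin: "lyapunov_exponent \<mu> < \<infinity>"
  shows "(\<integral>x. cf_log (trunc_word M n x) \<partial>\<mu>) \<le> n * enn2real (lyapunov_exponent \<mu>)"
proof -
  have AE0: "AE x in \<mu>. 0 \<le> - 2 * ln x"
    using AE_points
  proof eventually_elim
    case (elim x)
    then show ?case using cf_pointsD[OF elim] by simp
  qed
  have meas: "(\<lambda>x. - 2 * ln x) \<in> borel_measurable \<mu>" unfolding measurable_mu by measurable
  have int: "integrable \<mu> (\<lambda>x. - 2 * ln x)"
    using fin AE0 meas unfolding lyapunov_exponent_eq[OF invariant] by (intro integrableI_nonneg) auto
  have val: "(\<integral>x. - 2 * ln x \<partial>\<mu>) = enn2real (lyapunov_exponent \<mu>)"
    unfolding lyapunov_exponent_eq[OF invariant] using AE0 meas by (intro integral_eq_nn_integral) auto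
  have "(\<integral>x. cf_log (trunc_word M n x) \<partial>\<mu>) \<le> (\<integral>x. (\<Sum>i<n. - 2 * ln ((gauss_map ^^ i) x)) \<partial>\<mu>)"
  proof (rule integral_mono_AE)
    show "integrable \<mu> (\<lambda>x. cf_log (trunc_word M n x))"
      by (rule expectation_simple(1)[OF trunc_word_simple])
    show "integrable \<mu> (\<lambda>x. \<Sum>i<n. - 2 * ln ((gauss_map ^^ i) x))"
      using integral_funpow(1)[OF int] by (intro Bochner_Integration.integrable_sum)
    show "AE x in \<mu>. cf_log (trunc_word M n x) \<le> (\<Sum>i<n. - 2 * ln ((gauss_map ^^ i) x))"
      using AE_points
    proof eventually_elim
      case (elim x)
      then show ?case
        using cf_log_trunc_word_le[OF elim M, of n] cf_log_cf_word_bounds(1)[OF elim, of n] by linarith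
    qed
  qed
  also have "\<dots> = (\<Sum>i<n. \<integral>x. - 2 * ln ((gauss_map ^^ i) x) \<partial>\<mu>)"
    using integral_funpow(1)[OF int] by (intro Bochner_Integration.integral_sum)
  also have "\<dots> = n * enn2real (lyapunov_exponent \<mu>)"
    using integral_funpow(2)[OF int] val by simp
  finally show ?thesis .
qed

lemma expectation_digit_sum_trunc_word:
  "(\<integral>x. digit_sum \<gamma> (trunc_word M n x) \<partial>\<mu>) = n * (\<integral>x. real (trunc_digit M x) powr \<gamma> \<partial>\<mu>)"
proof -
  have int: "integrable \<mu> (\<lambda>x. real (trunc_digit M x) powr \<gamma>)"
    by (rule expectation_simple(1)[OF trunc_digit_simple])
  have "digit_sum \<gamma> (trunc_word M n x) = (\<Sum>i<n. real (trunc_digit M ((gauss_map ^^ i) x)) powr \<gamma>)" for x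
    by (simp add: digit_sum_def trunc_word_def itinerary_def comp_def interv_sum_list_conv_sum_set_nat lessThan_atLeast0)
  then have "(\<integral>x. digit_sum \<gamma> (trunc_word M n x) \<partial>\<mu>) =
      (\<Sum>i<n. \<integral>x. real (trunc_digit M ((gauss_map ^^ i) x)) powr \<gamma> \<partial>\<mu>)"
    using integral_funpow(1)[OF int] by (simp add: Bochner_Integration.integral_sum)
  then show ?thesis using integral_funpow(2)[OF int] by simp
qed

lemma trunc_digit_mean_tendsto:
  assumes \<gamma>: "0 < \<gamma>" and int: "integrable \<mu> (phi \<gamma>)" and val: "(\<integral>x. phi \<gamma> x \<partial>\<mu>) = - \<alpha>"
  shows "(\<lambda>M. \<integral>x. real (trunc_digit M x) powr \<gamma> \<partial>\<mu>) \<longlonglongrightarrow> \<alpha>"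
proof -
  have "(\<lambda>M. \<integral>x. real (trunc_digit M x) powr \<gamma> \<partial>\<mu>) \<longlonglongrightarrow> (\<integral>x. - phi \<gamma> x \<partial>\<mu>)"
  proof (rule integral_dominated_convergence)
    show "integrable \<mu> (\<lambda>x. - phi \<gamma> x)" using int by simp
    show "(\<lambda>x. - phi \<gamma> x) \<in> borel_measurable \<mu>" using int by (auto dest: borel_measurable_integrable)
    show "(\<lambda>x. real (trunc_digit M x) powr \<gamma>) \<in> borel_measurable \<mu>" for M
      using expectation_simple(1)[OF trunc_digit_simple] by (rule borel_measurable_integrable)
    show "AE x in \<mu>. norm (real (trunc_digit M x) powr \<gamma>) \<le> - phi \<gamma> x" for M
      using \<gamma> by (auto simp: phi_def cf_digit_def trunc_digit_def intro!: AE_I2 powr_mono2)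
    show "AE x in \<mu>. (\<lambda>M. real (trunc_digit M x) powr \<gamma>) \<longlonglongrightarrow> - phi \<gamma> x"
    proof (rule AE_I2, rule tendsto_eventually)
      fix x
      show "\<forall>\<^sub>F M in sequentially. real (trunc_digit M x) powr \<gamma> = - phi \<gamma> x"
        using eventually_ge_at_top[of "nat \<lfloor>1 / x\<rfloor>"]
        by eventually_elim (simp add: phi_def cf_digit_def trunc_digit_def)
    qed
  qed
  then show ?thesis using val by simp
qed

text \<open>Truncated words keep an entropy of \<open>s * l\<close> per digit up to a constant,
  while their mean \<open>cf_log\<close> is at most \<open>l\<close> per digit; one truncation level
  serves both the entropy and the digit mean.\<close>

lemma word_distributions:
  assumes \<gamma>: "0 < \<gamma>" and int: "integrable \<mu> (phi \<gamma>)" and val: "(\<integral>x. phi \<gamma> x \<partial>\<mu>) = - \<alpha>"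
    and fin: "lyapunov_exponent \<mu> < \<infinity>"
    and s: "0 < s" "ennreal s < measure_entropy \<mu> gauss_map / lyapunov_exponent \<mu>"
  shows "almost_optimal_words \<alpha> \<gamma> s"
  unfolding almost_optimal_words_def
proof (intro allI impI)
  fix \<delta> :: real assume \<delta>: "0 < \<delta>"
  define l where "l = enn2real (lyapunov_exponent \<mu>)"
  have le: "lyapunov_exponent \<mu> = ennreal l" using fin by (simp add: l_def less_top)
  have l: "0 < l" using lyapunov_exponent_pos[OF invariant] le by (cases "0 < l") (auto simp: ennreal_neg)
  \<comment> \<open>The intermediate value leaves the room that the passage from \<open>X\<close> to
    truncated words consumes.\<close>
  obtain t where t: "ennreal s < t" "t < measure_entropy \<mu> gauss_map / lyapunov_exponent \<mu>"
    using dense[OF s(2)] by blast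
  then obtain s1 where s1: "t = ennreal s1" "0 \<le> s1" by (cases t) (auto simp: top_unique)
  have ss1: "s < s1" using t(1) s(1) s1 by (simp add: ennreal_less_iff)
  have h: "ennreal (s1 * l) < measure_entropy \<mu> gauss_map"
  proof (rule ccontr)
    assume "\<not> ennreal (s1 * l) < measure_entropy \<mu> gauss_map"
    then have "measure_entropy \<mu> gauss_map \<le> ennreal s1 * lyapunov_exponent \<mu>"
      using s1 l by (simp add: le not_less ennreal_mult)
    then have "measure_entropy \<mu> gauss_map / lyapunov_exponent \<mu> \<le> ennreal s1 * lyapunov_exponent \<mu> / lyapunov_exponent \<mu>"
      by (rule divide_right_mono_ennreal)
    also have "\<dots> = ennreal s1"
      using lyapunov_exponent_pos[OF invariant] fin by (intro ennreal_mult_divide_eq) (auto simp: less_top)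
    finally show False using t(2) s1 by simp
  qed
  obtain X :: "real \<Rightarrow> real set" where X: "simple_function \<mu> X"
    "\<And>n. n \<ge> 1 \<Longrightarrow> n * (s1 * l) < rv_entropy \<mu> (itinerary X gauss_map n)"
    using measure_entropy_gt_obtains[OF h] s1 l by auto
  have "\<forall>\<^sub>F M in sequentially. dist (\<integral>x. real (trunc_digit M x) powr \<gamma> \<partial>\<mu>) \<alpha> < \<delta>"
    using tendstoD[OF trunc_digit_mean_tendsto[OF \<gamma> int val] \<delta>] .
  then obtain M0 where M0: "\<And>M. M0 \<le> M \<Longrightarrow> \<bar>(\<integral>x. real (trunc_digit M x) powr \<gamma> \<partial>\<mu>) - \<alpha>\<bar> < \<delta>"
    unfolding eventually_sequentially dist_real_def by blast
  obtain m M where M: "max 1 M0 \<le> M"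
    and ent: "\<And>n. n \<ge> 1 \<Longrightarrow> n * (s * l) \<le> rv_entropy \<mu> (trunc_word M (n + m))"
  proof -
    have "s * l < s1 * l" using ss1 l by simp
    then show ?thesis using rv_entropy_trunc_word_ge[OF X, of "s * l" "max 1 M0"] that by blast
  qed
  show "\<exists>C. \<forall>n0. \<exists>n\<ge>n0. \<exists>W p. word_distribution n W p \<and>
      \<bar>(\<Sum>w\<in>W. p w * digit_sum \<gamma> w) / n - \<alpha>\<bar> \<le> \<delta> \<and>
      s * (\<Sum>w\<in>W. p w * cf_log w) - C \<le> word_entropy W p"
  \<comment> \<open>The constant pays for the \<open>m\<close> digits by which the words exceed the
    coded length.\<close>
  proof (intro exI[of _ "m * (s * l)"] allI)
    fix n0
    define n where "n = Suc n0 + m"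
    have M1: "1 \<le> M" using M by simp
    obtain W p where W: "word_distribution n W p"
      "\<And>f. (\<Sum>w\<in>W. p w * f w) = (\<integral>x. f (trunc_word M n x) \<partial>\<mu>)"
      "word_entropy W p = rv_entropy \<mu> (trunc_word M n)"
      using word_distribution_trunc_word[OF M1, of n] by blast
    have mean: "(\<Sum>w\<in>W. p w * digit_sum \<gamma> w) / n = (\<integral>x. real (trunc_digit M x) powr \<gamma> \<partial>\<mu>)"
      unfolding W(2) expectation_digit_sum_trunc_word by (simp add: n_def)
    have "s * (\<Sum>w\<in>W. p w * cf_log w) - m * (s * l) \<le> s * (n * l) - m * (s * l)"
      using expectation_cf_log_trunc_word_le[OF M1 fin, of n] s(1) unfolding W(2) l_def
      by (intro diff_right_mono mult_left_mono) auto
    also have "\<dots> = Suc n0 * (s * l)" by (simp add: n_def algebra_simps)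
    also have "\<dots> \<le> word_entropy W p" using ent[of "Suc n0"] W(3) by (simp add: n_def)
    finally show "\<exists>n\<ge>n0. \<exists>W p. word_distribution n W p \<and>
      \<bar>(\<Sum>w\<in>W. p w * digit_sum \<gamma> w) / n - \<alpha>\<bar> \<le> \<delta> \<and>
      s * (\<Sum>w\<in>W. p w * cf_log w) - m * (s * l) \<le> word_entropy W p"
      using W(1) mean M0[of M] M by (intro exI[of _ n] conjI exI[of _ W] exI[of _ p]) (auto simp: n_def)
  qed
qed

end

section \<open>Word distributions from coverings\<close>

lemma hausdorff_premeasure_mono: "A \<subseteq> B \<Longrightarrow> hausdorff_premeasure s \<delta> A \<le> hausdorff_premeasure s \<delta> B"
  unfolding hausdorff_premeasure_def by (rule INF_superset_mono) auto

text \<open>Covers with errors e/2, e/4, ... are merged through \<open>prod_decode\<close> at an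
  unchanged scale. It serves to find, among the sets of points with uniformly controlled digit
  means, one that is not null.\<close>

lemma hausdorff_premeasure_Union_null:
  fixes A :: "nat \<Rightarrow> 'a::metric_space set"
  assumes "\<And>N. hausdorff_premeasure s \<delta> (A N) = 0"
  shows "hausdorff_premeasure s \<delta> (\<Union>N. A N) = 0"
proof -
  have "hausdorff_premeasure s \<delta> (\<Union>N. A N) \<le> ennreal e" if e: "0 < e" for e
  proof -
    have "\<exists>U. A N \<subseteq> (\<Union>i. U i) \<and> (\<forall>i. bounded (U i) \<and> diameter (U i) \<le> \<delta>) \<and>
        (\<Sum>i. ennreal (diam_power s (U i))) < ennreal (e * (1/2) ^ Suc N)" for N
    proof -
      have "hausdorff_premeasure s \<delta> (A N) < ennreal (e * (1/2) ^ Suc N)"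
        using assms e by (simp add: ennreal_less_zero_iff)
      then show ?thesis unfolding hausdorff_premeasure_def INF_less_iff by blast
    qed
    then have "\<forall>N. \<exists>U. A N \<subseteq> (\<Union>i. U i) \<and> (\<forall>i. bounded (U i) \<and> diameter (U i) \<le> \<delta>) \<and>
        (\<Sum>i. ennreal (diam_power s (U i))) < ennreal (e * (1/2) ^ Suc N)" by blast
    from choice[OF this] obtain U where U: "\<And>N. A N \<subseteq> (\<Union>i. U N i)"
      "\<And>N i. bounded (U N i) \<and> diameter (U N i) \<le> \<delta>"
      "\<And>N. (\<Sum>i. ennreal (diam_power s (U N i))) < ennreal (e * (1/2) ^ Suc N)" by blast
    let ?V = "\<lambda>k. case prod_decode k of (N, i) \<Rightarrow> U N i"
    have "(\<Union>N. A N) \<subseteq> (\<Union>k. ?V k)"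
    proof
      fix x assume "x \<in> (\<Union>N. A N)"
      then obtain N i where "x \<in> U N i" using U(1) by blast
      then show "x \<in> (\<Union>k. ?V k)" by (intro UN_I[of "prod_encode (N, i)"]) auto
    qed
    then have "hausdorff_premeasure s \<delta> (\<Union>N. A N) \<le> (\<Sum>k. ennreal (diam_power s (?V k)))"
      unfolding hausdorff_premeasure_def using U(2) by (intro INF_lower) (auto split: prod.split)
    also have "\<dots> = (\<Sum>k. (\<lambda>(N, i). ennreal (diam_power s (U N i))) (prod_decode k))"
      by (intro suminf_cong) (simp split: prod.split)
    also have "\<dots> = (\<Sum>N. \<Sum>i. ennreal (diam_power s (U N i)))"
      by (rule suminf_ennreal_2dimen) simp
    also have "\<dots> \<le> (\<Sum>N. ennreal (e * (1/2) ^ Suc N))"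
      using U(3) by (intro suminf_le less_imp_le) auto
    also have "\<dots> = ennreal e"
    proof -
      have "(\<lambda>N. e * (1/2) ^ Suc N) sums (e * 1)" by (intro sums_mult power_half_series)
      then show ?thesis using e by (intro suminf_ennreal_eq) auto
    qed
    finally show ?thesis .
  qed
  note le = this
  have "hausdorff_premeasure s \<delta> (\<Union>N. A N) \<le> 0"
  proof (rule ennreal_le_epsilon)
    fix e :: real assume "0 < e"
    from le[OF this] show "hausdorff_premeasure s \<delta> (\<Union>N. A N) \<le> 0 + ennreal e" by (simp only: add_0)
  qed
  then show ?thesis by simp
qed

text \<open>For \<gamma> > 0 the digit sum dominates the power of each single digit. Despite the
  infinite alphabet, sums over admissible words are thus finite.\<close>

lemma finite_words_digit_sum_le:
  assumes "0 < \<gamma>"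
  shows "finite {w. length w = n \<and> digit_sum \<gamma> w \<le> B}"
proof -
  have "a \<le> nat \<lceil>max 0 B powr (1 / \<gamma>)\<rceil>" if "digit_sum \<gamma> w \<le> B" "a \<in> set w" for w a
  proof -
    have "real a powr \<gamma> \<le> digit_sum \<gamma> w"
      unfolding digit_sum_def using that(2) by (intro member_le_sum_list) auto
    then have "real a powr \<gamma> \<le> max 0 B" using that(1) by linarith
    then have "(real a powr \<gamma>) powr (1 / \<gamma>) \<le> max 0 B powr (1 / \<gamma>)" using assms by (intro powr_mono2) auto
    then have "real a \<le> max 0 B powr (1 / \<gamma>)" using assms by (simp add: powr_powr)
    from order.trans[OF this real_nat_ceiling_ge] show ?thesis by (simp only: of_nat_le_iff)
  qed
  then have "{w. length w = n \<and> digit_sum \<gamma> w \<le> B} \<subseteq> {w. set w \<subseteq> {..nat \<lceil>max 0 B powr (1 / \<gamma>)\<rceil>} \<and> length w = n}"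
    by blast
  then show ?thesis by (rule finite_subset) (simp add: finite_lists_length_eq)
qed

text \<open>The images of [0,1] under the Moebius maps are the covering sets: distortion bounds
  their diameters, and the enumeration is padded with empty sets, which count 0.\<close>

lemma hausdorff_premeasure_cylinders_le:
  assumes W: "finite W" "\<And>w. w \<in> W \<Longrightarrow> 0 \<notin> set w" and s: "0 < s"
    and small: "\<And>w. w \<in> W \<Longrightarrow> exp (- cf_log w) \<le> \<delta>" and \<delta>: "0 \<le> \<delta>"
    and cover: "A \<subseteq> (\<Union>w\<in>W. cf_fold w ` {0..1})"
  shows "hausdorff_premeasure s \<delta> A \<le> ennreal (\<Sum>w\<in>W. exp (- s * cf_log w))"
proof -
  obtain h where h: "bij_betw h {0..<card W} W" using ex_bij_betw_nat_finite[OF W(1)] by blast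
  define J where "J w = cf_fold w ` {0..1::real}" for w
  define U where "U i = (if i < card W then J (h i) else {})" for i
  have hW: "h i \<in> W" if "i < card W" for i using h that by (auto simp: bij_betw_def)
  have dist: "dist x y \<le> exp (- cf_log w)" if w: "w \<in> W" and xy: "x \<in> J w" "y \<in> J w" for w x y
  proof -
    obtain a b where ab: "x = cf_fold w a" "y = cf_fold w b" "0 \<le> a" "a \<le> 1" "0 \<le> b" "b \<le> 1"
      using xy by (auto simp: J_def)
    have "\<bar>x - y\<bar> \<le> \<bar>a - b\<bar> * exp (- cf_log w)"
      unfolding ab(1,2) using ab W(2)[OF w] by (intro cf_fold_diff_le) auto
    also have "\<dots> \<le> 1 * exp (- cf_log w)" using ab by (intro mult_right_mono) auto
    finally show ?thesis by (simp add: dist_real_def)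
  qed
  have diam: "bounded (J w)" "diameter (J w) \<le> exp (- cf_log w)" "J w \<noteq> {}" if "w \<in> W" for w
  proof -
    show "J w \<noteq> {}" by (simp add: J_def)
    then obtain x where "x \<in> J w" by auto
    then show "bounded (J w)" using dist[OF that] unfolding bounded_def by blast
    show "diameter (J w) \<le> exp (- cf_log w)"
      using dist[OF that] by (intro diameter_le) (auto simp: dist_norm)
  qed
  have "A \<subseteq> (\<Union>i. U i)"
  proof
    fix x assume "x \<in> A"
    then obtain w where w: "w \<in> W" "x \<in> J w" using cover by (auto simp: J_def)
    then obtain i where "i < card W" "h i = w" using h unfolding bij_betw_def by (metis atLeastLessThan_iff imageE)
    then show "x \<in> (\<Union>i. U i)" using w by (intro UN_I[of i]) (auto simp: U_def)
  qed
  moreover have "bounded (U i) \<and> diameter (U i) \<le> \<delta>" for i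
    using diam(1,2)[OF hW] order.trans[OF diam(2)[OF hW] small[OF hW]] \<delta> by (auto simp: U_def)
  ultimately have "hausdorff_premeasure s \<delta> A \<le> (\<Sum>i. ennreal (diam_power s (U i)))"
    unfolding hausdorff_premeasure_def by (intro INF_lower) auto
  also have "\<dots> = (\<Sum>i<card W. ennreal (diam_power s (U i)))"
    by (rule suminf_finite) (auto simp: U_def diam_power_def)
  also have "\<dots> = (\<Sum>i<card W. ennreal (diam_power s (J (h i))))"
    by (intro sum.cong) (auto simp: U_def)
  also have "\<dots> = (\<Sum>w\<in>W. ennreal (diam_power s (J w)))"
    using h unfolding lessThan_atLeast0 by (rule sum.reindex_bij_betw)
  also have "\<dots> \<le> (\<Sum>w\<in>W. ennreal (exp (- s * cf_log w)))"
  proof (intro sum_mono ennreal_leI)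
    fix w assume w: "w \<in> W"
    have "diam_power s (J w) = diameter (J w) powr s" using diam(3)[OF w] s by (simp add: diam_power_def)
    also have "\<dots> \<le> exp (- cf_log w) powr s"
      using diam[OF w] s by (intro powr_mono2) (auto intro: diameter_ge_0)
    finally show "diam_power s (J w) \<le> exp (- s * cf_log w)" by (simp add: powr_def)
  qed
  also have "\<dots> = ennreal (\<Sum>w\<in>W. exp (- s * cf_log w))" by (rule sum_ennreal) auto
  finally show ?thesis .
qed

text \<open>The lower bound for the sum comes from covering: cylinders of admissible words of length
  \<open>n\<close> cover \<open>A N\<close>, whose premeasure at a fixed scale exceeds
  \<open>c\<close>. As \<open>c\<close> does not depend on \<open>n\<close>, \<open>- ln c\<close>
  can serve as the constant.\<close>

lemma word_distributions_of_hausdorff_dim: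
  assumes \<gamma>: "0 < \<gamma>" and s: "0 < s" "ennreal s < hausdorff_dim (cf_mean_set \<alpha> \<gamma>)"
  shows "almost_optimal_words \<alpha> \<gamma> s"
  unfolding almost_optimal_words_def
proof (intro allI impI)
  fix \<delta> :: real assume \<delta>: "0 < \<delta>"
  have "hausdorff_measure s (cf_mean_set \<alpha> \<gamma>) \<noteq> 0"
  proof
    assume "hausdorff_measure s (cf_mean_set \<alpha> \<gamma>) = 0"
    then have "hausdorff_dim (cf_mean_set \<alpha> \<gamma>) \<le> ennreal s"
      unfolding hausdorff_dim_def using s(1) by (intro Inf_lower CollectI exI[of _ s]) auto
    then show False using s(2) by simp
  qed
  then have "0 < hausdorff_measure s (cf_mean_set \<alpha> \<gamma>)" by (simp add: zero_less_iff_neq_zero)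
  then obtain \<delta>0 where \<delta>0: "0 < \<delta>0" "hausdorff_premeasure s \<delta>0 (cf_mean_set \<alpha> \<gamma>) \<noteq> 0"
    unfolding hausdorff_measure_def less_SUP_iff by auto
  \<comment> \<open>A common \<open>N\<close> is required in order that admissible words of one
    single length cover the set.\<close>
  define A where "A N = {x \<in> cf_points. \<forall>n\<ge>N. \<bar>digit_sum \<gamma> (cf_word x n) / n - \<alpha>\<bar> < \<delta>}" for N
  have "cf_mean_set \<alpha> \<gamma> \<subseteq> (\<Union>N. A N)"
  proof
    fix x assume x: "x \<in> cf_mean_set \<alpha> \<gamma>"
    then have pt: "x \<in> cf_points" by (auto simp: cf_mean_set_def intro: irrational_cf_points)
    have "(\<Sum>i=1..n. real (cf_digit x i) powr \<gamma>) = digit_sum \<gamma> (cf_word x n)" for n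
    proof -
      have "digit_sum \<gamma> (cf_word x n) = (\<Sum>i<n. real (cf_digit x (Suc i)) powr \<gamma>)"
        by (simp add: digit_sum_def cf_word_def comp_def interv_sum_list_conv_sum_set_nat lessThan_atLeast0 cf_digit_def)
      also have "\<dots> = (\<Sum>i=1..n. real (cf_digit x i) powr \<gamma>)"
        by (rule sum.reindex_bij_witness[of _ "\<lambda>i. i - 1" Suc]) auto
      finally show ?thesis by simp
    qed
    then have "(\<lambda>n. digit_sum \<gamma> (cf_word x n) / n) \<longlonglongrightarrow> \<alpha>" using x by (simp add: cf_mean_set_def)
    from tendstoD[OF this \<delta>] obtain N where "\<And>n. N \<le> n \<Longrightarrow> \<bar>digit_sum \<gamma> (cf_word x n) / n - \<alpha>\<bar> < \<delta>"
      unfolding eventually_sequentially dist_real_def by blast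
    then show "x \<in> (\<Union>N. A N)" using pt by (auto simp: A_def)
  qed
  then have "hausdorff_premeasure s \<delta>0 (\<Union>N. A N) \<noteq> 0"
    using hausdorff_premeasure_mono[of "cf_mean_set \<alpha> \<gamma>" "\<Union>N. A N" s \<delta>0] \<delta>0(2) by auto
  then obtain N where N: "hausdorff_premeasure s \<delta>0 (A N) \<noteq> 0"
    using hausdorff_premeasure_Union_null[of s \<delta>0 A] by blast
  then obtain c where c: "0 < c" "ennreal c < hausdorff_premeasure s \<delta>0 (A N)"
  proof -
    obtain t where t: "0 < t" "t < hausdorff_premeasure s \<delta>0 (A N)"
      using dense[of 0 "hausdorff_premeasure s \<delta>0 (A N)"] N by (auto simp: zero_less_iff_neq_zero)
    then show ?thesis using that by (cases t) (auto simp: top_unique)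
  qed
  obtain k where k: "(1/2::real) ^ k < \<delta>0" using real_arch_pow_inv[of \<delta>0 "1/2"] \<delta>0(1) by auto
  show "\<exists>C. \<forall>n0. \<exists>n\<ge>n0. \<exists>W p. word_distribution n W p \<and>
      \<bar>(\<Sum>w\<in>W. p w * digit_sum \<gamma> w) / n - \<alpha>\<bar> \<le> \<delta> \<and>
      s * (\<Sum>w\<in>W. p w * cf_log w) - C \<le> word_entropy W p"
  proof (intro exI[of _ "- ln c"] allI)
    fix n0
    \<comment> \<open>At least \<open>n0\<close> as demanded, past \<open>N\<close> so that the
      words are admissible, and longer than \<open>k\<close> so that cylinders are smaller than
      \<open>\<delta>0\<close>.\<close>
    define n where "n = Suc (n0 + N + k)"
    define W where "W = {w. length w = n \<and> 0 \<notin> set w \<and> \<bar>digit_sum \<gamma> w / n - \<alpha>\<bar> < \<delta>}"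
    have fin: "finite W"
    proof (rule finite_subset[OF _ finite_words_digit_sum_le[OF \<gamma>, of n "n * (\<alpha> + \<delta>)"]])
      have "digit_sum \<gamma> w \<le> n * (\<alpha> + \<delta>)" if "\<bar>digit_sum \<gamma> w / n - \<alpha>\<bar> < \<delta>" for w
      proof -
        have "digit_sum \<gamma> w / n \<le> \<alpha> + \<delta>" using that by linarith
        then show ?thesis by (simp add: n_def divide_le_eq mult.commute)
      qed
      then show "W \<subseteq> {w. length w = n \<and> digit_sum \<gamma> w \<le> n * (\<alpha> + \<delta>)}" by (auto simp: W_def)
    qed
    define Z where "Z = (\<Sum>w\<in>W. exp (- s * cf_log w))"
    have "hausdorff_premeasure s \<delta>0 (A N) \<le> ennreal Z"
      unfolding Z_def
    proof (rule hausdorff_premeasure_cylinders_le[OF fin _ s(1)])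
      show "exp (- cf_log w) \<le> \<delta>0" if "w \<in> W" for w
      proof -
        have "real k * ln 2 \<le> real (length w - 1) * ln 2"
          using that by (intro mult_right_mono) (auto simp: W_def n_def)
        also have "\<dots> \<le> cf_log w" using that by (intro cf_log_growth) (auto simp: W_def)
        finally have "exp (- cf_log w) \<le> exp (- (real k * ln 2))" by simp
        also have "\<dots> = (1/2::real) ^ k"
          by (simp add: exp_minus exp_of_nat_mult power_one_over inverse_eq_divide)
        finally show ?thesis using k by simp
      qed
      show "A N \<subseteq> (\<Union>w\<in>W. cf_fold w ` {0..1})"
      proof
        fix x assume x: "x \<in> A N"
        then have pt: "x \<in> cf_points" by (simp add: A_def)
        have "cf_word x n \<in> W"
        proof -
          have "N \<le> n" by (simp add: n_def)
          then show ?thesis using x cf_word_nonzero[OF pt] by (simp add: W_def A_def)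
        qed
        moreover have "x \<in> cf_fold (cf_word x n) ` {0..1}"
          using cf_fold_cf_word[OF pt, of n] cf_pointsD[OF funpow_gauss_map_cf_points[OF pt, of n]]
          by (intro image_eqI[of _ _ "(gauss_map ^^ n) x"]) auto
        ultimately show "x \<in> (\<Union>w\<in>W. cf_fold w ` {0..1})" by blast
      qed
    qed (use \<delta>0(1) in \<open>auto simp: W_def\<close>)
    then have "ennreal c < ennreal Z" using c(2) by (rule order.strict_trans2[rotated])
    then have Z: "c < Z" using c(1) by (simp add: ennreal_less_iff)
    then have Z0: "0 < Z" using c(1) by simp
    define p where "p w = exp (- s * cf_log w) / Z" for w
    have p: "0 < p w" for w using Z0 by (simp add: p_def)
    have one: "(\<Sum>w\<in>W. p w) = 1"
      using Z0 unfolding p_def sum_divide_distrib[symmetric] Z_def[symmetric] by simp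
    have "word_distribution n W p"
      unfolding word_distribution_def using fin one p by (auto simp: W_def less_imp_le)
    moreover have "\<bar>(\<Sum>w\<in>W. p w * digit_sum \<gamma> w) / n - \<alpha>\<bar> \<le> \<delta>"
    proof -
      have "(\<Sum>w\<in>W. p w * digit_sum \<gamma> w) / n - \<alpha> = (\<Sum>w\<in>W. p w * (digit_sum \<gamma> w / n - \<alpha>))"
        using one by (simp add: right_diff_distrib sum_subtractf sum_divide_distrib flip: sum_distrib_right)
      also have "\<bar>\<dots>\<bar> \<le> (\<Sum>w\<in>W. \<bar>p w * (digit_sum \<gamma> w / n - \<alpha>)\<bar>)" by (rule sum_abs)
      also have "\<dots> \<le> (\<Sum>w\<in>W. p w * \<delta>)"
        using p by (intro sum_mono) (auto simp: abs_mult W_def less_imp_le intro!: mult_left_mono)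
      also have "\<dots> = \<delta>" using one by (simp flip: sum_distrib_right)
      finally show ?thesis .
    qed
    moreover have "s * (\<Sum>w\<in>W. p w * cf_log w) - - ln c \<le> word_entropy W p"
    proof -
      \<comment> \<open>The logarithm of a weight is affine in \<open>cf_log\<close>, which makes
        the entropy an exact expression in the mean of \<open>cf_log\<close> and
        \<open>ln Z\<close>.\<close>
      have lnp: "ln (p w) = - s * cf_log w - ln Z" for w using Z0 by (simp add: p_def ln_div)
      have "word_entropy W p = (\<Sum>w\<in>W. s * (p w * cf_log w) + p w * ln Z)"
        unfolding word_entropy_def lnp by (simp add: algebra_simps)
      also have "\<dots> = s * (\<Sum>w\<in>W. p w * cf_log w) + ln Z"
        using one by (simp add: sum.distrib sum_distrib_left flip: sum_distrib_right)
      finally show ?thesis using Z c(1) by simp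
    qed
    ultimately show "\<exists>n\<ge>n0. \<exists>W p. word_distribution n W p \<and>
      \<bar>(\<Sum>w\<in>W. p w * digit_sum \<gamma> w) / n - \<alpha>\<bar> \<le> \<delta> \<and>
      s * (\<Sum>w\<in>W. p w * cf_log w) - - ln c \<le> word_entropy W p"
      by (intro exI[of _ n]) (auto simp: n_def)
  qed
qed

text \<open>If \<open>a\<close> exceeded \<open>b\<close>, two reals would fit strictly between
  them, even for infinite \<open>a\<close>; their gap absorbs the loss from \<open>s\<close> to
  \<open>s'\<close> when a mean is corrected.\<close>

lemma ennreal_le_of_real_approx:
  fixes a b :: ennreal
  assumes "\<And>s s'. 0 < s' \<Longrightarrow> s' < s \<Longrightarrow> ennreal s < a \<Longrightarrow> ennreal s' \<le> b"
  shows "a \<le> b"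
proof (rule ccontr)
  assume "\<not> a \<le> b"
  then obtain c where c: "b < c" "c < a" using dense[of b a] by (auto simp: not_le)
  obtain d where d: "b < d" "d < c" using dense[OF c(1)] by blast
  obtain s where s: "c = ennreal s" "0 \<le> s" using c(2) by (cases c) (auto simp: top_unique)
  obtain s' where s': "d = ennreal s'" "0 \<le> s'" using d(2) by (cases d) (auto simp: top_unique)
  have "0 < s'" using d(1) s' by (cases "s' = 0") auto
  moreover have "s' < s" using d(2) s s' by (simp add: ennreal_less_iff)
  ultimately have "ennreal s' \<le> b" using assms c(2) s by blast
  then show False using d(1) s' by simp
qed

theorem corollary6p2:
  fixes \<alpha> \<gamma> :: real
  assumes "\<gamma> > 0" and "\<alpha> > 1"
  shows "hausdorff_dim (cf_mean_set \<alpha> \<gamma>) =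
    Sup {measure_entropy \<mu> gauss_map / lyapunov_exponent \<mu> | \<mu>.
           \<mu> \<in> gauss_invariant_measures \<and>
           integrable \<mu> (phi \<gamma>) \<and> (\<integral>x. phi \<gamma> x \<partial>\<mu>) = - \<alpha> \<and>
           lyapunov_exponent \<mu> < \<infinity>}"
  unfolding variational_dim_def[symmetric]
proof (rule antisym)
  show "hausdorff_dim (cf_mean_set \<alpha> \<gamma>) \<le> variational_dim \<alpha> \<gamma>"
  proof (rule ennreal_le_of_real_approx)
    fix s s' :: real assume s: "0 < s'" "s' < s" "ennreal s < hausdorff_dim (cf_mean_set \<alpha> \<gamma>)"
    show "ennreal s' \<le> variational_dim \<alpha> \<gamma>"
      by (rule dim_ge_of_word_distributions(2)[OF assms(2,1) s(1,2)])
        (rule word_distributions_of_hausdorff_dim[OF assms(1) order.strict_trans[OF s(1,2)] s(3)])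
  qed
  show "variational_dim \<alpha> \<gamma> \<le> hausdorff_dim (cf_mean_set \<alpha> \<gamma>)"
    unfolding variational_dim_def
  proof (rule Sup_least, clarify)
    fix \<mu> assume \<mu>: "\<mu> \<in> gauss_invariant_measures" "integrable \<mu> (phi \<gamma>)" "(\<integral>x. phi \<gamma> x \<partial>\<mu>) = - \<alpha>"
      "lyapunov_exponent \<mu> < \<infinity>"
    interpret gauss_invariant \<mu> by unfold_locales (rule \<mu>(1))
    show "measure_entropy \<mu> gauss_map / lyapunov_exponent \<mu> \<le> hausdorff_dim (cf_mean_set \<alpha> \<gamma>)"
    proof (rule ennreal_le_of_real_approx)
      fix s s' :: real
      assume s: "0 < s'" "s' < s" "ennreal s < measure_entropy \<mu> gauss_map / lyapunov_exponent \<mu>"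
      show "ennreal s' \<le> hausdorff_dim (cf_mean_set \<alpha> \<gamma>)"
        by (rule dim_ge_of_word_distributions(1)[OF assms(2,1) s(1,2)])
          (rule word_distributions[OF assms(1) \<mu>(2,3,4) order.strict_trans[OF s(1,2)] s(3)])
    qed
  qed
qed

end
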